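(* There exists a function $c:(0,+\infty)\to[1/2,3/2]$ of class $C^\infty$ with the following two properties: (1) $c\notin W^{s,1}((0,T))$ for every $T>0$ and every $s>1/2$; (2) for every Hilbert space $H$ and every nonnegative self-adjoint operator $A$ on $H$, the abstract wave equation $$u''(t)+c(t)^2Au(t)=0$$ is well posed in $D(A^{1/2})\times H$.
   Context: For $s\in(0,1)$, $W^{s,1}((0,T))$ is the space of $f\in L^1((0,T))$ with $\int_0^T\int_0^T\frac{|f(y)-f(x)|}{|y-x|^{1+s}}\,dx\,dy<+\infty$; for $s\ge1$ it is the usual (fractional) Sobolev space. Well-posedness in $D(A^{1/2})\times H$ means (no derivative loss in the energy space): for every $T>0$ and every initial data $(u_0,u_1)\in D(A^{1/2})\times H$ there is a unique solution $u\in C^0([0,T];D(A^{1/2}))\cap C^1([0,T];H)$ with $u(0)=u_0$, $u'(0)=u_1$, depending continuously on the data. The equation is understood in the usual weak sense: for every $v\in D(A^{1/2})$ and $t\in(0,T)$, $\frac{d}{dt}\langle u'(t),v\rangle+c(t)^2\langle A^{1/2}u(t),A^{1/2}v\rangle=0$ (equivalently, in a spectral representation where $A$ is multiplication by $\lambda(\xi)^2$, each component solves $u_\lambda''+\lambda^2c(t)^2u_\lambda=0$). *)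

theory Defs
  imports "HOL-Analysis.Analysis"
begin

section \<open>Smoothness and fractional Sobolev spaces on an interval\<close>

text \<open>Used for open \<open>S\<close> only, so that the iterated total derivative \<open>deriv\<close> at a point of \<open>S\<close>
  depends only on the values of \<open>f\<close> on \<open>S\<close>.\<close>

definition smooth_on :: "real set \<Rightarrow> (real \<Rightarrow> real) \<Rightarrow> bool" where
  "smooth_on S f \<longleftrightarrow> (\<forall>n. \<forall>x\<in>S. ((deriv ^^ n) f) field_differentiable (at x))"

definition test_function :: "real \<Rightarrow> (real \<Rightarrow> real) \<Rightarrow> bool" where
  "test_function T \<phi> \<longleftrightarrow> smooth_on UNIV \<phi> \<and>
     (\<exists>a b. 0 < a \<and> b < T \<and> (\<forall>x. x \<notin> {a..b} \<longrightarrow> \<phi> x = 0))"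

definition weak_derivative :: "real \<Rightarrow> nat \<Rightarrow> (real \<Rightarrow> real) \<Rightarrow> (real \<Rightarrow> real) \<Rightarrow> bool" where
  "weak_derivative T k f g \<longleftrightarrow> (\<forall>\<phi>. test_function T \<phi> \<longrightarrow>
     (LINT x:{0<..<T}|lborel. f x * (deriv ^^ k) \<phi> x) =
     (- 1) ^ k * (LINT x:{0<..<T}|lborel. g x * \<phi> x))"

definition gagliardo :: "real \<Rightarrow> real \<Rightarrow> (real \<Rightarrow> real) \<Rightarrow> ennreal" where
  "gagliardo \<sigma> T f =
     (\<integral>\<^sup>+ y\<in>{0<..<T}. (\<integral>\<^sup>+ x\<in>{0<..<T}.
        ennreal (\<bar>f y - f x\<bar> / \<bar>y - x\<bar> powr (1 + \<sigma>)) \<partial>lborel) \<partial>lborel)"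

text \<open>The space \<open>W\<^sup>s\<^sup>,\<^sup>1((0,T))\<close> for \<open>s > 0\<close>, with \<open>s = m + \<sigma>\<close>, \<open>m\<close> a natural number and
  \<open>0 \<le> \<sigma> < 1\<close>: weak derivatives up to order \<open>m\<close> are in \<open>L\<^sup>1\<close>, and, when \<open>\<sigma> > 0\<close>, the derivative of
  order \<open>m\<close> has finite Gagliardo seminorm of order \<open>\<sigma>\<close>.\<close>

definition sobolev_W1 :: "real \<Rightarrow> real \<Rightarrow> (real \<Rightarrow> real) set" where
  "sobolev_W1 s T = {f. \<exists>g :: nat \<Rightarrow> real \<Rightarrow> real.
     g 0 = f \<and>
     (\<forall>k \<le> nat \<lfloor>s\<rfloor>. set_integrable lborel {0<..<T} (g k) \<and> weak_derivative T k f (g k)) \<and>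
     (frac s > 0 \<longrightarrow> gagliardo (frac s) T (g (nat \<lfloor>s\<rfloor>)) < \<infinity>)}"


section \<open>Unbounded self-adjoint operators\<close>

text \<open>An unbounded operator is represented by its graph, a subset of \<open>H \<times> H\<close>; its domain is
  \<open>Domain A\<close>, and the composition of operators, with its natural domain, is \<open>O\<close>.
  A complex Hilbert space is also a real one for the inner product \<open>Re \<langle>x,y\<rangle>\<close>; self-adjointness,
  nonnegativity, square roots and solutions of the wave equation are the same for both
  structures, so complex spaces are covered.\<close>

definition op_apply :: "('h \<times> 'h) set \<Rightarrow> 'h \<Rightarrow> 'h" where
  "op_apply A x = (THE y. (x, y) \<in> A)"

definition adjoint_op :: "('h::real_inner \<times> 'h) set \<Rightarrow> ('h \<times> 'h) set" where
  "adjoint_op A = {(y, z). \<forall>(x, w)\<in>A. w \<bullet> y = x \<bullet> z}"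

definition self_adjoint_op :: "('h::real_inner \<times> 'h) set \<Rightarrow> bool" where
  "self_adjoint_op A \<longleftrightarrow> subspace A \<and> single_valued A \<and> closure (Domain A) = UNIV \<and>
     adjoint_op A = A"

definition nonneg_op :: "('h::real_inner \<times> 'h) set \<Rightarrow> bool" where
  "nonneg_op A \<longleftrightarrow> (\<forall>(x, y)\<in>A. 0 \<le> y \<bullet> x)"

text \<open>For a nonnegative self-adjoint operator on a Hilbert space such a \<open>B\<close> exists and is unique.\<close>

definition sqrt_op :: "('h::real_inner \<times> 'h) set \<Rightarrow> ('h \<times> 'h) set" where
  "sqrt_op A = (SOME B. self_adjoint_op B \<and> nonneg_op B \<and> B O B = A)"

definition graph_norm :: "('h::real_inner \<times> 'h) set \<Rightarrow> 'h \<Rightarrow> real" where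
  "graph_norm B x = sqrt ((norm x)\<^sup>2 + (norm (op_apply B x))\<^sup>2)"


section \<open>The abstract wave equation\<close>

text \<open>Here \<open>B\<close> stands for \<open>A\<^sup>1\<^sup>/\<^sup>2\<close>, and \<open>u'\<close> for the time derivative of \<open>u\<close>.  Continuity of \<open>u\<close>
  and of \<open>B u\<close> in \<open>H\<close> is continuity of \<open>u\<close> for the graph norm.\<close>

definition wave_solution ::
  "(real \<Rightarrow> real) \<Rightarrow> ('h::real_inner \<times> 'h) set \<Rightarrow> real \<Rightarrow> 'h \<Rightarrow> 'h \<Rightarrow>
     (real \<Rightarrow> 'h) \<Rightarrow> (real \<Rightarrow> 'h) \<Rightarrow> bool" where
  "wave_solution c B T u0 u1 u u' \<longleftrightarrow>
     (\<forall>t\<in>{0..T}. u t \<in> Domain B) \<and>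
     continuous_on {0..T} u \<and> continuous_on {0..T} (\<lambda>t. op_apply B (u t)) \<and>
     (\<forall>t\<in>{0..T}. (u has_vector_derivative u' t) (at t within {0..T})) \<and>
     continuous_on {0..T} u' \<and>
     u 0 = u0 \<and> u' 0 = u1 \<and>
     (\<forall>v\<in>Domain B. \<forall>t\<in>{0<..<T}.
        ((\<lambda>r. u' r \<bullet> v) has_real_derivative
           - ((c t)\<^sup>2 * (op_apply B (u t) \<bullet> op_apply B v))) (at t))"

text \<open>Well-posedness of \<open>u'' + c\<^sup>2 A u = 0\<close> in \<open>D(A\<^sup>1\<^sup>/\<^sup>2) \<times> H\<close>.  Existence, uniqueness (on \<open>[0,T]\<close>),
  and continuity of the map taking data in \<open>D(A\<^sup>1\<^sup>/\<^sup>2) \<times> H\<close> to the solution in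
  \<open>C\<^sup>0([0,T]; D(A\<^sup>1\<^sup>/\<^sup>2)) \<inter> C\<^sup>1([0,T]; H)\<close>.\<close>

definition wave_well_posed :: "(real \<Rightarrow> real) \<Rightarrow> ('h::real_inner \<times> 'h) set \<Rightarrow> bool" where
  "wave_well_posed c A \<longleftrightarrow> (\<forall>T>0. \<forall>u0\<in>Domain (sqrt_op A). \<forall>u1.
     (\<exists>u u'. wave_solution c (sqrt_op A) T u0 u1 u u') \<and>
     (\<forall>u u' v v'. wave_solution c (sqrt_op A) T u0 u1 u u' \<longrightarrow>
        wave_solution c (sqrt_op A) T u0 u1 v v' \<longrightarrow> (\<forall>t\<in>{0..T}. u t = v t)) \<and>
     (\<forall>\<epsilon>>0. \<exists>\<delta>>0. \<forall>v0\<in>Domain (sqrt_op A). \<forall>v1 u u' v v'.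
        graph_norm (sqrt_op A) (v0 - u0) < \<delta> \<longrightarrow> norm (v1 - u1) < \<delta> \<longrightarrow>
        wave_solution c (sqrt_op A) T u0 u1 u u' \<longrightarrow>
        wave_solution c (sqrt_op A) T v0 v1 v v' \<longrightarrow>
        (\<forall>t\<in>{0..T}. graph_norm (sqrt_op A) (v t - u t) < \<epsilon> \<and> norm (v' t - u' t) < \<epsilon>)))"


section \<open>The propagation speed\<close>

definition rough_speed :: "(real \<Rightarrow> real) \<Rightarrow> bool" where
  "rough_speed c \<longleftrightarrow> smooth_on {0<..} c \<and> (\<forall>t>0. c t \<in> {1/2..3/2}) \<and>
     (\<forall>T>0. \<forall>s>1/2. c \<notin> sobolev_W1 s T)"

definition scalar_energy_bound :: "(real \<Rightarrow> real) \<Rightarrow> bool" where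
  "scalar_energy_bound c \<longleftrightarrow> (\<forall>T>0. \<exists>K. \<forall>\<mu>\<ge>0. \<forall>w w'.
     continuous_on {0..T} w \<and> continuous_on {0..T} w' \<and>
     (\<forall>t\<in>{0<..<T}. (w has_real_derivative w' t) (at t) \<and>
        (w' has_real_derivative - (\<mu>\<^sup>2 * (c t)\<^sup>2 * w t)) (at t)) \<longrightarrow>
     (\<forall>t\<in>{0..T}. (w' t)\<^sup>2 + \<mu>\<^sup>2 * (w t)\<^sup>2 \<le> K * ((w' 0)\<^sup>2 + \<mu>\<^sup>2 * (w 0)\<^sup>2)))"

text \<open>A single function has to serve all Hilbert spaces.  Under an existential quantifier over
  \<open>c\<close>, the type of the Hilbert space would be fixed before \<open>c\<close>, so that \<open>c\<close> could depend on it;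
  a constant of a type without type variables cannot.  The choice selects a speed whose energy
  estimate for the components \<open>w'' + \<mu>\<^sup>2 c\<^sup>2 w = 0\<close> is uniform in \<open>\<mu>\<close>; such a speed exists if and only if some
  \<open>c\<close> has the regularity properties and makes the equation well posed for all nonnegative
  self-adjoint operators.  Nothing is assumed about the constant: that a suitable function exists
  has to be proved.\<close>

definition wave_speed :: "real \<Rightarrow> real" where
  "wave_speed = (SOME c. rough_speed c \<and> scalar_energy_bound c)"

end

theory Submission
  imports Defs "HOL-Computational_Algebra.Polynomial" "HOL-Real_Asymp.Real_Asymp"
begin

text \<open>
  The speed is \<open>exp F\<close>, where \<open>F\<close> is a sum of chirps supported in the intervals \<open>[2\<^sup>-\<^sup>n\<^sup>-\<^sup>1, 2\<^sup>-\<^sup>n]\<close>. A chirp has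
  amplitude \<open>N\<^sup>-\<^sup>\<rho>\<close> with \<open>\<rho>\<close> slightly above \<open>1/2\<close> and frequency sweeping over \<open>[N, 2 N]\<close>. Its contribution to the
  seminorm of order \<open>\<sigma>\<close> is of size \<open>N\<^sup>\<sigma>\<^sup>-\<^sup>\<rho>\<close>, hence arbitrarily large for \<open>\<sigma> > \<rho>\<close>. Nevertheless every component
  \<open>w'' + \<mu>\<^sup>2 c\<^sup>2 w = 0\<close> is resonant with it only for a short time, and a near-identity change of variables shows
  that the energy grows at most by a factor \<open>1 + O(N\<^sup>1\<^sup>-\<^sup>2\<^sup>\<rho> ln N)\<close>, uniformly in \<open>\<mu>\<close>. For \<open>N\<close> large enough on each
  interval the product of these factors converges.

  The uniform bound for the components is transported to an operator \<open>B = A\<^sup>1\<^sup>/\<^sup>2\<close> by the continuous functional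
  calculus of its resolvent \<open>R = (1 + B)\<^sup>-\<^sup>1\<close>, which lies between \<open>0\<close> and \<open>1\<close>. After a cut-off near
  \<open>R = 0\<close> the equation involves a bounded operator, and every solution is given by the fundamental solutions
  of the components, as functions of \<open>R\<close>. This gives the a priori estimate for arbitrary solutions, hence
  uniqueness and continuous dependence, and existence by removing the cut-off.
\<close>

section \<open>Smooth functions on the real line\<close>

text \<open>Why 1/2: the coupling felt by the energy is \<open>f' / 2\<close>, of size \<epsilon> N
  for amplitude \<epsilon> and frequency N, so a Gronwall estimate would cost exp(\<epsilon> N) per
  chirp up to constants. Integrated against the rotation \<open>cis (2 * \<mu> * t)\<close> of a
  component it counts only during the resonance time 1 / sqrt N and leaves \<epsilon> sqrt N, which
  tends to 0 exactly for amplitudes N^(-\<rho>) with \<rho> > 1/2. The frequency has to sweep: a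
  constant one would resonate with a single \<mu> throughout the block, and the estimate must hold
  for all \<mu> at once. The second order remainder, primitive times perturbation, is \<epsilon>^2 N
  up to a logarithm and obeys the same threshold.

  No fixed \<rho> > 1/2 defeats every s > 1/2, so the order attached to a block decreases to 1/2
  while the demanded seminorm grows. For s \<ge> 1 membership speaks of weak derivatives, so the
  blocks must also have large variation.

  On the operator side the energy constant must not depend on the cut-off; hence operators are
  compared through pointwise inequalities between their symbols.\<close>

primrec Ck :: "nat \<Rightarrow> real set \<Rightarrow> (real \<Rightarrow> real) \<Rightarrow> bool" where
  "Ck 0 S f \<longleftrightarrow> True"
| "Ck (Suc n) S f \<longleftrightarrow> (\<forall>x\<in>S. f field_differentiable (at x)) \<and> Ck n S (deriv f)"

lemma Ck_iff: "Ck n S f \<longleftrightarrow> (\<forall>k<n. \<forall>x\<in>S. ((deriv ^^ k) f) field_differentiable (at x))"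
proof (induction n arbitrary: f)
  case (Suc n)
  have "(\<forall>k<Suc n. \<forall>x\<in>S. ((deriv ^^ k) f) field_differentiable (at x)) \<longleftrightarrow>
    (\<forall>x\<in>S. f field_differentiable (at x)) \<and> (\<forall>k<n. \<forall>x\<in>S. ((deriv ^^ k) (deriv f)) field_differentiable (at x))"
    by (simp only: All_less_Suc2 funpow_Suc_right o_apply funpow_0)
  then show ?case using Suc.IH by simp
qed simp

text \<open>All closure properties are proved for \<open>Ck n\<close> by induction on n with the
  function arbitrary: the recursion moves one derivative into the function, a structure that the
  iterated \<open>deriv\<close> in \<open>smooth_on\<close> hides.\<close>

lemma smooth_on_iff_Ck: "smooth_on S f \<longleftrightarrow> (\<forall>n. Ck n S f)"
  unfolding smooth_on_def Ck_iff by blast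

lemma Ck_mono: "Ck (Suc n) S f \<Longrightarrow> Ck n S f"
  by (simp add: Ck_iff)

lemma Ck_subset: "Ck n S f \<Longrightarrow> T \<subseteq> S \<Longrightarrow> Ck n T f"
  by (auto simp: Ck_iff)

lemma field_differentiable_cong_open:
  fixes f g :: "real \<Rightarrow> real"
  assumes "open S" "\<And>x. x \<in> S \<Longrightarrow> f x = g x" "x \<in> S" "f field_differentiable (at x)"
  shows "g field_differentiable (at x)"
  using assms by (meson field_differentiable_def has_field_derivative_transform_within_open)

lemma deriv_cong_open:
  fixes f g :: "real \<Rightarrow> real"
  assumes "open S" "\<And>x. x \<in> S \<Longrightarrow> f x = g x" "x \<in> S"
  shows "deriv f x = deriv g x"
proof (rule deriv_cong_ev)
  show "\<forall>\<^sub>F x in nhds x. f x = g x"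
    using assms by (metis (mono_tags, lifting) eventually_nhds)
qed simp

lemma deriv_eq_0_outside:
  fixes g :: "real \<Rightarrow> real"
  assumes "\<And>x. x \<notin> {a..b} \<Longrightarrow> g x = 0" "x \<notin> {a..b}"
  shows "deriv g x = 0"
proof -
  have "deriv g x = deriv (\<lambda>x. 0) x"
    by (rule deriv_cong_open[of "- {a..b}"]) (use assms in auto)
  then show ?thesis by simp
qed

lemma Ck_cong:
  assumes "open S" "\<And>x. x \<in> S \<Longrightarrow> f x = g x" "Ck n S f"
  shows "Ck n S g"
  using assms(2,3)
proof (induction n arbitrary: f g)
  case (Suc n)
  have "Ck n S (deriv g)"
  proof (rule Suc.IH)
    show "Ck n S (deriv f)" using Suc.prems(2) by simp
    show "deriv f x = deriv g x" if "x \<in> S" for x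
      by (rule deriv_cong_open[OF assms(1) _ that]) (rule Suc.prems(1))
  qed
  moreover have "\<forall>x\<in>S. g field_differentiable at x"
  proof
    fix x assume x: "x \<in> S"
    then have f: "f field_differentiable at x" using Suc.prems(2) by simp
    show "g field_differentiable at x"
      by (rule field_differentiable_cong_open[OF assms(1) _ x f]) (rule Suc.prems(1))
  qed
  ultimately show ?case by simp
qed simp

text \<open>Lets a closed form f' stand in for \<open>deriv f\<close>. The two may be exchanged on
  the open set S because \<open>deriv\<close> is local.\<close>

lemma Ck_SucI:
  assumes "open S" "\<And>x. x \<in> S \<Longrightarrow> (f has_field_derivative f' x) (at x)" "Ck n S f'"
  shows "Ck (Suc n) S f"
proof -
  have "Ck n S (deriv f)"
    by (rule Ck_cong[OF assms(1) _ assms(3)]) (simp add: DERIV_imp_deriv[OF assms(2)])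
  then show ?thesis using assms(2) by (auto simp: field_differentiable_def)
qed

lemma Ck_SucD:
  assumes "Ck (Suc n) S f" "x \<in> S"
  shows "(f has_field_derivative deriv f x) (at x)"
  using assms by (simp add: field_differentiable_derivI)

lemma Ck_SucD': "Ck (Suc n) S f \<Longrightarrow> Ck n S (deriv f)"
  by simp

lemma Ck_const [simp]: "Ck n S (\<lambda>x. c)"
proof (induction n arbitrary: c)
  case (Suc n)
  have "deriv (\<lambda>x. c) = (\<lambda>x::real. 0)" by auto
  then show ?case using Suc by simp
qed simp

lemma Ck_ident [simp]: "Ck n S (\<lambda>x. x)"
proof (cases n)
  case (Suc m)
  have "deriv (\<lambda>x. x) = (\<lambda>x::real. 1)" by auto
  then show ?thesis using Suc by simp
qed simp

lemma Ck_add: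
  assumes "open S" "Ck n S f" "Ck n S g"
  shows "Ck n S (\<lambda>x. f x + g x)"
  using assms(2,3)
proof (induction n arbitrary: f g)
  case (Suc n)
  show ?case
    by (rule Ck_SucI[OF assms(1) DERIV_add[OF Ck_SucD[OF Suc.prems(1)] Ck_SucD[OF Suc.prems(2)]]
          Suc.IH[OF Ck_SucD'[OF Suc.prems(1)] Ck_SucD'[OF Suc.prems(2)]]])
qed simp

lemma Ck_sum:
  fixes f :: "nat \<Rightarrow> real \<Rightarrow> real" and m :: nat
  assumes "open S" "\<And>i. Ck n S (f i)"
  shows "Ck n S (\<lambda>x. \<Sum>i<m. f i x)"
  by (induction m) (simp_all add: Ck_add[OF assms(1) _ assms(2)])

lemma Ck_mult:
  assumes "open S" "Ck n S f" "Ck n S g"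
  shows "Ck n S (\<lambda>x. f x * g x)"
  using assms(2,3)
proof (induction n arbitrary: f g)
  case (Suc n)
  show ?case
  proof (rule Ck_SucI[OF assms(1), where f' = "\<lambda>x. deriv f x * g x + deriv g x * f x"])
    fix x assume "x \<in> S"
    then show "((\<lambda>x. f x * g x) has_real_derivative deriv f x * g x + deriv g x * f x) (at x)"
      using DERIV_mult[OF Ck_SucD[OF Suc.prems(1)] Ck_SucD[OF Suc.prems(2)]] by (simp add: add.commute)
  next
    show "Ck n S (\<lambda>x. deriv f x * g x + deriv g x * f x)"
      by (rule Ck_add[OF assms(1) Suc.IH[OF Ck_SucD'[OF Suc.prems(1)] Ck_mono[OF Suc.prems(2)]]
            Suc.IH[OF Ck_SucD'[OF Suc.prems(2)] Ck_mono[OF Suc.prems(1)]]])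
  qed
qed simp

lemma Ck_compose:
  assumes "open S" "open U" "Ck n U f" "Ck n S g" "g ` S \<subseteq> U"
  shows "Ck n S (\<lambda>x. f (g x))"
  using assms(3,4)
proof (induction n arbitrary: f)
  case (Suc n)
  show ?case
  proof (rule Ck_SucI[OF assms(1), where f' = "\<lambda>x. deriv f (g x) * deriv g x"])
    fix x assume "x \<in> S"
    then show "((\<lambda>x. f (g x)) has_real_derivative deriv f (g x) * deriv g x) (at x)"
      using assms(5) by (intro DERIV_chain2[OF Ck_SucD[OF Suc.prems(1)] Ck_SucD[OF Suc.prems(2)]]) auto
  next
    show "Ck n S (\<lambda>x. deriv f (g x) * deriv g x)"
      by (rule Ck_mult[OF assms(1) Suc.IH[OF Ck_SucD'[OF Suc.prems(1)] Ck_mono[OF Suc.prems(2)]]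
            Ck_SucD'[OF Suc.prems(2)]])
  qed
qed simp

lemma Ck_exp: "Ck n UNIV (exp :: real \<Rightarrow> real)"
proof (induction n)
  case (Suc n)
  show ?case by (rule Ck_SucI[OF open_UNIV DERIV_exp Suc])
qed simp

text \<open>The two-parameter family is closed under differentiation, so a single induction covers
  sine and cosine.\<close>

lemma Ck_sin_cos: "Ck n UNIV (\<lambda>x. a * sin x + b * cos x :: real)"
proof (induction n arbitrary: a b)
  case (Suc n)
  show ?case
    by (rule Ck_SucI[OF open_UNIV _ Suc[of "- b" a]]) (auto intro!: derivative_eq_intros)
qed simp

lemma Ck_sin: "Ck n UNIV (sin :: real \<Rightarrow> real)"
  using Ck_sin_cos[of n 1 0] by simp

section \<open>Flat functions and smooth bumps\<close>

definition flat :: "real poly \<Rightarrow> real \<Rightarrow> real" where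
  "flat p x = (if x > 0 then poly p (1 / x) * exp (- 1 / x) else 0)"

lemma poly_times_exp_tendsto_0: "((\<lambda>x::real. poly p x * exp (- x)) \<longlongrightarrow> 0) at_top"
proof -
  have "((\<lambda>x::real. \<Sum>i\<le>degree p. coeff p i * (x ^ i / exp x)) \<longlongrightarrow> (\<Sum>i\<le>degree p. coeff p i * 0)) at_top"
    by (intro tendsto_sum tendsto_mult tendsto_const tendsto_power_div_exp_0)
  then show ?thesis
    by (simp add: poly_altdef exp_minus sum_distrib_right divide_inverse mult.assoc)
qed

text \<open>The family over all polynomials is closed under differentiation: with u = 1/x one has
  d/dx = - u^2 d/du, which turns p(u) exp(-u) into u^2 (p - p')(u) exp(-u). At 0 the difference
  quotient is u p(u) exp(-u), which tends to 0 from the right.\<close>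

lemma flat_deriv:
  "(flat p has_field_derivative flat ([:0,0,1:] * (p - pderiv p)) x) (at x)"
proof -
  consider "x > 0" | "x < 0" | "x = 0" by linarith
  then show ?thesis
  proof cases
    case 1
    have 1: "((\<lambda>x. 1 / x) has_field_derivative - (1 / x\<^sup>2)) (at x)"
      using 1 by (auto intro!: derivative_eq_intros simp: power2_eq_square)
    have 2: "((\<lambda>x. poly p (1 / x)) has_field_derivative poly (pderiv p) (1 / x) * - (1 / x\<^sup>2)) (at x)"
      by (rule DERIV_chain2[OF poly_DERIV 1])
    have 3: "((\<lambda>x. exp (- (1 / x))) has_field_derivative exp (- (1 / x)) * - (- (1 / x\<^sup>2))) (at x)"
      by (rule DERIV_chain2[OF DERIV_exp DERIV_minus[OF 1]])
    have "((\<lambda>x. poly p (1 / x) * exp (- 1 / x)) has_field_derivative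
        flat ([:0,0,1:] * (p - pderiv p)) x) (at x)"
      using DERIV_mult[OF 2 3] \<open>x > 0\<close>
      by (simp add: flat_def power2_eq_square algebra_simps)
    then show ?thesis
      by (rule has_field_derivative_transform_within_open[where S = "{0<..}"])
         (use \<open>x > 0\<close> in \<open>auto simp: flat_def\<close>)
  next
    case 2
    have "((\<lambda>x. 0) has_field_derivative 0) (at x)" by simp
    then have "(flat p has_field_derivative 0) (at x)"
      by (rule has_field_derivative_transform_within_open[of _ _ _ "{..<0}"])
         (use \<open>x < 0\<close> in \<open>auto simp: flat_def\<close>)
    then show ?thesis using \<open>x < 0\<close> by (simp add: flat_def)
  next
    case 3
    have "((\<lambda>x. flat p x / x) \<longlongrightarrow> 0) (at_right 0)"
    proof -
      have "((\<lambda>x. poly ([:0,1:] * p) x * exp (- x)) \<longlongrightarrow> 0) at_top"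
        by (rule poly_times_exp_tendsto_0)
      then have "((\<lambda>x. poly ([:0,1:] * p) (inverse x) * exp (- inverse x)) \<longlongrightarrow> 0) (at_right 0)"
        by (rule filterlim_compose) (rule filterlim_inverse_at_top_right)
      then show ?thesis
      proof (rule Lim_transform_eventually)
        show "\<forall>\<^sub>F x in at_right 0. poly ([:0,1:] * p) (inverse x) * exp (- inverse x) = flat p x / x"
          using eventually_at_right_less[of "0::real"]
          by eventually_elim (simp add: flat_def field_simps)
      qed
    qed
    moreover have "((\<lambda>x. flat p x / x) \<longlongrightarrow> 0) (at_left 0)"
    proof (rule Lim_transform_eventually[OF tendsto_const])
      have "\<forall>\<^sub>F x::real in at_left 0. x < 0" by (simp add: eventually_at_filter)
      then show "\<forall>\<^sub>F x in at_left 0. 0 = flat p x / x"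
        by eventually_elim (simp add: flat_def)
    qed
    ultimately have "((\<lambda>x. flat p x / x) \<longlongrightarrow> 0) (at 0)"
      by (simp add: filterlim_split_at)
    then show ?thesis using 3 by (simp add: DERIV_def flat_def)
  qed
qed

lemma Ck_flat: "Ck n UNIV (flat p)"
proof (induction n arbitrary: p)
  case (Suc n)
  show ?case by (rule Ck_SucI[OF _ flat_deriv Suc]) simp
qed simp

lemma bump_exists:
  fixes a b :: real
  assumes "a < b"
  obtains h where "smooth_on UNIV h" "\<And>x. 0 \<le> h x" "\<And>x. h x \<le> 1"
    "\<And>x. a < x \<Longrightarrow> x < b \<Longrightarrow> 0 < h x" "\<And>x. x \<notin> {a..b} \<Longrightarrow> h x = 0"
proof
  \<comment> \<open>The arguments x - a and b - x are written as sums and products to which the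
    \<open>Ck\<close> rules apply literally.\<close>
  let ?h = "\<lambda>x. flat 1 (x + (- a)) * flat 1 ((- 1) * x + b)"
  show "smooth_on UNIV ?h"
    unfolding smooth_on_iff_Ck
  proof
    fix n
    have "Ck n UNIV (\<lambda>x. x + (- a))" "Ck n UNIV (\<lambda>x. (- 1) * x + b)"
      by (rule Ck_add[OF open_UNIV Ck_ident Ck_const] Ck_add[OF open_UNIV Ck_mult[OF open_UNIV Ck_const Ck_ident] Ck_const])+
    then show "Ck n UNIV ?h"
      by (intro Ck_mult[OF open_UNIV] Ck_compose[OF open_UNIV open_UNIV Ck_flat _ subset_UNIV])
  qed
  have nn: "0 \<le> flat 1 x" and le: "flat 1 x \<le> 1" for x by (auto simp: flat_def)
  show "0 \<le> ?h x" for x by (rule mult_nonneg_nonneg[OF nn nn])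
  show "?h x \<le> 1" for x by (rule mult_le_one[OF le nn le])
  show "0 < ?h x" if "a < x" "x < b" for x
    using that by (intro mult_pos_pos) (simp_all add: flat_def)
  show "?h x = 0" if "x \<notin> {a..b}" for x
    using that by (auto simp: flat_def)
qed

section \<open>Oscillatory integrals and near-identity transformations\<close>

text \<open>Integration starts at a - 1, on an interval enlarged by 1 at both ends, so that the
  derivative at a and at b is two-sided.\<close>

lemma antiderivative_exists:
  fixes h :: "real \<Rightarrow> 'a::banach"
  assumes "continuous_on UNIV h"
  obtains H where "\<And>t. t \<in> {a..b} \<Longrightarrow> (H has_vector_derivative h t) (at t)"
proof
  fix t assume t: "t \<in> {a..b}"
  have "((\<lambda>u. integral {a-1..u} h) has_vector_derivative h t) (at t within {a-1..b+1})"
    using t by (intro integral_has_vector_derivative continuous_on_subset[OF assms]) auto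
  moreover have "at t within {a-1..b+1} = at t"
    using t by (intro at_within_interior) auto
  ultimately show "((\<lambda>u. integral {a-1..u} h) has_vector_derivative h t) (at t)" by simp
qed

lemma has_vector_derivative_cis:
  assumes "(\<psi> has_real_derivative d) (at t)"
  shows "((\<lambda>t. cis (\<psi> t)) has_vector_derivative (\<i> * of_real d) * cis (\<psi> t)) (at t)"
  unfolding has_vector_derivative_complex_iff
  by (auto intro!: derivative_eq_intros assms)

lemma norm_diff_le_derivative:
  fixes f :: "real \<Rightarrow> 'a::real_normed_vector"
  assumes "a \<le> b" "\<And>x. x \<in> {a..b} \<Longrightarrow> (f has_vector_derivative f' x) (at x)"
    "\<And>x. x \<in> {a..b} \<Longrightarrow> (\<phi> has_real_derivative \<phi>' x) (at x)"
    "\<And>x. x \<in> {a..b} \<Longrightarrow> norm (f' x) \<le> \<phi>' x"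
  shows "norm (f b - f a) \<le> \<phi> b - \<phi> a"
proof (cases "a = b")
  case False
  show ?thesis
  proof (rule differentiable_bound_general[where f' = f' and \<phi>' = \<phi>'])
    show "continuous_on {a..b} f" "continuous_on {a..b} \<phi>"
      using assms(2,3) by (meson continuous_at_imp_continuous_on has_vector_derivative_continuous DERIV_isCont)+
  qed (use assms False in \<open>auto simp: has_real_derivative_iff_has_vector_derivative\<close>)
qed simp

lemma norm_diff_le_const:
  fixes f :: "real \<Rightarrow> 'a::real_normed_vector"
  assumes "a \<le> b" "\<And>x. x \<in> {a..b} \<Longrightarrow> (f has_vector_derivative f' x) (at x)"
    "\<And>x. x \<in> {a..b} \<Longrightarrow> norm (f' x) \<le> L"
  shows "norm (f b - f a) \<le> L * (b - a)"
  using norm_diff_le_derivative[OF assms(1,2), where \<phi> = "\<lambda>x. L * x" and \<phi>' = "\<lambda>x. L"] assms(3)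
  by (auto intro!: derivative_eq_intros simp: right_diff_distrib)

text \<open>Non-stationary phase: one integration by parts, done by subtracting F = - i g cis \<psi>
  / \<psi>'. The two boundary terms, the term with g' and the term with (1/\<psi>')' cost L / m
  each. The last one does not see the size of \<kappa>: as \<psi>' is affine and keeps its sign,
  1/\<psi>' is monotone with variation at most 1 / m. This matters because \<kappa> will be as large
  as the frequency.\<close>

lemma oscillatory_integral_bound:
  fixes g g' I :: "real \<Rightarrow> complex" and \<alpha> \<kappa> :: real
  assumes pq: "p \<le> q" "q - p \<le> 1" and m: "m > 0"
    and g: "\<And>t. t \<in> {p..q} \<Longrightarrow> (g has_vector_derivative g' t) (at t)"
    and L: "\<And>t. t \<in> {p..q} \<Longrightarrow> norm (g t) \<le> L" "\<And>t. t \<in> {p..q} \<Longrightarrow> norm (g' t) \<le> L"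
    and \<psi>: "\<And>t. t \<in> {p..q} \<Longrightarrow> (\<psi> has_real_derivative \<alpha> + \<kappa> * t) (at t)"
    and sgn: "(\<forall>t\<in>{p..q}. m \<le> \<alpha> + \<kappa> * t) \<or> (\<forall>t\<in>{p..q}. \<alpha> + \<kappa> * t \<le> - m)"
    and I: "\<And>t. t \<in> {p..q} \<Longrightarrow> (I has_vector_derivative g t * cis (\<psi> t)) (at t)"
  shows "norm (I q - I p) \<le> 4 * L / m"
proof -
  define s where "s t = \<alpha> + \<kappa> * t" for t
  have s_abs: "m \<le> \<bar>s t\<bar>" if "t \<in> {p..q}" for t using sgn that m by (force simp: s_def)
  have s0: "s t \<noteq> 0" if "t \<in> {p..q}" for t using s_abs[OF that] m by auto
  have L0: "L \<ge> 0" using L(1)[of p] pq norm_ge_zero order_trans by (metis atLeastAtMost_iff order_refl)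
  define F where "F t = (g t * cis (\<psi> t)) * (- \<i> * of_real (1 / s t))" for t
  define D where "D t = (g' t * cis (\<psi> t)) * (\<i> * of_real (1 / s t)) - (g t * cis (\<psi> t)) * (\<i> * of_real (\<kappa> / (s t)\<^sup>2))" for t
  have D: "((\<lambda>t. I t - F t) has_vector_derivative D t) (at t)" if t: "t \<in> {p..q}" for t
  proof -
    have "((\<lambda>t. 1 / s t) has_real_derivative - (\<kappa> / (s t)\<^sup>2)) (at t)"
      unfolding s_def using s0[OF t] by (auto intro!: derivative_eq_intros simp: s_def power2_eq_square)
    then have "((\<lambda>t. of_real (1 / s t) :: complex) has_vector_derivative of_real (- (\<kappa> / (s t)\<^sup>2))) (at t)"
      using has_vector_derivative_of_real by (simp only: has_real_derivative_iff_has_vector_derivative) blast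
    then have i: "((\<lambda>t. - \<i> * of_real (1 / s t)) has_vector_derivative - \<i> * of_real (- (\<kappa> / (s t)\<^sup>2))) (at t)"
      by (rule has_vector_derivative_mult_right)
    have gc: "((\<lambda>t. g t * cis (\<psi> t)) has_vector_derivative
        g t * (\<i> * of_real (s t) * cis (\<psi> t)) + g' t * cis (\<psi> t)) (at t)"
      using has_vector_derivative_mult[OF g[OF t] has_vector_derivative_cis[OF \<psi>[OF t]]] by (simp add: s_def)
    have "((\<lambda>t. I t - F t) has_vector_derivative g t * cis (\<psi> t) -
        (g t * cis (\<psi> t) * (- \<i> * of_real (- (\<kappa> / (s t)\<^sup>2)))
          + (g t * (\<i> * of_real (s t) * cis (\<psi> t)) + g' t * cis (\<psi> t)) * (- \<i> * of_real (1 / s t)))) (at t)"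
      unfolding F_def by (rule has_vector_derivative_diff[OF I[OF t] has_vector_derivative_mult[OF gc i]])
    moreover have k: "(g t * (\<i> * of_real (s t) * cis (\<psi> t))) * (- \<i> * of_real (1 / s t)) = g t * cis (\<psi> t)"
      using s0[OF t] by (simp add: field_simps)
    have "g t * cis (\<psi> t) - (g t * cis (\<psi> t) * (- \<i> * of_real (- (\<kappa> / (s t)\<^sup>2)))
          + (g t * (\<i> * of_real (s t) * cis (\<psi> t)) + g' t * cis (\<psi> t)) * (- \<i> * of_real (1 / s t))) = D t"
      unfolding distrib_right k D_def by (simp add: algebra_simps)
    ultimately show ?thesis by (simp only:)
  qed
  \<comment> \<open>The sign of \<kappa> makes - \<sigma> L / s(t) a primitive of the nonnegative
    function L |\<kappa>| / s(t)^2.\<close>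
  define \<sigma> where "\<sigma> = (if \<kappa> \<ge> 0 then 1 else - 1 :: real)"
  have "norm ((I q - F q) - (I p - F p)) \<le> (L / m * q - \<sigma> * L * (1 / s q)) - (L / m * p - \<sigma> * L * (1 / s p))"
  proof (rule norm_diff_le_derivative[OF pq(1) D])
    fix t assume t: "t \<in> {p..q}"
    show "((\<lambda>t. L / m * t - \<sigma> * L * (1 / s t)) has_real_derivative L / m + L * (\<bar>\<kappa>\<bar> / (s t)\<^sup>2)) (at t)"
      unfolding s_def using s0[OF t] m by (auto intro!: derivative_eq_intros simp: s_def power2_eq_square \<sigma>_def)
    have "norm (D t) \<le> norm (g' t) * (1 / \<bar>s t\<bar>) + norm (g t) * (\<bar>\<kappa>\<bar> / (s t)\<^sup>2)"
      unfolding D_def by (rule order_trans[OF norm_triangle_ineq4]) (simp add: norm_mult norm_divide norm_power)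
    also have "\<dots> \<le> L * (1 / m) + L * (\<bar>\<kappa>\<bar> / (s t)\<^sup>2)"
      using L[OF t] L0 s_abs[OF t] m by (intro add_mono mult_mono divide_left_mono) auto
    finally show "norm (D t) \<le> L / m + L * (\<bar>\<kappa>\<bar> / (s t)\<^sup>2)" by simp
  qed
  also have "\<dots> \<le> L / m + L / m"
  proof -
    have "L / m * (q - p) \<le> L / m * 1" using pq L0 m by (intro mult_left_mono) auto
    \<comment> \<open>Both reciprocals have the same sign and modulus at most 1 / m, hence their
      difference is at most 1 / m.\<close>
    moreover have "\<sigma> * (1 / s p - 1 / s q) \<le> 1 / m"
    proof -
      have pqm: "p \<in> {p..q}" "q \<in> {p..q}" using pq by auto
      have "(0 < 1 / s p \<and> 1 / s p \<le> 1 / m \<and> 0 < 1 / s q \<and> 1 / s q \<le> 1 / m) \<or>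
          (1 / s p < 0 \<and> - (1 / m) \<le> 1 / s p \<and> 1 / s q < 0 \<and> - (1 / m) \<le> 1 / s q)"
      proof (cases "\<forall>t\<in>{p..q}. m \<le> \<alpha> + \<kappa> * t")
        case True
        then have "m \<le> s p" "m \<le> s q" using pqm by (auto simp: s_def)
        then show ?thesis using m by (auto simp: divide_simps)
      next
        case False
        then have "s p \<le> - m" "s q \<le> - m" using pqm sgn by (auto simp: s_def)
        then show ?thesis using m by (auto simp: divide_simps)
      qed
      then have "\<bar>1 / s p - 1 / s q\<bar> \<le> 1 / m" by linarith
      then show ?thesis by (simp add: \<sigma>_def abs_le_iff)
    qed
    then have "L * (\<sigma> * (1 / s p - 1 / s q)) \<le> L * (1 / m)" using L0 by (rule mult_left_mono)
    moreover have "(A * q - \<sigma> * L * v) - (A * p - \<sigma> * L * u) = A * (q - p) + L * (\<sigma> * (u - v))" for A u v :: real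
      by (simp add: algebra_simps)
    from this[of "L / m" "1 / s q" "1 / s p"]
    have "(L / m * q - \<sigma> * L * (1 / s q)) - (L / m * p - \<sigma> * L * (1 / s p)) =
        L / m * (q - p) + L * (\<sigma> * (1 / s p - 1 / s q))" .
    ultimately show ?thesis unfolding mult_1_right times_divide_eq_right[of L 1] by linarith
  qed
  finally have 1: "norm ((I q - F q) - (I p - F p)) \<le> 2 * (L / m)" by simp
  have F: "norm (F t) \<le> L / m" if t: "t \<in> {p..q}" for t
  proof -
    have "norm (F t) = norm (g t) * (1 / \<bar>s t\<bar>)" by (simp add: F_def norm_mult norm_divide)
    also have "\<dots> \<le> L * (1 / m)"
      using L[OF t] L0 s_abs[OF t] m by (intro mult_mono divide_left_mono) auto
    finally show ?thesis by simp
  qed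
  have "I q - I p = ((I q - F q) - (I p - F p)) + F q - F p" by simp
  then have "norm (I q - I p) \<le> norm ((I q - F q) - (I p - F p)) + norm (F q) + norm (F p)"
    by (metis (no_types, opaque_lifting) norm_triangle_ineq norm_triangle_ineq4 add_mono_thms_linordered_semiring(3) order_trans)
  then show ?thesis using 1 F[of p] F[of q] pq by simp
qed

text \<open>The substitution \<open>z \<mapsto> z - e\<^sup>-\<^sup>2\<^sup>i\<^sup>\<mu>\<^sup>t P cnj z\<close> removes the coupling term \<open>f'/2 cnj z\<close>
  to first order; what is left is of second order in the perturbation.\<close>

lemma near_identity_transfer:
  fixes z P :: "real \<Rightarrow> complex"
  assumes \<mu>: "\<mu> \<ge> 0" and s: "0 \<le> s" "s \<le> 1/4"
    and t: "t \<in> {p..q}"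
    and z: "\<And>x. x \<in> {p..t} \<Longrightarrow> (z has_vector_derivative
        - \<i> * of_real (\<mu> * c x) * z x + of_real (f' x / 2) * cnj (z x)) (at x)"
    and P: "\<And>x. x \<in> {p..q} \<Longrightarrow> (P has_vector_derivative of_real (f' x / 2) * cis (2 * \<mu> * x)) (at x)"
    and c: "continuous_on UNIV c"
    and Ps: "\<And>x. x \<in> {p..q} \<Longrightarrow> norm (P x) \<le> s"
    and \<rho>: "\<And>x. x \<in> {p..q} \<Longrightarrow> (\<rho> has_real_derivative \<rho>' x) (at x)"
      "\<And>x. x \<in> {p..q} \<Longrightarrow> norm (P x) * (\<bar>f' x\<bar> / 2 + 2 * \<mu> * \<bar>c x - 1\<bar>) \<le> \<rho>' x" "\<rho> q - \<rho> p \<le> s"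
  shows "norm (z t) \<le> (1 + 6 * s) * norm (z p)"
proof -
  obtain \<sigma> where \<sigma>0: "\<And>x. x \<in> {p..q} \<Longrightarrow> (\<sigma> has_vector_derivative c x) (at x)"
    using antiderivative_exists[OF c] by metis
  have \<sigma>: "(\<sigma> has_real_derivative c x) (at x)" if "x \<in> {p..q}" for x
    using \<sigma>0[OF that] by (simp add: has_real_derivative_iff_has_vector_derivative)
  \<comment> \<open>\<sigma> is a primitive of c, so \<open>cis (\<mu> * \<sigma> x)\<close> undoes
    the rotation and X would be constant without coupling. In X' = E the factor \<mu> (1 - c) is the
    mismatch between the phase \<open>cis (- 2 * \<mu> * x)\<close>, made for speed 1, and the
    actual speed c; the other term is the coupling acting on the corrector.\<close>
  define X where "X x = cis (\<mu> * \<sigma> x) * (z x - cis (- 2 * \<mu> * x) * P x * cnj (z x))" for x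
  define E where "E x = cis (\<mu> * \<sigma> x) * (2 * \<i> * of_real (\<mu> * (1 - c x)) * (cis (- 2 * \<mu> * x) * P x) * cnj (z x)
      - of_real (f' x / 2) * (cis (- 2 * \<mu> * x) * P x) * z x)" for x
  have X: "(X has_vector_derivative E x) (at x)" if x: "x \<in> {p..t}" for x
  proof -
    have x': "x \<in> {p..q}" using x t by auto
    have e1: "((\<lambda>x. cis (\<mu> * \<sigma> x)) has_vector_derivative (\<i> * of_real (\<mu> * c x)) * cis (\<mu> * \<sigma> x)) (at x)"
      by (intro has_vector_derivative_cis DERIV_cmult \<sigma> x')
    have e2: "((\<lambda>x. cis (- 2 * \<mu> * x)) has_vector_derivative (\<i> * of_real (- 2 * \<mu>)) * cis (- 2 * \<mu> * x)) (at x)"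
      by (intro has_vector_derivative_cis) (auto intro!: derivative_eq_intros)
    have e3: "((\<lambda>x. cnj (z x)) has_vector_derivative cnj (- \<i> * of_real (\<mu> * c x) * z x + of_real (f' x / 2) * cnj (z x))) (at x)"
      by (rule bounded_linear.has_vector_derivative[OF bounded_linear_cnj z[OF x]])
    \<comment> \<open>Differentiating P gives back the coupling term with the opposite sign. This
      cancellation is the reason why P is a primitive of \<open>f' / 2\<close> times the
      phase.\<close>
    have cc: "cis (- 2 * \<mu> * x) * (of_real (f' x / 2) * cis (2 * \<mu> * x)) = of_real (f' x / 2)"
      by (simp add: cis_mult mult.left_commute)
    note has_vector_derivative_mult[OF e1 has_vector_derivative_diff[OF z[OF x]
          has_vector_derivative_mult[OF has_vector_derivative_mult[OF e2 P[OF x']] e3]]]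
    moreover have "cis (\<mu> * \<sigma> x) * (- \<i> * of_real (\<mu> * c x) * z x + of_real (f' x / 2) * cnj (z x) -
        (cis (- 2 * \<mu> * x) * P x * cnj (- \<i> * of_real (\<mu> * c x) * z x + of_real (f' x / 2) * cnj (z x)) +
         (cis (- 2 * \<mu> * x) * (of_real (f' x / 2) * cis (2 * \<mu> * x)) + \<i> * of_real (- 2 * \<mu>) * cis (- 2 * \<mu> * x) * P x) * cnj (z x))) +
        \<i> * of_real (\<mu> * c x) * cis (\<mu> * \<sigma> x) * (z x - cis (- 2 * \<mu> * x) * P x * cnj (z x)) = E x"
      unfolding cc E_def by (simp add: algebra_simps)
    ultimately show ?thesis unfolding X_def[abs_def] by (simp only:)
  qed
  have zc: "continuous_on {p..t} (\<lambda>x. norm (z x))"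
    by (intro continuous_on_norm continuous_at_imp_continuous_on ballI has_vector_derivative_continuous[OF z])
  \<comment> \<open>Comparison at a maximum point of |z| replaces a Gronwall argument: the remainder
    is linear in |z| with total weight at most s, so it can be absorbed.\<close>
  then obtain y where y: "y \<in> {p..t}" "\<And>x. x \<in> {p..t} \<Longrightarrow> norm (z x) \<le> norm (z y)"
    using continuous_attains_sup[OF compact_Icc _ zc] t by auto
  define M where "M = norm (z y)"
  have M: "M \<ge> 0" "\<And>x. x \<in> {p..t} \<Longrightarrow> norm (z x) \<le> M" using y by (auto simp: M_def)
  have "\<rho> p \<le> \<rho> x \<and> \<rho> x \<le> \<rho> q" if x: "x \<in> {p..q}" for x
  proof -
    have d: "\<exists>y. (\<rho> has_real_derivative y) (at u) \<and> y \<ge> 0" if u: "u \<in> {p..q}" for u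
    proof -
      have "0 \<le> norm (P u) * (\<bar>f' u\<bar> / 2 + 2 * \<mu> * \<bar>c u - 1\<bar>)" using \<mu> by (intro mult_nonneg_nonneg) auto
      then show ?thesis using \<rho>(1,2)[OF u] order_trans by blast
    qed
    have "\<rho> p \<le> \<rho> x" by (rule DERIV_nonneg_imp_nondecreasing) (use x in \<open>auto intro: d\<close>)
    moreover have "\<rho> x \<le> \<rho> q" by (rule DERIV_nonneg_imp_nondecreasing) (use x in \<open>auto intro: d\<close>)
    ultimately show ?thesis ..
  qed
  then have \<rho>y: "\<rho> y - \<rho> p \<le> s" using \<rho>(3) y t by force
  have "norm (X y - X p) \<le> M * \<rho> y - M * \<rho> p"
  proof (rule norm_diff_le_derivative)
    fix x assume x: "x \<in> {p..y}"
    then have x1: "x \<in> {p..t}" and x2: "x \<in> {p..q}" using y t by auto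
    show "(X has_vector_derivative E x) (at x)" by (rule X[OF x1])
    show "((\<lambda>x. M * \<rho> x) has_real_derivative M * \<rho>' x) (at x)" by (intro DERIV_cmult \<rho>(1) x2)
    have "norm (E x) \<le> (2 * (\<mu> * \<bar>1 - c x\<bar>) * norm (P x) * norm (z x)) + (\<bar>f' x\<bar> / 2 * norm (P x) * norm (z x))"
      unfolding E_def norm_mult norm_cis mult_1_left
      by (rule order_trans[OF norm_triangle_ineq4]) (use \<mu> in \<open>simp add: norm_mult abs_mult del: of_real_diff of_real_mult of_real_divide\<close>)
    also have "\<dots> = norm (z x) * (norm (P x) * (\<bar>f' x\<bar> / 2 + 2 * \<mu> * \<bar>c x - 1\<bar>))"
      by (simp add: abs_minus_commute algebra_simps)
    also have "\<dots> \<le> M * \<rho>' x"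
      using M(2)[OF x1] \<rho>(2)[OF x2] M \<mu> by (intro mult_mono) auto
    finally show "norm (E x) \<le> M * \<rho>' x" .
  qed (use y in auto)
  also have "\<dots> \<le> M * s" using mult_left_mono[OF \<rho>y M(1)] by (simp add: right_diff_distrib)
  finally have 1: "norm (X y - X p) \<le> M * s" .
  have nX: "norm (X x - cis (\<mu> * \<sigma> x) * z x) \<le> s * norm (z x)" if x: "x \<in> {p..q}" for x
  proof -
    have "X x - cis (\<mu> * \<sigma> x) * z x = - (cis (\<mu> * \<sigma> x) * (cis (- 2 * \<mu> * x) * P x * cnj (z x)))"
      by (simp add: X_def algebra_simps)
    then have "norm (X x - cis (\<mu> * \<sigma> x) * z x) = norm (P x) * norm (z x)" by (simp add: norm_mult)
    then show ?thesis using Ps[OF x] by (simp add: mult_right_mono)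
  qed
  have yq: "y \<in> {p..q}" "p \<in> {p..q}" using y t by auto
  have "norm (cis (\<mu> * \<sigma> y) * z y) \<le> norm (X y) + norm (X y - cis (\<mu> * \<sigma> y) * z y)"
    by (metis norm_minus_commute norm_triangle_sub)
  then have "M \<le> norm (X y) + s * M" using nX[OF yq(1)] by (simp add: norm_mult M_def)
  moreover have "norm (X y) \<le> norm (X p) + norm (X y - X p)" by (rule norm_triangle_sub)
  moreover have "norm (X p) \<le> norm (cis (\<mu> * \<sigma> p) * z p) + norm (X p - cis (\<mu> * \<sigma> p) * z p)" by (rule norm_triangle_sub)
  ultimately have "M \<le> norm (z p) + s * norm (z p) + M * s + s * M"
    using 1 nX[OF yq(2)] unfolding norm_mult norm_cis mult_1_left mult.commute[of M s] by linarith
  then have "(1 - 2 * s) * M \<le> (1 + s) * norm (z p)" by (simp add: algebra_simps)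
  \<comment> \<open>Here s \<le> 1/4 enters: (1 - 2 s)(1 + 6 s) = 1 + 4 s - 12 s^2 and 12 s^2 \<le>
    3 s.\<close>
  also have "\<dots> \<le> ((1 - 2 * s) * (1 + 6 * s)) * norm (z p)"
  proof (rule mult_right_mono)
    have "s * s \<le> s * (1/4)" using s by (intro mult_left_mono) auto
    then show "1 + s \<le> (1 - 2 * s) * (1 + 6 * s)" by (simp add: algebra_simps)
  qed simp
  finally have "M \<le> (1 + 6 * s) * norm (z p)" using s by (simp add: mult.assoc)
  then show ?thesis using M(2)[of t] t by auto
qed

text \<open>J is a primitive of an oscillating function and u the distance to the resonance. The
  Lipschitz bound is better for u below 1 / sqrt N, the oscillatory bound above; at the balance
  point both are of order L sqrt N, and the conclusion is a common majorant of the two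
  regimes.\<close>

lemma near_far_bound:
  fixes J :: "real \<Rightarrow> 'a::real_normed_vector"
  assumes L: "L \<ge> 0" and N: "N > 0"
    and lip: "\<And>u v. 0 \<le> u \<Longrightarrow> u \<le> v \<Longrightarrow> v \<le> U \<Longrightarrow> norm (J v - J u) \<le> L * N * (v - u)"
    and osc: "\<And>u v. 0 < u \<Longrightarrow> u \<le> v \<Longrightarrow> v \<le> U \<Longrightarrow> norm (J v - J u) \<le> 4 * L / u"
    and u: "0 \<le> u" "u \<le> U"
  shows "norm (J U - J u) \<le> 10 * L * sqrt N / (1 + sqrt N * u)"
proof (cases "u \<ge> 1 / sqrt N")
  case True
  then have u0: "u > 0" using N by (meson divide_pos_pos less_le_trans real_sqrt_gt_zero zero_less_one)
  have "1 \<le> sqrt N * u" using True N by (simp add: field_simps)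
  have "norm (J U - J u) \<le> 4 * L / u" using osc u u0 by simp
  also have "\<dots> \<le> 10 * L * sqrt N / (1 + sqrt N * u)"
  proof -
    have "4 * L * (1 + sqrt N * u) \<le> 4 * L * (2 * (sqrt N * u))"
      using L \<open>1 \<le> sqrt N * u\<close> by (intro mult_left_mono; linarith)
    also have "\<dots> \<le> 10 * L * sqrt N * u" using L N u0 by (simp add: mult_ac)
    finally show ?thesis using u0 N by (simp add: divide_simps add_pos_pos mult_ac)
  qed
  finally show ?thesis .
next
  case False
  define v where "v = min U (1 / sqrt N)"
  have v: "u \<le> v" "v \<le> U" "v - u \<le> 1 / sqrt N" using u False by (auto simp: v_def)
  have "norm (J v - J u) \<le> L * N * (v - u)" using lip u v by simp
  also have "\<dots> \<le> L * N * (1 / sqrt N)" using L N v by (intro mult_left_mono) auto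
  also have "\<dots> = L * sqrt N"
  proof -
    have "N * (1 / sqrt N) = sqrt N" using N by (simp add: real_div_sqrt)
    then show ?thesis by (simp only: mult.assoc)
  qed
  finally have 1: "norm (J v - J u) \<le> L * sqrt N" .
  have 2: "norm (J U - J v) \<le> 4 * L * sqrt N"
  proof (cases "U \<le> 1 / sqrt N")
    case True
    then show ?thesis using L N by (simp add: v_def)
  next
    case False
    then have "v = 1 / sqrt N" by (simp add: v_def)
    then show ?thesis using osc[of v U] v N by simp
  qed
  have "norm (J U - J u) \<le> norm (J U - J v) + norm (J v - J u)"
    using norm_triangle_ineq[of "J U - J v" "J v - J u"] by simp
  then have "norm (J U - J u) \<le> 5 * L * sqrt N" using 1 2 by simp
  also have "\<dots> \<le> 10 * L * sqrt N / (1 + sqrt N * u)"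
  proof -
    have "sqrt N * u \<le> 1" using False N by (simp add: field_simps)
    then have "5 * L * sqrt N * (1 + sqrt N * u) \<le> 5 * L * sqrt N * 2"
      using L N by (intro mult_left_mono) auto
    then show ?thesis using u N by (simp add: divide_simps add_pos_nonneg)
  qed
  finally show ?thesis .
qed

section \<open>Energy transfer across a chirp\<close>

lemma abs_exp_minus_1_le:
  fixes x :: real assumes "\<bar>x\<bar> \<le> 1/2"
  shows "\<bar>exp x - 1\<bar> \<le> 2 * \<bar>x\<bar>"
proof -
  have "norm (exp x - exp 0) \<le> 2 * norm (x - 0)"
  proof (rule field_differentiable_bound[of "{-1/2..1/2}" exp exp])
    fix y :: real assume y: "y \<in> {-1/2..1/2}"
    show "(exp has_real_derivative exp y) (at y within {-1/2..1/2})"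
      by (rule has_field_derivative_at_within[OF DERIV_exp])
    have "norm y \<le> 1/2" unfolding real_norm_def abs_le_iff using y by simp
    then show "norm (exp y) \<le> 2" by (rule exp_bound_half)
  qed (use assms in auto)
  then show ?thesis by simp
qed

text \<open>The profile h enters the estimates only through the bound X on its derivatives, while N
  and \<epsilon> appear explicitly: N is chosen after the profile, and \<epsilon> as a power of
  N.\<close>

locale chirp =
  fixes h h1 h2 :: "real \<Rightarrow> real" and X N \<epsilon> :: real
  assumes dh: "\<And>t. (h has_real_derivative h1 t) (at t)"
    and dh1: "\<And>t. (h1 has_real_derivative h2 t) (at t)"
    and X: "X \<ge> 1"
    and bh: "\<And>t. \<bar>h t\<bar> \<le> 1" "\<And>t. \<bar>h1 t\<bar> \<le> X" "\<And>t. \<bar>h2 t\<bar> \<le> X"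
    and N: "N \<ge> 1" and \<epsilon>: "0 < \<epsilon>" "\<epsilon> \<le> 1/2"
begin

text \<open>The frequency \<open>N (1 + t)\<close> sweeps over \<open>[N, 2 N]\<close> while \<open>t\<close> runs through \<open>[0, 1]\<close>, so that a
  component with parameter \<open>\<mu>\<close> is resonant, \<open>2 \<mu> \<approx> N (1 + t)\<close>, only during a time of order \<open>1 / sqrt N\<close>.\<close>

definition "\<phi> t = N * (t + t\<^sup>2 / 2)"
definition "f t = \<epsilon> * (h t * sin (\<phi> t))"
definition "f' t = \<epsilon> * (h1 t * sin (\<phi> t) + h t * (N * (1 + t)) * cos (\<phi> t))"
definition "f'' t = \<epsilon> * (h2 t * sin (\<phi> t) + 2 * (h1 t * (N * (1 + t)) * cos (\<phi> t)) + h t * N * cos (\<phi> t)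
  - h t * (N * (1 + t))\<^sup>2 * sin (\<phi> t))"
text \<open>One constant, independent of N \<ge> 1, for the amplitude of the oscillating factors in
  f' and for the derivative of that amplitude, both relative to \<epsilon> N.\<close>

definition "L = 3 * X + 4"

lemma d\<phi>: "(\<phi> has_real_derivative N * (1 + t)) (at t)"
  unfolding \<phi>_def[abs_def] by (auto intro!: derivative_eq_intros simp: algebra_simps)

lemma df: "(f has_real_derivative f' t) (at t)"
  unfolding f_def[abs_def] f'_def
  by (rule DERIV_cong[OF DERIV_cmult[OF DERIV_mult[OF dh DERIV_chain2[OF DERIV_sin d\<phi>]]]])
     (simp add: algebra_simps)

lemma df': "(f' has_real_derivative f'' t) (at t)"
proof -
  have n: "((\<lambda>t. N * (1 + t)) has_real_derivative N) (at t)"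
    by (auto intro!: derivative_eq_intros)
  show ?thesis
    unfolding f'_def[abs_def] f''_def
    by (rule DERIV_cong[OF DERIV_cmult[OF DERIV_add[OF DERIV_mult[OF dh1 DERIV_chain2[OF DERIV_sin d\<phi>]]
              DERIV_mult[OF DERIV_mult[OF dh n] DERIV_chain2[OF DERIV_cos d\<phi>]]]]])
       (simp add: algebra_simps power2_eq_square)
qed

lemma cont: "continuous_on S h" "continuous_on S h1" "continuous_on S \<phi>" "continuous_on S f" "continuous_on S f'"
  by (meson DERIV_isCont continuous_at_imp_continuous_on dh dh1 d\<phi> df df')+

lemma L: "L \<ge> 7" "X + 2 * N \<le> L * N" "2 * X * N + N + X \<le> L * N"
proof -
  show "L \<ge> 7" using X by (simp add: L_def)
  have "X * 1 \<le> X * N" using X N by (intro mult_left_mono) auto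
  then show "X + 2 * N \<le> L * N" "2 * X * N + N + X \<le> L * N"
    using N X unfolding L_def distrib_right mult_1_right by linarith+
qed

lemma f_le: "\<bar>f t\<bar> \<le> \<epsilon>"
proof -
  have "\<bar>h t\<bar> * \<bar>sin (\<phi> t)\<bar> \<le> 1 * 1" using bh by (intro mult_mono) auto
  then show ?thesis using \<epsilon> by (simp add: f_def abs_mult mult_left_le)
qed

lemma amplitude_le:
  assumes "t \<in> {0..1}"
  shows "\<bar>h t * (N * (1 + t))\<bar> \<le> 2 * N"
proof -
  have "\<bar>h t\<bar> * \<bar>N * (1 + t)\<bar> \<le> 1 * (N * 2)" using bh(1)[of t] N assms by (intro mult_mono) auto
  then show ?thesis by (simp add: abs_mult)
qed

lemma f'_le:
  assumes t: "t \<in> {0..1}"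
  shows "\<bar>f' t\<bar> \<le> \<epsilon> * L * N"
proof -
  have "\<bar>h1 t\<bar> * \<bar>sin (\<phi> t)\<bar> \<le> X * 1" using bh X by (intro mult_mono) auto
  moreover have "\<bar>h t * (N * (1 + t))\<bar> * \<bar>cos (\<phi> t)\<bar> \<le> (2 * N) * 1"
    using amplitude_le[OF t] N by (intro mult_mono) auto
  ultimately have "\<bar>h1 t * sin (\<phi> t) + h t * (N * (1 + t)) * cos (\<phi> t)\<bar> \<le> L * N"
    using L(2) by (intro order_trans[OF abs_triangle_ineq]) (simp add: abs_mult)
  then show ?thesis using \<epsilon> by (simp add: f'_def abs_mult mult.assoc)
qed

lemma f''_le:
  assumes t: "t \<in> {0..1}"
  shows "\<bar>f'' t\<bar> \<le> \<epsilon> * (5 * X + 5) * N\<^sup>2"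
proof -
  have NN: "N \<le> N\<^sup>2" "1 \<le> N\<^sup>2" using N by (simp_all add: power2_eq_square mult_le_cancel_left1 mult_ge1_I)
  have n: "\<bar>N * (1 + t)\<bar> \<le> N * 2" using t N by (auto simp: abs_mult)
  have "\<bar>h2 t\<bar> * \<bar>sin (\<phi> t)\<bar> \<le> X * 1" using bh X by (intro mult_mono) auto
  then have 1: "\<bar>h2 t * sin (\<phi> t)\<bar> \<le> X" by (simp add: abs_mult)
  have "\<bar>h1 t\<bar> * \<bar>N * (1 + t)\<bar> * \<bar>cos (\<phi> t)\<bar> \<le> (X * (N * 2)) * 1"
    using bh X n N by (intro mult_mono mult_nonneg_nonneg) auto
  moreover have "\<bar>h1 t * (N * (1 + t)) * cos (\<phi> t)\<bar> = \<bar>h1 t\<bar> * \<bar>N * (1 + t)\<bar> * \<bar>cos (\<phi> t)\<bar>"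
    by (simp add: abs_mult)
  moreover have "X * (N * 2) * 1 = 2 * (X * N)" by simp
  ultimately have 2: "\<bar>h1 t * (N * (1 + t)) * cos (\<phi> t)\<bar> \<le> 2 * (X * N)" by linarith
  have "\<bar>h t\<bar> * \<bar>N\<bar> * \<bar>cos (\<phi> t)\<bar> \<le> 1 * N * 1"
    using bh N by (intro mult_mono) auto
  then have 3: "\<bar>h t * N * cos (\<phi> t)\<bar> \<le> N" by (simp only: abs_mult mult_1_left mult_1_right)
  have "\<bar>h t\<bar> * \<bar>N * (1 + t)\<bar>\<^sup>2 * \<bar>sin (\<phi> t)\<bar> \<le> 1 * (N * 2)\<^sup>2 * 1"
    using bh n N by (intro mult_mono power_mono mult_nonneg_nonneg) auto
  moreover have "\<bar>h t * (N * (1 + t))\<^sup>2 * sin (\<phi> t)\<bar> = \<bar>h t\<bar> * \<bar>N * (1 + t)\<bar>\<^sup>2 * \<bar>sin (\<phi> t)\<bar>"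
    by (simp add: abs_mult power_mult_distrib)
  moreover have "1 * (N * 2)\<^sup>2 * 1 = 4 * N\<^sup>2" by (simp add: power_mult_distrib)
  ultimately have 4: "\<bar>h t * (N * (1 + t))\<^sup>2 * sin (\<phi> t)\<bar> \<le> 4 * N\<^sup>2" by linarith
  have "\<bar>h2 t * sin (\<phi> t)\<bar> + 2 * \<bar>h1 t * (N * (1 + t)) * cos (\<phi> t)\<bar> + \<bar>h t * N * cos (\<phi> t)\<bar>
    + \<bar>h t * (N * (1 + t))\<^sup>2 * sin (\<phi> t)\<bar> \<le> X + 4 * (X * N) + N + 4 * N\<^sup>2"
    using 1 2 3 4 by linarith
  also have "\<dots> \<le> X * N\<^sup>2 + 4 * (X * N\<^sup>2) + N\<^sup>2 + 4 * N\<^sup>2"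
    using NN X by (intro add_mono mult_left_mono) (auto simp: mult_le_cancel_left1)
  also have "\<dots> = (5 * X + 5) * N\<^sup>2" by (simp add: algebra_simps)
  finally have sum: "\<bar>h2 t * sin (\<phi> t)\<bar> + 2 * \<bar>h1 t * (N * (1 + t)) * cos (\<phi> t)\<bar> + \<bar>h t * N * cos (\<phi> t)\<bar>
    + \<bar>h t * (N * (1 + t))\<^sup>2 * sin (\<phi> t)\<bar> \<le> (5 * X + 5) * N\<^sup>2" .
  have tri: "\<bar>A + 2 * B + C - D\<bar> \<le> \<bar>A\<bar> + 2 * \<bar>B\<bar> + \<bar>C\<bar> + \<bar>D\<bar>" for A B C D :: real by linarith
  have "\<bar>h2 t * sin (\<phi> t) + 2 * (h1 t * (N * (1 + t)) * cos (\<phi> t)) + h t * N * cos (\<phi> t)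
    - h t * (N * (1 + t))\<^sup>2 * sin (\<phi> t)\<bar> \<le> (5 * X + 5) * N\<^sup>2"
    by (rule order_trans[OF tri sum])
  then show ?thesis using \<epsilon> by (simp add: f''_def abs_mult mult.assoc)
qed

text \<open>Splitting sine and cosine into exponentials, \<open>f' / 2\<close> times the phase is a
  sum of two oscillating terms with phase derivatives 2 \<mu> + N (1 + t), which never vanishes, and
  2 \<mu> - N (1 + t), which vanishes at t = 2 \<mu> / N - 1. For \<mu> \<ge> 4 N there is no
  resonance, but the weight grows with \<mu>; for \<mu> < 4 N the interval is cut at the resonance,
  and the two pieces give the square in the conclusion. Of the smallness conditions, the first and
  third bound the primitive and the total weight in the resonant regime, the second and fourth in
  the other one.\<close>

lemma transfer:
  fixes z :: "real \<Rightarrow> complex"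
  assumes ab: "0 \<le> a" "a < b" "b \<le> 1" and \<mu>: "\<mu> \<ge> 0" and s: "s \<le> 1/4"
    and s1: "\<epsilon> * (4 * L * sqrt N) \<le> s" "\<epsilon> * L \<le> s"
      "\<epsilon>\<^sup>2 * N * (L / 2 + 16) * (L + 5 * L * ln (1 + sqrt N)) \<le> s"
      "\<epsilon>\<^sup>2 * N * (L\<^sup>2 + 8 * L) \<le> s"
    and t: "t \<in> {a..b}"
    and z: "\<And>x. x \<in> {a..t} \<Longrightarrow> (z has_vector_derivative
        - \<i> * of_real (\<mu> * exp (f x)) * z x + of_real (f' x / 2) * cnj (z x)) (at x)"
  shows "norm (z t) \<le> (1 + 6 * s)\<^sup>2 * norm (z a)"
proof -
  have L0: "L > 0" using L by simp
  have s0: "s \<ge> 0" using s1(2) \<epsilon> L0 by (meson mult_nonneg_nonneg less_imp_le order_trans)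
  define gp where "gp t = complex_of_real (h t * (N * (1 + t))) - \<i> * of_real (h1 t)" for t
  define gm where "gm t = complex_of_real (h t * (N * (1 + t))) + \<i> * of_real (h1 t)" for t
  define dp where "dp t = complex_of_real (h1 t * (N * (1 + t)) + N * h t) - \<i> * of_real (h2 t)" for t
  define dm where "dm t = complex_of_real (h1 t * (N * (1 + t)) + N * h t) + \<i> * of_real (h2 t)" for t
  have n: "((\<lambda>t. N * (1 + t)) has_real_derivative N) (at t)" for t
    by (auto intro!: derivative_eq_intros)
  have dg: "(gp has_vector_derivative dp t) (at t)" "(gm has_vector_derivative dm t) (at t)" for t
  proof -
    have 1: "((\<lambda>t. complex_of_real (h t * (N * (1 + t)))) has_vector_derivative of_real (h1 t * (N * (1 + t)) + N * h t)) (at t)"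
      using has_vector_derivative_of_real[of "\<lambda>t. h t * (N * (1 + t))"] DERIV_mult[OF dh n]
      by (simp only: has_real_derivative_iff_has_vector_derivative) blast
    have 2: "((\<lambda>t. \<i> * complex_of_real (h1 t)) has_vector_derivative \<i> * of_real (h2 t)) (at t)"
      using has_vector_derivative_of_real[of "h1"] dh1
      by (intro has_vector_derivative_mult_right) (simp only: has_real_derivative_iff_has_vector_derivative, blast)
    show "(gp has_vector_derivative dp t) (at t)" "(gm has_vector_derivative dm t) (at t)"
      unfolding gp_def[abs_def] gm_def[abs_def] dp_def dm_def
      using has_vector_derivative_diff[OF 1 2] has_vector_derivative_add[OF 1 2] by auto
  qed
  have ng: "norm (gp t) \<le> L * N" "norm (gm t) \<le> L * N" "norm (dp t) \<le> L * N" "norm (dm t) \<le> L * N"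
    if t: "t \<in> {0..1}" for t
  proof -
    have "norm (gp t) \<le> \<bar>h t * (N * (1 + t))\<bar> + \<bar>h1 t\<bar>" "norm (gm t) \<le> \<bar>h t * (N * (1 + t))\<bar> + \<bar>h1 t\<bar>"
      unfolding gp_def gm_def
      by (rule order_trans[OF norm_triangle_ineq4], simp add: norm_mult abs_mult del: of_real_mult)
         (rule order_trans[OF norm_triangle_ineq], simp add: norm_mult abs_mult del: of_real_mult)
    then show "norm (gp t) \<le> L * N" "norm (gm t) \<le> L * N"
      using amplitude_le[OF t] bh(2)[of t] L(2) by linarith+
    have "norm (dp t) \<le> \<bar>h1 t * (N * (1 + t)) + N * h t\<bar> + \<bar>h2 t\<bar>" "norm (dm t) \<le> \<bar>h1 t * (N * (1 + t)) + N * h t\<bar> + \<bar>h2 t\<bar>"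
      unfolding dp_def dm_def
      by (rule order_trans[OF norm_triangle_ineq4], simp add: norm_mult del: of_real_mult of_real_add)
         (rule order_trans[OF norm_triangle_ineq], simp add: norm_mult del: of_real_mult of_real_add)
    moreover have "\<bar>h1 t\<bar> * \<bar>N * (1 + t)\<bar> \<le> X * (N * 2)"
      using bh X t N by (intro mult_mono) auto
    moreover have "N * \<bar>h t\<bar> \<le> N * 1" using bh N by (intro mult_left_mono) auto
    moreover have "\<bar>h1 t * (N * (1 + t)) + N * h t\<bar> \<le> \<bar>h1 t\<bar> * \<bar>N * (1 + t)\<bar> + N * \<bar>h t\<bar>"
      using N abs_triangle_ineq[of "h1 t * (N * (1 + t))" "N * h t"] by (simp add: abs_mult)
    ultimately show "norm (dp t) \<le> L * N" "norm (dm t) \<le> L * N"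
      using bh(3)[of t] L(3) by (simp_all add: mult_ac)
  qed
  have cg: "continuous_on UNIV (\<lambda>t. gp t * cis (2 * \<mu> * t + \<phi> t))" "continuous_on UNIV (\<lambda>t. gm t * cis (2 * \<mu> * t - \<phi> t))"
    unfolding gp_def[abs_def] gm_def[abs_def] by (intro continuous_intros cont continuous_on_cis)+
  obtain Ip where Ip: "\<And>t. t \<in> {a..b} \<Longrightarrow> (Ip has_vector_derivative gp t * cis (2 * \<mu> * t + \<phi> t)) (at t)"
    using antiderivative_exists[OF cg(1)] by metis
  obtain Im where Im: "\<And>t. t \<in> {a..b} \<Longrightarrow> (Im has_vector_derivative gm t * cis (2 * \<mu> * t - \<phi> t)) (at t)"
    using antiderivative_exists[OF cg(2)] by metis
  \<comment> \<open>The sum of the two terms is 2 f' / \<epsilon> times the phase: \<open>gp\<close>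
    and \<open>gm\<close> are conjugate to each other, the real part being the cosine amplitude and
    the imaginary part, up to sign, the sine amplitude of f'.\<close>
  have key: "of_real (\<epsilon> / 4) * (gp t * cis (2 * \<mu> * t + \<phi> t) + gm t * cis (2 * \<mu> * t - \<phi> t))
      = of_real (f' t / 2) * cis (2 * \<mu> * t)" for t
    by (simp add: complex_eq_iff gp_def gm_def f'_def cos_add sin_add cos_diff sin_diff field_simps)
  \<comment> \<open>A and B are free constants of integration; below they are the values at a or at
    b, depending on where the primitive has to vanish.\<close>
  have PD: "((\<lambda>t. of_real (\<epsilon> / 4) * ((Ip t - A) + (Im t - B))) has_vector_derivative of_real (f' t / 2) * cis (2 * \<mu> * t)) (at t)"
    if t: "t \<in> {a..b}" for t A B
    unfolding key[symmetric] using Ip[OF t] Im[OF t] by (auto intro!: derivative_eq_intros has_vector_derivative_mult_right)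
  have oscp: "norm (Ip y - Ip x) \<le> 4 * (L * N) / (2 * \<mu> + N)" if xy: "a \<le> x" "x \<le> y" "y \<le> b" for x y
  proof (rule oscillatory_integral_bound[where g = gp and g' = dp and \<psi> = "\<lambda>t. 2 * \<mu> * t + \<phi> t" and \<alpha> = "2 * \<mu> + N" and \<kappa> = N])
    show "((\<lambda>t. 2 * \<mu> * t + \<phi> t) has_real_derivative 2 * \<mu> + N + N * t) (at t)" for t
      by (auto intro!: derivative_eq_intros d\<phi> simp: algebra_simps)
    show "(\<forall>t\<in>{x..y}. 2 * \<mu> + N \<le> 2 * \<mu> + N + N * t) \<or> (\<forall>t\<in>{x..y}. 2 * \<mu> + N + N * t \<le> - (2 * \<mu> + N))"
      using xy ab N by auto
  qed (use xy ab dg ng Ip \<mu> N in auto)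
  have oscm: "norm (Im y - Im x) \<le> 4 * (L * N) / m"
    if xy: "a \<le> x" "x \<le> y" "y \<le> b" "m > 0"
      and sg: "(\<forall>t\<in>{x..y}. m \<le> 2 * \<mu> - N + - N * t) \<or> (\<forall>t\<in>{x..y}. 2 * \<mu> - N + - N * t \<le> - m)" for x y m
  proof (rule oscillatory_integral_bound[where g = gm and g' = dm and \<psi> = "\<lambda>t. 2 * \<mu> * t - \<phi> t" and \<alpha> = "2 * \<mu> - N" and \<kappa> = "- N"])
    show "((\<lambda>t. 2 * \<mu> * t - \<phi> t) has_real_derivative 2 * \<mu> - N + - N * t) (at t)" for t
      by (auto intro!: derivative_eq_intros d\<phi> simp: algebra_simps)
    show "(\<forall>t\<in>{x..y}. m \<le> 2 * \<mu> - N + - N * t) \<or> (\<forall>t\<in>{x..y}. 2 * \<mu> - N + - N * t \<le> - m)" by (rule sg)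
  qed (use xy ab dg ng Im in auto)
  have lipm: "norm (Im y - Im x) \<le> L * N * (y - x)" if "a \<le> x" "x \<le> y" "y \<le> b" for x y
    by (rule norm_diff_le_const[where f' = "\<lambda>t. gm t * cis (2 * \<mu> * t - \<phi> t)"])
       (use that ab Im ng in \<open>auto simp: norm_mult\<close>)
  have cc: "continuous_on UNIV (\<lambda>x. exp (f x))" by (intro continuous_intros cont)
  have weight: "\<bar>f' x\<bar> / 2 + 2 * \<mu> * \<bar>exp (f x) - 1\<bar> \<le> \<epsilon> * L * N / 2 + 4 * \<mu> * \<epsilon>" if x: "x \<in> {a..b}" for x
  proof -
    have x': "x \<in> {0..1}" using x ab by auto
    have "\<bar>exp (f x) - 1\<bar> \<le> 2 * \<bar>f x\<bar>" using f_le[of x] \<epsilon> by (intro abs_exp_minus_1_le) auto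
    also have "\<dots> \<le> 2 * \<epsilon>" using f_le[of x] by simp
    finally have "2 * \<mu> * \<bar>exp (f x) - 1\<bar> \<le> 2 * \<mu> * (2 * \<epsilon>)" using \<mu> by (intro mult_left_mono) auto
    also have "2 * \<mu> * (2 * \<epsilon>) = 4 * \<mu> * \<epsilon>" by simp
    finally show ?thesis using f'_le[OF x'] by linarith
  qed
  show ?thesis
  proof (cases "\<mu> \<ge> 4 * N")
    case True
    define P where "P t = of_real (\<epsilon> / 4) * ((Ip t - Ip a) + (Im t - Im a))" for t
    have \<mu>0: "\<mu> > 0" using True N by linarith
    have P: "norm (P t) \<le> 2 * \<epsilon> * (L * N / \<mu>)" if t: "t \<in> {a..b}" for t
    proof -
      have "norm (Ip t - Ip a) \<le> 4 * (L * N) / (2 * \<mu> + N)" using oscp t by auto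
      also have "\<dots> \<le> 4 * (L * N) / \<mu>" using \<mu>0 N L0 by (intro divide_left_mono) auto
      finally have 1: "norm (Ip t - Ip a) \<le> 4 * (L * N) / \<mu>" .
      have 2: "norm (Im t - Im a) \<le> 4 * (L * N) / \<mu>"
      proof (rule oscm)
        have "\<forall>x\<in>{a..t}. \<mu> \<le> 2 * \<mu> - N + - N * x"
        proof
          fix x assume "x \<in> {a..t}"
          then have "N * x \<le> N * 1" using t ab N by (intro mult_left_mono) auto
          moreover have "- N * x = - (N * x)" by simp
          ultimately show "\<mu> \<le> 2 * \<mu> - N + - N * x" using True N by linarith
        qed
        then show "(\<forall>x\<in>{a..t}. \<mu> \<le> 2 * \<mu> - N + - N * x) \<or> (\<forall>x\<in>{a..t}. 2 * \<mu> - N + - N * x \<le> - \<mu>)" ..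
      qed (use t \<mu>0 in auto)
      have "norm (P t) = \<epsilon> / 4 * norm ((Ip t - Ip a) + (Im t - Im a))"
        using \<epsilon> by (simp add: P_def norm_mult)
      also have "\<dots> \<le> \<epsilon> / 4 * (4 * (L * N) / \<mu> + 4 * (L * N) / \<mu>)"
        using \<epsilon> 1 2 by (intro mult_left_mono order_trans[OF norm_triangle_ineq add_mono]) auto
      also have "\<dots> = 2 * \<epsilon> * (L * N / \<mu>)" by simp
      finally show ?thesis .
    qed
    have LN: "L * N / \<mu> \<le> L / 4" using True N L0 \<mu>0 by (simp add: divide_simps mult_ac)
    then have LN': "L * N / \<mu> \<le> L" using L0 by linarith
    define W where "W = \<epsilon>\<^sup>2 * N * (L\<^sup>2 + 8 * L)"
    have "norm (z t) \<le> (1 + 6 * s) * norm (z a)"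
    proof (rule near_identity_transfer[OF \<mu> s0 s t z _ cc, where P = P and \<rho> = "\<lambda>x. W * x" and \<rho>' = "\<lambda>x. W"])
      have "W * (b - a) \<le> W * 1" using ab N L0 by (intro mult_left_mono) (auto simp: W_def)
      then show "W * b - W * a \<le> s" using s1(4) by (simp add: W_def[symmetric] right_diff_distrib)
      fix x assume x: "x \<in> {a..b}"
      show "(P has_vector_derivative of_real (f' x / 2) * cis (2 * \<mu> * x)) (at x)"
        unfolding P_def[abs_def] by (rule PD[OF x])
      have "norm (P x) \<le> 2 * \<epsilon> * (L / 4)"
        using P[OF x] LN \<epsilon> by (smt (verit) mult_left_mono)
      also have "\<dots> \<le> \<epsilon> * L" using \<epsilon> L0 by simp
      finally show "norm (P x) \<le> s" using s1(2) by simp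
      show "((\<lambda>x. W * x) has_real_derivative W) (at x)" by (auto intro!: derivative_eq_intros)
      \<comment> \<open>The primitive decays like 1 / \<mu>, which pays for the factor \<mu> in the
        weight: the product is bounded uniformly in \<mu> \<ge> 4 N.\<close>
      have "norm (P x) * (\<bar>f' x\<bar> / 2 + 2 * \<mu> * \<bar>exp (f x) - 1\<bar>) \<le> (2 * \<epsilon> * (L * N / \<mu>)) * (\<epsilon> * L * N / 2 + 4 * \<mu> * \<epsilon>)"
        using P[OF x] weight[OF x] \<mu> \<epsilon> L0 N by (intro mult_mono) auto
      also have "\<dots> = \<epsilon>\<^sup>2 * N * L * (L * N / \<mu>) + 8 * \<epsilon>\<^sup>2 * N * L"
        using \<mu>0 by (simp add: field_simps power2_eq_square)
      also have "\<dots> \<le> \<epsilon>\<^sup>2 * N * L * L + 8 * \<epsilon>\<^sup>2 * N * L"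
        using LN' L0 N by (intro add_mono mult_left_mono[OF LN'] mult_nonneg_nonneg) auto
      also have "\<dots> = W" by (simp add: W_def power2_eq_square algebra_simps)
      finally show "norm (P x) * (\<bar>f' x\<bar> / 2 + 2 * \<mu> * \<bar>exp (f x) - 1\<bar>) \<le> W" .
    qed
    also have "\<dots> \<le> (1 + 6 * s)\<^sup>2 * norm (z a)"
      using s0 by (intro mult_right_mono) (auto simp: power2_eq_square mult_le_cancel_left1 add_pos_nonneg)
    finally show ?thesis .
  next
    case False
    \<comment> \<open>\<open>p\<close> is the resonance time. To its left (right) the primitive \<open>P\<close> is normalized to vanish at \<open>a\<close>
      (at \<open>b\<close>): it then decays away from \<open>p\<close>, whereas a single primitive on \<open>[a, b]\<close> would keep the
      contribution of the resonance.\<close>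
    define p where "p = max a (min b (2 * \<mu> / N - 1))"
    have p: "a \<le> p" "p \<le> b" using ab by (auto simp: p_def)
    \<comment> \<open>If the resonance time lies outside the interval, p is an endpoint and one side
      degenerates to a point; hence the strict hypotheses of this fact and of the next one.\<close>
    have pl: "N * p \<le> 2 * \<mu> - N" if "a < p"
    proof -
      have "p \<le> 2 * \<mu> / N - 1" using that by (auto simp: p_def)
      then show ?thesis using N by (simp add: field_simps)
    qed
    have pr: "2 * \<mu> - N \<le> N * p" if "p < b"
    proof -
      have "2 * \<mu> / N - 1 \<le> p" using that by (auto simp: p_def min_def max_def split: if_splits)
      then show ?thesis using N by (simp add: field_simps)
    qed
    have N0: "N > 0" and sN: "sqrt N > 0" using N by auto
    have left: "norm (Im x - Im a) \<le> 10 * L * sqrt N / (1 + sqrt N * (p - x))" if x: "x \<in> {a..p}" for x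
    proof -
      \<comment> \<open>Reflection: the left side is described by the distance u = p - x to the
        resonance.\<close>
      have "norm (Im (p - (p - a)) - Im (p - (p - x))) \<le> 10 * L * sqrt N / (1 + sqrt N * (p - x))"
      proof (rule near_far_bound[OF _ N0])
        fix u v assume uv: "0 \<le> u" "u \<le> v" "v \<le> p - a"
        show "norm (Im (p - v) - Im (p - u)) \<le> L * N * (v - u)"
          using lipm[of "p - v" "p - u"] uv p by (simp add: norm_minus_commute)
      next
        fix u v assume uv: "0 < u" "u \<le> v" "v \<le> p - a"
        have "norm (Im (p - u) - Im (p - v)) \<le> 4 * (L * N) / (N * u)"
        proof (rule oscm)
          have "\<forall>y\<in>{p - v..p - u}. N * u \<le> 2 * \<mu> - N + - N * y"
          proof
            fix y assume "y \<in> {p - v..p - u}"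
            then have "N * (y + u) \<le> N * p" using N0 by (intro mult_left_mono) auto
            then show "N * u \<le> 2 * \<mu> - N + - N * y" using pl uv by (simp add: algebra_simps)
          qed
          then show "(\<forall>y\<in>{p - v..p - u}. N * u \<le> 2 * \<mu> - N + - N * y) \<or> (\<forall>y\<in>{p - v..p - u}. 2 * \<mu> - N + - N * y \<le> - (N * u))" ..
        qed (use uv p N0 in auto)
        then show "norm (Im (p - v) - Im (p - u)) \<le> 4 * L / u" using N0 by (simp add: norm_minus_commute)
      qed (use x L0 in auto)
      then show ?thesis by (simp add: norm_minus_commute)
    qed
    have right: "norm (Im x - Im b) \<le> 10 * L * sqrt N / (1 + sqrt N * (x - p))" if x: "x \<in> {p..b}" for x
    proof -
      have "norm (Im (p + (b - p)) - Im (p + (x - p))) \<le> 10 * L * sqrt N / (1 + sqrt N * (x - p))"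
      proof (rule near_far_bound[OF _ N0])
        fix u v assume uv: "0 \<le> u" "u \<le> v" "v \<le> b - p"
        show "norm (Im (p + v) - Im (p + u)) \<le> L * N * (v - u)"
          using lipm[of "p + u" "p + v"] uv p by simp
      next
        fix u v assume uv: "0 < u" "u \<le> v" "v \<le> b - p"
        have "norm (Im (p + v) - Im (p + u)) \<le> 4 * (L * N) / (N * u)"
        proof (rule oscm)
          have "\<forall>y\<in>{p + u..p + v}. 2 * \<mu> - N + - N * y \<le> - (N * u)"
          proof
            fix y assume "y \<in> {p + u..p + v}"
            then have "N * (p + u) \<le> N * y" using N0 by (intro mult_left_mono) auto
            then show "2 * \<mu> - N + - N * y \<le> - (N * u)" using pr uv by (simp add: algebra_simps)
          qed
          then show "(\<forall>y\<in>{p + u..p + v}. N * u \<le> 2 * \<mu> - N + - N * y) \<or> (\<forall>y\<in>{p + u..p + v}. 2 * \<mu> - N + - N * y \<le> - (N * u))" ..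
        qed (use uv p N0 in auto)
        then show "norm (Im (p + v) - Im (p + u)) \<le> 4 * L / u" using N0 by simp
      qed (use x L0 in auto)
      then show ?thesis by (simp add: norm_minus_commute)
    qed
    have oscp': "norm (Ip y - Ip x) \<le> 4 * L" if "a \<le> x" "x \<le> y" "y \<le> b" for x y
    proof -
      have "norm (Ip y - Ip x) \<le> 4 * (L * N) / (2 * \<mu> + N)" by (rule oscp[OF that])
      also have "\<dots> \<le> 4 * (L * N) / N" using \<mu> N0 L0 by (intro divide_left_mono) auto
      finally show ?thesis using N0 by simp
    qed
    define W where "W = \<epsilon> / 4 * (\<epsilon> * N * (L / 2 + 16))"
    have W0: "W \<ge> 0" using \<epsilon> N0 L0 by (simp add: W_def)
    have w: "\<bar>f' x\<bar> / 2 + 2 * \<mu> * \<bar>exp (f x) - 1\<bar> \<le> \<epsilon> * N * (L / 2 + 16)" if "x \<in> {a..b}" for x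
    proof -
      have "4 * \<mu> * \<epsilon> \<le> 4 * (4 * N) * \<epsilon>" using False \<epsilon> by (intro mult_right_mono) auto
      then show ?thesis using weight[OF that] by (simp add: algebra_simps)
    qed
    \<comment> \<open>Integrating the bound 10 L sqrt N / (1 + sqrt N u) of the primitive over the
      distance u to the resonance produces the logarithm of the third smallness condition.\<close>
    have final: "W * (4 * L * d + 10 * L * ln (1 + sqrt N * d)) \<le> s" if d: "0 \<le> d" "d \<le> 1" for d
    proof -
      have "sqrt N * d \<le> sqrt N * 1" using d sN by (intro mult_left_mono) auto
      then have "ln (1 + sqrt N * d) \<le> ln (1 + sqrt N)" using d sN by (subst ln_le_cancel_iff) (auto simp: add_pos_nonneg)
      then have "W * (4 * L * d + 10 * L * ln (1 + sqrt N * d)) \<le> W * (4 * L * 1 + 10 * L * ln (1 + sqrt N))"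
        using W0 L0 d by (intro mult_left_mono add_mono) auto
      also have "\<dots> \<le> W * (4 * (L + 5 * L * ln (1 + sqrt N)))"
        using W0 L0 sN by (intro mult_left_mono) auto
      also have "\<dots> = \<epsilon>\<^sup>2 * N * (L / 2 + 16) * (L + 5 * L * ln (1 + sqrt N))"
        by (simp add: W_def power2_eq_square algebra_simps)
      finally show ?thesis using s1(3) by simp
    qed
    have nP: "norm (of_real (\<epsilon> / 4) * (A + B)) \<le> \<epsilon> / 4 * (4 * L + 10 * L * sqrt N / (1 + sqrt N * u))"
      if "norm A \<le> 4 * L" "norm B \<le> 10 * L * sqrt N / (1 + sqrt N * u)" for A B :: complex and u
      unfolding norm_mult using \<epsilon> that
      by (auto intro!: mult_left_mono order_trans[OF norm_triangle_ineq add_mono])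
    have small: "\<epsilon> / 4 * (4 * L + 10 * L * sqrt N / (1 + sqrt N * u)) \<le> s" if u: "u \<ge> 0" for u
    proof -
      have "10 * L * sqrt N / (1 + sqrt N * u) \<le> 10 * L * sqrt N / 1"
        using u L0 sN by (intro divide_left_mono) (auto simp: add_pos_nonneg)
      moreover have "L * 1 \<le> L * sqrt N" using N L0 by (intro mult_left_mono) auto
      moreover have "10 * L * sqrt N / 1 = 10 * (L * sqrt N)" "4 * (4 * L * sqrt N) = 16 * (L * sqrt N)" by simp_all
      moreover have "0 \<le> L * sqrt N" using L0 sN by simp
      ultimately have "4 * L + 10 * L * sqrt N / (1 + sqrt N * u) \<le> 4 * (4 * L * sqrt N)" by linarith
      then have "\<epsilon> / 4 * (4 * L + 10 * L * sqrt N / (1 + sqrt N * u)) \<le> \<epsilon> / 4 * (4 * (4 * L * sqrt N))"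
        using \<epsilon> by (intro mult_left_mono) auto
      also have "\<dots> = \<epsilon> * (4 * L * sqrt N)" by simp
      finally show ?thesis using s1(1) by linarith
    qed
    have step1: "norm (z t) \<le> (1 + 6 * s) * norm (z a)" if t: "t \<in> {a..p}"
      and z: "\<And>x. x \<in> {a..t} \<Longrightarrow> (z has_vector_derivative
        - \<i> * of_real (\<mu> * exp (f x)) * z x + of_real (f' x / 2) * cnj (z x)) (at x)" for t
    proof (rule near_identity_transfer[OF \<mu> s0 s t z _ cc,
          where P = "\<lambda>t. of_real (\<epsilon> / 4) * ((Ip t - Ip a) + (Im t - Im a))"
            and \<rho> = "\<lambda>x. W * (4 * L * x - 10 * L * ln (1 + sqrt N * (p - x)))"
            and \<rho>' = "\<lambda>x. W * (4 * L + 10 * L * sqrt N / (1 + sqrt N * (p - x)))"])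
      show "W * (4 * L * p - 10 * L * ln (1 + sqrt N * (p - p))) - W * (4 * L * a - 10 * L * ln (1 + sqrt N * (p - a))) \<le> s"
        using final[of "p - a"] p ab by (simp add: algebra_simps)
      fix x assume x: "x \<in> {a..p}"
      then have x': "x \<in> {a..b}" using p by auto
      show "((\<lambda>t. of_real (\<epsilon> / 4) * ((Ip t - Ip a) + (Im t - Im a))) has_vector_derivative of_real (f' x / 2) * cis (2 * \<mu> * x)) (at x)"
        by (rule PD[OF x'])
      have nPx: "norm (of_real (\<epsilon> / 4) * ((Ip x - Ip a) + (Im x - Im a))) \<le> \<epsilon> / 4 * (4 * L + 10 * L * sqrt N / (1 + sqrt N * (p - x)))"
        by (rule nP[OF oscp' left[OF x]]) (use x' in auto)
      then show "norm (of_real (\<epsilon> / 4) * ((Ip x - Ip a) + (Im x - Im a))) \<le> s"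
        by (rule order_trans[OF _ small]) (use x in auto)
      have pos: "1 + sqrt N * (p - x) > 0" using x sN by (simp add: add_pos_nonneg)
      show "((\<lambda>x. W * (4 * L * x - 10 * L * ln (1 + sqrt N * (p - x)))) has_real_derivative
          W * (4 * L + 10 * L * sqrt N / (1 + sqrt N * (p - x)))) (at x)"
        using pos by (auto intro!: derivative_eq_intros simp: field_simps)
      have "norm (of_real (\<epsilon> / 4) * ((Ip x - Ip a) + (Im x - Im a))) * (\<bar>f' x\<bar> / 2 + 2 * \<mu> * \<bar>exp (f x) - 1\<bar>)
        \<le> (\<epsilon> / 4 * (4 * L + 10 * L * sqrt N / (1 + sqrt N * (p - x)))) * (\<epsilon> * N * (L / 2 + 16))"
        using nPx w[OF x'] \<mu> order_trans[OF norm_ge_zero nPx] by (intro mult_mono) auto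
      then show "norm (of_real (\<epsilon> / 4) * ((Ip x - Ip a) + (Im x - Im a))) * (\<bar>f' x\<bar> / 2 + 2 * \<mu> * \<bar>exp (f x) - 1\<bar>)
        \<le> W * (4 * L + 10 * L * sqrt N / (1 + sqrt N * (p - x)))" by (simp add: W_def mult_ac)
    qed
    have step2: "norm (z t) \<le> (1 + 6 * s) * norm (z p)" if t': "t \<in> {p..b}"
    proof (rule near_identity_transfer[OF \<mu> s0 s t' z _ cc,
          where P = "\<lambda>t. of_real (\<epsilon> / 4) * ((Ip t - Ip b) + (Im t - Im b))"
            and \<rho> = "\<lambda>x. W * (4 * L * x + 10 * L * ln (1 + sqrt N * (x - p)))"
            and \<rho>' = "\<lambda>x. W * (4 * L + 10 * L * sqrt N / (1 + sqrt N * (x - p)))"])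
      show "x \<in> {p..t} \<Longrightarrow> x \<in> {a..t}" for x using p by auto
      show "W * (4 * L * b + 10 * L * ln (1 + sqrt N * (b - p))) - W * (4 * L * p + 10 * L * ln (1 + sqrt N * (p - p))) \<le> s"
        using final[of "b - p"] p ab by (simp add: algebra_simps)
      fix x assume x: "x \<in> {p..b}"
      then have x': "x \<in> {a..b}" using p by auto
      show "((\<lambda>t. of_real (\<epsilon> / 4) * ((Ip t - Ip b) + (Im t - Im b))) has_vector_derivative of_real (f' x / 2) * cis (2 * \<mu> * x)) (at x)"
        by (rule PD[OF x'])
      have "norm (Ip x - Ip b) \<le> 4 * L" using oscp'[of x b] x' by (simp add: norm_minus_commute)
      then have nPx: "norm (of_real (\<epsilon> / 4) * ((Ip x - Ip b) + (Im x - Im b))) \<le> \<epsilon> / 4 * (4 * L + 10 * L * sqrt N / (1 + sqrt N * (x - p)))"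
        by (rule nP[OF _ right[OF x]])
      then show "norm (of_real (\<epsilon> / 4) * ((Ip x - Ip b) + (Im x - Im b))) \<le> s"
        by (rule order_trans[OF _ small]) (use x in auto)
      have pos: "1 + sqrt N * (x - p) > 0" using x sN by (simp add: add_pos_nonneg)
      show "((\<lambda>x. W * (4 * L * x + 10 * L * ln (1 + sqrt N * (x - p)))) has_real_derivative
          W * (4 * L + 10 * L * sqrt N / (1 + sqrt N * (x - p)))) (at x)"
        using pos by (auto intro!: derivative_eq_intros simp: field_simps)
      have "norm (of_real (\<epsilon> / 4) * ((Ip x - Ip b) + (Im x - Im b))) * (\<bar>f' x\<bar> / 2 + 2 * \<mu> * \<bar>exp (f x) - 1\<bar>)
        \<le> (\<epsilon> / 4 * (4 * L + 10 * L * sqrt N / (1 + sqrt N * (x - p)))) * (\<epsilon> * N * (L / 2 + 16))"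
        using nPx w[OF x'] \<mu> order_trans[OF norm_ge_zero nPx] by (intro mult_mono) auto
      then show "norm (of_real (\<epsilon> / 4) * ((Ip x - Ip b) + (Im x - Im b))) * (\<bar>f' x\<bar> / 2 + 2 * \<mu> * \<bar>exp (f x) - 1\<bar>)
        \<le> W * (4 * L + 10 * L * sqrt N / (1 + sqrt N * (x - p)))" by (simp add: W_def mult_ac)
    qed
    show ?thesis
    proof (cases "t \<le> p")
      case True
      have "norm (z t) \<le> (1 + 6 * s) * norm (z a)" by (rule step1) (use t True z in auto)
      also have "\<dots> \<le> (1 + 6 * s)\<^sup>2 * norm (z a)"
        using s0 by (intro mult_right_mono) (auto simp: power2_eq_square mult_le_cancel_left1 add_pos_nonneg)
      finally show ?thesis .
    next
      case False
      have "norm (z t) \<le> (1 + 6 * s) * norm (z p)" by (rule step2) (use t False in auto)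
      also have "norm (z p) \<le> (1 + 6 * s) * norm (z a)" by (rule step1) (use t p False z in auto)
      finally show ?thesis using s0 by (simp add: power2_eq_square mult.assoc mult_left_mono)
    qed
  qed
qed

end

section \<open>Roughness of a chirp\<close>

definition wave_ode :: "(real \<Rightarrow> real) \<Rightarrow> real \<Rightarrow> (real \<Rightarrow> real) \<Rightarrow> (real \<Rightarrow> real) \<Rightarrow> real \<Rightarrow> bool" where
  "wave_ode F \<mu> w w' t \<longleftrightarrow> (w has_real_derivative w' t) (at t) \<and>
     (w' has_real_derivative - (\<mu>\<^sup>2 * (exp (F t))\<^sup>2 * w t)) (at t)"

text \<open>This is w'^2 + \<mu>^2 c^2 w^2 divided by the speed c = exp F, the adiabatic invariant
  of the oscillator: along solutions its derivative is F' times a difference of kinetic and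
  potential part, which oscillates.\<close>

definition energy :: "(real \<Rightarrow> real) \<Rightarrow> real \<Rightarrow> (real \<Rightarrow> real) \<Rightarrow> (real \<Rightarrow> real) \<Rightarrow> real \<Rightarrow> real" where
  "energy F \<mu> w w' t = \<mu>\<^sup>2 * exp (F t) * (w t)\<^sup>2 + exp (- F t) * (w' t)\<^sup>2"

text \<open>The equation is required only on [a, t], so that the bound also applies to a solution
  that is given on part of a block.\<close>

definition gain_bound :: "(real \<Rightarrow> real) \<Rightarrow> real \<Rightarrow> real \<Rightarrow> real \<Rightarrow> bool" where
  "gain_bound F a b \<eta> \<longleftrightarrow> (\<forall>\<mu>\<ge>0. \<forall>w w'. \<forall>t\<in>{a..b}. (\<forall>x\<in>{a..t}. wave_ode F \<mu> w w' x) \<longrightarrow>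
     energy F \<mu> w w' t \<le> (1 + \<eta>) * energy F \<mu> w w' a)"

definition gagliardo_exp :: "real \<Rightarrow> real \<Rightarrow> real \<Rightarrow> (real \<Rightarrow> real) \<Rightarrow> ennreal" where
  "gagliardo_exp \<sigma> a b f =
    (\<integral>\<^sup>+ y\<in>{a<..<b}. (\<integral>\<^sup>+ x\<in>{a<..<b}. ennreal (\<bar>exp (f y) - exp (f x)\<bar> / \<bar>y - x\<bar> powr (1 + \<sigma>)) \<partial>lborel) \<partial>lborel)"

text \<open>Roughness is recorded twice. The seminorm serves the orders below 1. The last clause
  serves s \<ge> 1 in dual form: the derivative of f will be its own test function, and its squared
  integral divided by its supremum bounds the mass of any weak derivative from below.\<close>

definition rough_block :: "real \<Rightarrow> real \<Rightarrow> real \<Rightarrow> real \<Rightarrow> real \<Rightarrow> (real \<Rightarrow> real) \<Rightarrow> bool" where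
  "rough_block a b \<eta> \<sigma> M f \<longleftrightarrow> smooth_on UNIV f \<and>
    (\<exists>a' b'. a < a' \<and> b' < b \<and> (\<forall>x. x \<notin> {a'..b'} \<longrightarrow> f x = 0)) \<and>
    (\<forall>x. \<bar>f x\<bar> \<le> \<eta>) \<and> gain_bound f a b \<eta> \<and>
    ennreal M \<le> gagliardo_exp \<sigma> a b f \<and>
    (\<exists>S>0. (\<forall>x. \<bar>deriv f x\<bar> \<le> S) \<and> M * S \<le> integral {a..b} (\<lambda>x. (deriv f x)\<^sup>2))"

text \<open>In the variable \<open>wkb F \<mu> w w'\<close> the equation with speed \<open>exp F\<close> is a rotation with angular velocity
  \<open>\<mu> exp F\<close>, which preserves the energy, perturbed by a term of size \<open>F'\<close>.\<close>

definition wkb :: "(real \<Rightarrow> real) \<Rightarrow> real \<Rightarrow> (real \<Rightarrow> real) \<Rightarrow> (real \<Rightarrow> real) \<Rightarrow> real \<Rightarrow> complex" where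
  "wkb F \<mu> w w' t = Complex (\<mu> * (exp (F t / 2) * w t)) (exp (- F t / 2) * w' t)"

lemma norm_wkb: "(norm (wkb F \<mu> w w' t))\<^sup>2 = energy F \<mu> w w' t"
proof -
  have "(exp (F t / 2))\<^sup>2 = exp (F t)" "(exp (- F t / 2))\<^sup>2 = exp (- F t)"
    by (simp_all add: power2_eq_square flip: exp_add)
  then show ?thesis by (simp add: wkb_def energy_def cmod_power2 power_mult_distrib)
qed

lemma wkb_ode:
  assumes F: "(F has_real_derivative F' t) (at t)" and w: "wave_ode F \<mu> w w' t"
  shows "(wkb F \<mu> w w' has_vector_derivative
    - \<i> * of_real (\<mu> * exp (F t)) * wkb F \<mu> w w' t + of_real (F' t / 2) * cnj (wkb F \<mu> w w' t)) (at t)"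
proof -
  have w1: "(w has_real_derivative w' t) (at t)"
    and w2: "(w' has_real_derivative - (\<mu>\<^sup>2 * (exp (F t))\<^sup>2 * w t)) (at t)"
    using w by (auto simp: wave_ode_def)
  have e: "exp (F t) = exp (F t / 2) * exp (F t / 2)" by (simp flip: exp_add)
  have e': "exp (- F t / 2) * exp (F t / 2) = 1" by (simp flip: exp_add)
  have 1: "((\<lambda>t. \<mu> * (exp (F t / 2) * w t)) has_real_derivative
      \<mu> * exp (F t) * (exp (- F t / 2) * w' t) + F' t / 2 * (\<mu> * (exp (F t / 2) * w t))) (at t)"
  proof -
    have "((\<lambda>t. \<mu> * (exp (F t / 2) * w t)) has_real_derivative
      \<mu> * (exp (F t / 2) * (F' t / 2) * w t + w' t * exp (F t / 2))) (at t)"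
      by (intro DERIV_cmult DERIV_mult DERIV_chain2[OF DERIV_exp] DERIV_cdivide F w1)
    moreover have "exp (F t) * exp (- F t / 2) = exp (F t / 2)" by (simp flip: exp_add)
    then have "\<mu> * (exp (F t / 2) * (F' t / 2) * w t + w' t * exp (F t / 2)) =
        \<mu> * exp (F t) * (exp (- F t / 2) * w' t) + F' t / 2 * (\<mu> * (exp (F t / 2) * w t))"
      by (metis (no_types, opaque_lifting) distrib_left mult.assoc mult.commute mult.left_commute add.commute)
    ultimately show ?thesis by simp
  qed
  have 2: "((\<lambda>t. exp (- F t / 2) * w' t) has_real_derivative
      - (\<mu> * exp (F t) * (\<mu> * (exp (F t / 2) * w t))) - F' t / 2 * (exp (- F t / 2) * w' t)) (at t)"
  proof -
    have D: "((\<lambda>t. exp (- F t / 2) * w' t) has_real_derivative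
      exp (- F t / 2) * (- F' t / 2) * w' t + - (\<mu>\<^sup>2 * (exp (F t))\<^sup>2 * w t) * exp (- F t / 2)) (at t)"
      by (intro DERIV_mult DERIV_chain2[OF DERIV_exp] DERIV_cdivide DERIV_minus F w2)
    have "(exp (F t))\<^sup>2 * exp (- F t / 2) = exp (F t) * exp (F t / 2)"
      by (simp add: power2_eq_square flip: exp_add)
    then have E: "\<mu>\<^sup>2 * (exp (F t))\<^sup>2 * w t * exp (- F t / 2) = \<mu> * exp (F t) * (\<mu> * (exp (F t / 2) * w t))"
      by (metis (no_types, opaque_lifting) mult.assoc mult.commute mult.left_commute power2_eq_square)
    show ?thesis by (rule DERIV_cong[OF D]) (simp only: mult_minus_left E, simp)
  qed
  show ?thesis
    unfolding has_vector_derivative_complex_iff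
  proof
    show "((\<lambda>x. Re (wkb F \<mu> w w' x)) has_real_derivative Re (- \<i> * of_real (\<mu> * exp (F t)) * wkb F \<mu> w w' t
        + of_real (F' t / 2) * cnj (wkb F \<mu> w w' t))) (at t)"
      unfolding wkb_def complex.sel by (rule DERIV_cong[OF 1]) simp
    show "((\<lambda>x. Im (wkb F \<mu> w w' x)) has_real_derivative Im (- \<i> * of_real (\<mu> * exp (F t)) * wkb F \<mu> w w' t
        + of_real (F' t / 2) * cnj (wkb F \<mu> w w' t))) (at t)"
      unfolding wkb_def complex.sel by (rule DERIV_cong[OF 2]) simp
  qed
qed

lemma half_abs_le_exp_diff:
  fixes u v :: real assumes "\<bar>u\<bar> \<le> 1/2" "\<bar>v\<bar> \<le> 1/2"
  shows "\<bar>u - v\<bar> / 2 \<le> \<bar>exp u - exp v\<bar>"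
proof -
  have *: "(x - y) / 2 \<le> exp x - exp y" if "y \<le> x" "\<bar>y\<bar> \<le> 1/2" for x y :: real
  proof -
    have "1/2 * (x - y) \<le> exp y * (exp (x - y) - 1)"
    proof (rule mult_mono)
      show "1/2 \<le> exp y" using exp_ge_add_one_self[of y] that by linarith
      show "x - y \<le> exp (x - y) - 1" using exp_ge_add_one_self[of "x - y"] by linarith
    qed (use that in auto)
    then show ?thesis by (simp add: right_diff_distrib flip: exp_add)
  qed
  show ?thesis using *[of v u] *[of u v] assms by (cases "v \<le> u") auto
qed

context chirp
begin

lemma gain:
  assumes ab: "0 \<le> a" "a < b" "b \<le> 1" and s: "s \<le> 1/6"
    and s1: "\<epsilon> * (4 * L * sqrt N) \<le> s" "\<epsilon> * L \<le> s"
      "\<epsilon>\<^sup>2 * N * (L / 2 + 16) * (L + 5 * L * ln (1 + sqrt N)) \<le> s"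
      "\<epsilon>\<^sup>2 * N * (L\<^sup>2 + 8 * L) \<le> s"
  shows "gain_bound f a b (90 * s)"
  unfolding gain_bound_def
proof (intro allI impI ballI)
  fix \<mu> t :: real and w w'
  assume \<mu>: "\<mu> \<ge> 0" and t: "t \<in> {a..b}" and w: "\<forall>x\<in>{a..t}. wave_ode f \<mu> w w' x"
  have s0: "s \<ge> 0" using s1(2) \<epsilon> L(1) by (smt (verit) mult_nonneg_nonneg)
  have "norm (wkb f \<mu> w w' t) \<le> (1 + 6 * s)\<^sup>2 * norm (wkb f \<mu> w w' a)"
    by (rule transfer[OF ab \<mu> _ s1 t wkb_ode[where F = f and F' = f', OF df]]) (use w s in auto)
  then have "(norm (wkb f \<mu> w w' t))\<^sup>2 \<le> ((1 + 6 * s)\<^sup>2 * norm (wkb f \<mu> w w' a))\<^sup>2"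
    by (intro power_mono) auto
  then have "energy f \<mu> w w' t \<le> (1 + 6 * s) ^ 4 * energy f \<mu> w w' a"
    by (simp add: norm_wkb power_mult_distrib flip: power_mult)
  \<comment> \<open>For 0 \<le> x \<le> 1 one has (1 + x)^4 \<le> 1 + 15 x; with x = 6 s this gives
    90 s. The power is 4 because the energy is the square of the norm and \<open>transfer\<close>
    already has a square.\<close>
  also have "\<dots> \<le> (1 + 90 * s) * energy f \<mu> w w' a"
  proof (rule mult_right_mono)
    define x where "x = 6 * s"
    have x: "0 \<le> x" "x \<le> 1" using s s0 by (auto simp: x_def)
    have "x ^ 2 \<le> x" "x ^ 3 \<le> x" "x ^ 4 \<le> x"
      using power_decreasing[of 1 2 x] power_decreasing[of 1 3 x] power_decreasing[of 1 4 x] x by simp_all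
    moreover have "(1 + x) ^ 4 = 1 + 4 * x + 6 * x ^ 2 + 4 * x ^ 3 + x ^ 4"
      by (simp add: power4_eq_xxxx power3_eq_cube power2_eq_square algebra_simps)
    ultimately show "(1 + 6 * s) ^ 4 \<le> 1 + 90 * s" by (simp add: x_def)
    show "0 \<le> energy f \<mu> w w' a" by (simp add: energy_def)
  qed
  finally show "energy f \<mu> w w' t \<le> (1 + 90 * s) * energy f \<mu> w w' a" .
qed

section \<open>Lower bounds for the variation and the seminorm of a chirp\<close>

context
  fixes a b c d m k :: real
  assumes ab: "0 \<le> a" "a < c" "c < d" "d < b" "b \<le> 1"
    and m: "0 < m" "\<And>t. t \<in> {c..d} \<Longrightarrow> m \<le> h t"
    and N1: "m / 2 + X * (d - c) \<le> m * (d - c) / 4 * N"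
  defines "k \<equiv> m * (d - c) / 4"
begin

lemma k_pos: "k > 0" using m ab by (simp add: k_def)

text \<open>A minorant of |f'| with an elementary primitive: |cos| is replaced by cos^2, whose mean
  is 1/2, and the term with h1 by its bound X. It may be negative.\<close>

definition "\<psi> y = \<epsilon> * (m * (N * (1 + y)) * (cos (\<phi> y))\<^sup>2 - X)"

lemma \<psi>_le: assumes y: "y \<in> {c..d}" shows "\<psi> y \<le> \<bar>f' y\<bar>"
proof -
  have y1: "1 + y > 0" using y ab by simp
  have "(cos (\<phi> y))\<^sup>2 = \<bar>cos (\<phi> y)\<bar> * \<bar>cos (\<phi> y)\<bar>" by (simp add: power2_eq_square)
  also have "\<dots> \<le> \<bar>cos (\<phi> y)\<bar> * 1" by (intro mult_left_mono) auto
  finally have c2: "(cos (\<phi> y))\<^sup>2 \<le> \<bar>cos (\<phi> y)\<bar>" by simp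
  have "m * (N * (1 + y)) * (cos (\<phi> y))\<^sup>2 \<le> h y * (N * (1 + y)) * \<bar>cos (\<phi> y)\<bar>"
    using m(2)[OF y] m(1) c2 N y1 by (intro mult_mono mult_nonneg_nonneg) auto
  also have "\<dots> = \<bar>h y * (N * (1 + y)) * cos (\<phi> y)\<bar>"
    using m(2)[OF y] m(1) N y1 by (simp add: abs_mult)
  finally have 1: "m * (N * (1 + y)) * (cos (\<phi> y))\<^sup>2 \<le> \<bar>h y * (N * (1 + y)) * cos (\<phi> y)\<bar>" .
  have "\<bar>h1 y\<bar> * \<bar>sin (\<phi> y)\<bar> \<le> X * 1" using bh X by (intro mult_mono) auto
  then have "\<bar>h1 y * sin (\<phi> y)\<bar> \<le> X" by (simp add: abs_mult)
  with 1 have "m * (N * (1 + y)) * (cos (\<phi> y))\<^sup>2 - X \<le> \<bar>h1 y * sin (\<phi> y) + h y * (N * (1 + y)) * cos (\<phi> y)\<bar>"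
    by linarith
  then show ?thesis using \<epsilon> by (simp add: \<psi>_def f'_def abs_mult)
qed

lemma \<psi>_cont: "continuous_on S \<psi>"
  unfolding \<psi>_def[abs_def] by (intro continuous_intros cont)

text \<open>The mean 1/2 of cos^2 contributes at least 2 k N. The boundary sines cost m / 2 and the
  term with X costs X (d - c); by the assumption on N both together use up at most k N.\<close>

lemma \<psi>_integral: "\<epsilon> * k * N \<le> integral {c..d} \<psi>"
proof -
  define \<Psi> where "\<Psi> y = \<epsilon> * (m * (\<phi> y / 2 + sin (2 * \<phi> y) / 4) - X * y)" for y
  have "(\<psi> has_integral \<Psi> d - \<Psi> c) {c..d}"
  proof (rule fundamental_theorem_of_calculus)
    fix y
    have "((\<lambda>y. sin (2 * \<phi> y)) has_real_derivative cos (2 * \<phi> y) * (2 * (N * (1 + y)))) (at y)"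
      by (intro DERIV_chain2[OF DERIV_sin] DERIV_cmult d\<phi>)
    then have "(\<Psi> has_real_derivative
        \<epsilon> * (m * (N * (1 + y) / 2 + cos (2 * \<phi> y) * (2 * (N * (1 + y))) / 4) - X * 1)) (at y)"
      unfolding \<Psi>_def[abs_def] by (intro DERIV_cmult DERIV_diff DERIV_add DERIV_cdivide d\<phi> DERIV_ident)
    moreover have "\<epsilon> * (m * (N * (1 + y) / 2 + cos (2 * \<phi> y) * (2 * (N * (1 + y))) / 4) - X * 1) = \<psi> y"
      by (simp add: \<psi>_def cos_double_cos field_simps)
    ultimately have "(\<Psi> has_real_derivative \<psi> y) (at y)" by simp
    then show "(\<Psi> has_vector_derivative \<psi> y) (at y within {c..d})"
      by (simp add: has_real_derivative_iff_has_vector_derivative has_vector_derivative_at_within)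
  qed (use ab in simp)
  then have i: "integral {c..d} \<psi> = \<Psi> d - \<Psi> c" by (rule integral_unique)
  have "c\<^sup>2 \<le> d\<^sup>2" using ab by (intro power_mono) auto
  then have "N * (d - c) \<le> N * ((d - c) + (d\<^sup>2 - c\<^sup>2) / 2)" using N by (intro mult_left_mono) auto
  then have "N * (d - c) \<le> \<phi> d - \<phi> c" by (simp add: \<phi>_def algebra_simps diff_divide_distrib)
  moreover have "sin (2 * \<phi> d) \<ge> - 1" "sin (2 * \<phi> c) \<le> 1" by auto
  ultimately have "N * (d - c) / 2 - 1 / 2 \<le> (\<phi> d / 2 + sin (2 * \<phi> d) / 4) - (\<phi> c / 2 + sin (2 * \<phi> c) / 4)"
    by linarith
  then have "m * (N * (d - c) / 2 - 1 / 2) \<le> m * ((\<phi> d / 2 + sin (2 * \<phi> d) / 4) - (\<phi> c / 2 + sin (2 * \<phi> c) / 4))"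
    using m by (intro mult_left_mono) auto
  moreover have "m * (N * (d - c) / 2 - 1 / 2) = 2 * (m * (d - c) / 4 * N) - m / 2"
    by (simp add: field_simps)
  then have "k * N \<le> m * (N * (d - c) / 2 - 1 / 2) - X * (d - c)"
    using N1 unfolding k_def by linarith
  ultimately have "k * N \<le> m * ((\<phi> d / 2 + sin (2 * \<phi> d) / 4) - (\<phi> c / 2 + sin (2 * \<phi> c) / 4)) - X * (d - c)"
    by linarith
  then have "\<epsilon> * (k * N) \<le> \<epsilon> * (m * ((\<phi> d / 2 + sin (2 * \<phi> d) / 4) - (\<phi> c / 2 + sin (2 * \<phi> c) / 4)) - X * (d - c))"
    using \<epsilon> by (intro mult_left_mono) auto
  also have "\<dots> = \<Psi> d - \<Psi> c" by (simp add: \<Psi>_def algebra_simps)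
  finally show ?thesis by (simp add: i mult.assoc)
qed

text \<open>Cauchy-Schwarz in the tangent form x^2 \<ge> 2 \<kappa> x - \<kappa>^2, with \<kappa>
  the guaranteed mean of |f'|. Being linear in x, it tolerates the minorant \<psi> where this is
  negative.\<close>

lemma square_integral: "(\<epsilon> * k * N)\<^sup>2 / (d - c) \<le> integral {a..b} (\<lambda>x. (f' x)\<^sup>2)"
proof -
  define \<kappa> where "\<kappa> = \<epsilon> * k * N / (d - c)"
  have \<kappa>: "\<kappa> \<ge> 0" "\<kappa> * (d - c) = \<epsilon> * k * N" using \<epsilon> k_pos N ab by (auto simp: \<kappa>_def)
  have "(\<epsilon> * k * N)\<^sup>2 / (d - c) = 2 * \<kappa> * (\<epsilon> * k * N) - \<kappa>\<^sup>2 * (d - c)"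
  proof -
    have "x\<^sup>2 / \<delta> = 2 * (x / \<delta>) * x - (x / \<delta>)\<^sup>2 * \<delta>" if "\<delta> > 0" for x \<delta> :: real
      using that by (simp add: field_simps power2_eq_square)
    from this[of "d - c" "\<epsilon> * k * N"] show ?thesis using ab by (simp add: \<kappa>_def)
  qed
  also have "\<dots> \<le> 2 * \<kappa> * integral {c..d} \<psi> - \<kappa>\<^sup>2 * (d - c)"
    using \<psi>_integral \<kappa> by (intro diff_right_mono mult_left_mono) auto
  also have "\<dots> = integral {c..d} (\<lambda>y. 2 * \<kappa> * \<psi> y - \<kappa>\<^sup>2)"
    using ab by (subst integral_diff) (auto intro!: integrable_continuous_real continuous_intros \<psi>_cont)
  also have "\<dots> \<le> integral {c..d} (\<lambda>x. (f' x)\<^sup>2)"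
  proof (rule integral_le)
    fix y assume y: "y \<in> {c..d}"
    have "0 \<le> (\<bar>f' y\<bar> - \<kappa>)\<^sup>2" by simp
    then have "2 * \<kappa> * \<bar>f' y\<bar> - \<kappa>\<^sup>2 \<le> (f' y)\<^sup>2" by (simp add: power2_diff mult_ac)
    moreover have "2 * \<kappa> * \<psi> y \<le> 2 * \<kappa> * \<bar>f' y\<bar>" using \<psi>_le[OF y] \<kappa> by (intro mult_left_mono) auto
    ultimately show "2 * \<kappa> * \<psi> y - \<kappa>\<^sup>2 \<le> (f' y)\<^sup>2" by linarith
  qed (auto intro!: integrable_continuous_real continuous_intros \<psi>_cont cont)
  also have "\<dots> \<le> integral {a..b} (\<lambda>x. (f' x)\<^sup>2)"
    by (rule integral_subset_le) (use ab in \<open>auto intro!: integrable_continuous_real continuous_intros cont\<close>)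
  finally show ?thesis .
qed

lemma increment_lower:
  assumes y: "y \<in> {0..1}" "y + u \<in> {0..1}" and u: "u \<ge> 0"
  shows "u * \<bar>f' y\<bar> - \<epsilon> * (5 * X + 5) * N\<^sup>2 * u\<^sup>2 \<le> \<bar>f (y + u) - f y\<bar>"
proof -
  define F2 where "F2 = \<epsilon> * (5 * X + 5) * N\<^sup>2"
  have F2: "F2 \<ge> 0" using \<epsilon> X by (simp add: F2_def)
  have sub: "{y..y+u} \<subseteq> {0..1}" using y by auto
  have "norm ((f (y + u) - (y + u) * f' y) - (f y - y * f' y)) \<le> (F2 * u) * norm (y + u - y)"
  proof (rule field_differentiable_bound[of "{y..y+u}" _ "\<lambda>t. f' t - f' y"])
    fix t assume t: "t \<in> {y..y+u}"
    show "((\<lambda>t. f t - t * f' y) has_real_derivative f' t - f' y) (at t within {y..y+u})"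
      by (rule has_field_derivative_at_within) (auto intro!: derivative_eq_intros df)
    have "norm (f' t - f' y) \<le> F2 * norm (t - y)"
    proof (rule field_differentiable_bound[of "{y..y+u}" _ f''])
      show "(f' has_real_derivative f'' x) (at x within {y..y+u})" for x
        by (rule has_field_derivative_at_within[OF df'])
      show "norm (f'' x) \<le> F2" if "x \<in> {y..y+u}" for x using f''_le[of x] that sub by (auto simp: F2_def)
    qed (use t u in auto)
    also have "\<dots> \<le> F2 * u" using t F2 by (intro mult_left_mono) auto
    finally show "norm (f' t - f' y) \<le> F2 * u" .
  qed (use u in auto)
  then have "\<bar>f (y + u) - f y - u * f' y\<bar> \<le> F2 * u\<^sup>2"
    using u by (simp add: algebra_simps power2_eq_square)
  moreover have "\<bar>u * f' y\<bar> = u * \<bar>f' y\<bar>" using u by (simp add: abs_mult)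
  ultimately show ?thesis unfolding F2_def by linarith
qed

text \<open>Only pairs with y in [c, d] and x at most h0 to its right are kept. With h0 of order 1 /
  N the function is nearly linear on this scale: the Taylor error consumes exactly half of the
  variation \<epsilon> k N, which determines the formula for h0. The result is of order h0^(1 -
  \<sigma>) \<epsilon> N, that is \<epsilon> N^\<sigma>.\<close>

lemma gagliardo_lower:
  assumes \<sigma>: "0 < \<sigma>" "\<sigma> < 1" and h0: "h0 = k / (2 * (5 * X + 5) * (d - c) * N)" "h0 \<le> b - d"
  shows "ennreal (h0 powr (1 - \<sigma>) / 4 * (\<epsilon> * k * N)) \<le>
    gagliardo_exp \<sigma> a b f"
proof -
  define F2 where "F2 = \<epsilon> * (5 * X + 5) * N\<^sup>2"
  have h0p: "h0 > 0" using k_pos X ab N by (auto simp: h0(1) intro!: divide_pos_pos mult_pos_pos)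
  have F2: "F2 \<ge> 0" using \<epsilon> X by (simp add: F2_def)
  define g where "g y = h0 powr (1 - \<sigma>) / 2 * (\<psi> y - F2 * h0)" for y
  have point: "ennreal (h0 powr (- \<sigma>) / 2 * (\<psi> y - F2 * h0)) \<le> ennreal (\<bar>exp (f y) - exp (f x)\<bar> / \<bar>y - x\<bar> powr (1 + \<sigma>))"
    if y: "y \<in> {c..d}" and x: "x \<in> {y<..<y+h0}" for x y
  proof (rule ennreal_leI, cases "\<psi> y - F2 * h0 \<ge> 0")
    case True
    define u where "u = x - y"
    have u: "0 < u" "u < h0" "x = y + u" using x by (auto simp: u_def)
    have "u * (\<psi> y - F2 * h0) \<le> u * (\<bar>f' y\<bar> - F2 * u)"
      using u F2 \<psi>_le[OF y] by (intro mult_left_mono diff_mono) auto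
    also have "\<dots> \<le> \<bar>f x - f y\<bar>"
      using increment_lower[of y u] u y ab h0(2) by (simp add: F2_def power2_eq_square algebra_simps)
    finally have 1: "u * (\<psi> y - F2 * h0) / 2 \<le> \<bar>f x - f y\<bar> / 2" by simp
    have 2: "\<bar>f x - f y\<bar> / 2 \<le> \<bar>exp (f x) - exp (f y)\<bar>"
      by (rule half_abs_le_exp_diff) (use f_le[of x] f_le[of y] \<epsilon> in linarith)+
    have "h0 powr (- \<sigma>) / 2 * (\<psi> y - F2 * h0) \<le> u powr (- \<sigma>) / 2 * (\<psi> y - F2 * h0)"
      using True u \<sigma> h0p by (intro mult_right_mono divide_right_mono powr_mono2') auto
    also have "\<dots> = (u * (\<psi> y - F2 * h0) / 2) / u powr (1 + \<sigma>)"
      using u by (simp add: powr_add powr_minus field_simps)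
    also have "\<dots> \<le> \<bar>exp (f x) - exp (f y)\<bar> / u powr (1 + \<sigma>)"
      using 1 2 by (intro divide_right_mono) auto
    finally show "h0 powr (- \<sigma>) / 2 * (\<psi> y - F2 * h0) \<le> \<bar>exp (f y) - exp (f x)\<bar> / \<bar>y - x\<bar> powr (1 + \<sigma>)"
      using u by (simp add: abs_minus_commute)
  next
    case False
    then have "h0 powr (- \<sigma>) / 2 * (\<psi> y - F2 * h0) \<le> 0" by (intro mult_nonneg_nonpos) auto
    also have "0 \<le> \<bar>exp (f y) - exp (f x)\<bar> / \<bar>y - x\<bar> powr (1 + \<sigma>)" by simp
    finally show "h0 powr (- \<sigma>) / 2 * (\<psi> y - F2 * h0) \<le> \<bar>exp (f y) - exp (f x)\<bar> / \<bar>y - x\<bar> powr (1 + \<sigma>)" .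
  qed
  have inner: "ennreal (g y) \<le> (\<integral>\<^sup>+ x\<in>{a<..<b}. ennreal (\<bar>exp (f y) - exp (f x)\<bar> / \<bar>y - x\<bar> powr (1 + \<sigma>)) \<partial>lborel)"
    if y: "y \<in> {c..d}" for y
  proof -
    have "ennreal (g y) = ennreal (h0 * (h0 powr (- \<sigma>) / 2 * (\<psi> y - F2 * h0)))"
      using h0p by (simp add: g_def powr_diff powr_minus field_simps)
    also have "\<dots> = ennreal (h0 powr (- \<sigma>) / 2 * (\<psi> y - F2 * h0)) * ennreal h0"
      using h0p by (metis ennreal_mult' less_imp_le mult.commute)
    also have "\<dots> = (\<integral>\<^sup>+ x. ennreal (h0 powr (- \<sigma>) / 2 * (\<psi> y - F2 * h0)) * indicator {y<..<y+h0} x \<partial>lborel)"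
      using h0p by (subst nn_integral_cmult_indicator) auto
    also have "\<dots> \<le> (\<integral>\<^sup>+ x\<in>{a<..<b}. ennreal (\<bar>exp (f y) - exp (f x)\<bar> / \<bar>y - x\<bar> powr (1 + \<sigma>)) \<partial>lborel)"
    proof (rule nn_integral_mono)
      fix x
      have "x \<in> {y<..<y+h0} \<Longrightarrow> x \<in> {a<..<b}" using y h0(2) ab by auto
      then show "ennreal (h0 powr (- \<sigma>) / 2 * (\<psi> y - F2 * h0)) * indicator {y<..<y+h0} x \<le>
        ennreal (\<bar>exp (f y) - exp (f x)\<bar> / \<bar>y - x\<bar> powr (1 + \<sigma>)) * indicator {a<..<b} x"
        using point[OF y, of x] by (auto simp: indicator_def)
    qed
    finally show ?thesis .
  qed
  \<comment> \<open>The lower bound g may be negative, and the nonnegative integral sees only its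
    positive part; the latter has at least the integral of g.\<close>
  have gc: "continuous_on {c..d} g" "continuous_on {c..d} (\<lambda>y. max 0 (g y))"
    unfolding g_def[abs_def] by (auto intro!: continuous_intros \<psi>_cont)
  have si: "set_integrable lborel {c..d} g" "set_integrable lborel {c..d} (\<lambda>y. max 0 (g y))"
    by (intro borel_integrable_atLeastAtMost' gc)+
  have "h0 powr (1 - \<sigma>) / 4 * (\<epsilon> * k * N) = h0 powr (1 - \<sigma>) / 2 * (\<epsilon> * k * N - F2 * h0 * (d - c))"
  proof -
    have "F2 * h0 * (d - c) = \<epsilon> * k * N / 2"
    proof -
      have "e * C * n\<^sup>2 * (x / (2 * C * \<delta> * n)) * \<delta> = e * x * n / 2" if "C > 0" "\<delta> > 0" "n > 0" for e C n x \<delta> :: real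
        using that by (simp add: field_simps power2_eq_square)
      from this[of "5 * X + 5" "d - c" N] show ?thesis unfolding F2_def h0(1) using X ab N by simp
    qed
    then show ?thesis by simp
  qed
  also have "\<dots> \<le> h0 powr (1 - \<sigma>) / 2 * (integral {c..d} \<psi> - F2 * h0 * (d - c))"
    using \<psi>_integral by (intro mult_left_mono diff_right_mono) auto
  also have "\<dots> = integral {c..d} g"
  proof -
    have "integral {c..d} (\<lambda>y. \<psi> y - F2 * h0) = integral {c..d} \<psi> - F2 * h0 * (d - c)"
      using ab by (subst integral_diff) (auto intro!: integrable_continuous_real continuous_intros \<psi>_cont)
    then show ?thesis by (simp add: g_def[abs_def])
  qed
  also have "\<dots> = (LINT y:{c..d}|lborel. g y)" by (rule set_borel_integral_eq_integral(2)[OF si(1), symmetric])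
  also have "\<dots> \<le> (LINT y:{c..d}|lborel. max 0 (g y))" by (rule set_integral_mono[OF si]) simp
  finally have "ennreal (h0 powr (1 - \<sigma>) / 4 * (\<epsilon> * k * N)) \<le> ennreal (LINT y:{c..d}|lborel. max 0 (g y))"
    by (rule ennreal_leI)
  also have "\<dots> = (\<integral>\<^sup>+ y. ennreal (indicator {c..d} y *\<^sub>R max 0 (g y)) \<partial>lborel)"
    unfolding set_lebesgue_integral_def
    by (rule nn_integral_eq_integral[symmetric]) (use si(2) in \<open>auto simp: set_integrable_def indicator_def\<close>)
  also have "\<dots> \<le> gagliardo_exp \<sigma> a b f"
    unfolding gagliardo_exp_def
  proof (rule nn_integral_mono)
    fix y
    show "ennreal (indicator {c..d} y *\<^sub>R max 0 (g y)) \<le>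
      (\<integral>\<^sup>+ x\<in>{a<..<b}. ennreal (\<bar>exp (f y) - exp (f x)\<bar> / \<bar>y - x\<bar> powr (1 + \<sigma>)) \<partial>lborel) * indicator {a<..<b} y"
    proof (cases "y \<in> {c..d}")
      case True
      then have "y \<in> {a<..<b}" using ab by auto
      moreover have "ennreal (max 0 (g y)) = ennreal (g y)" by (simp add: max_def ennreal_neg)
      ultimately show ?thesis using inner[OF True] True by simp
    qed simp
  qed
  finally show ?thesis .
qed

end
end

text \<open>N is chosen last, with profile, support and constants fixed. The quantities that must be
  small are powers N^(-\<rho>), N^(1/2 - \<rho>) and N^(1 - 2 \<rho>), the last one with a
  logarithm; those that must be large are N^(\<sigma> - \<rho>) and N^(1 - \<rho>). Hence \<eta> and
  M may be arbitrary.\<close>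

lemma block_exists:
  fixes a b \<eta> \<sigma> M :: real
  assumes ab: "0 \<le> a" "a < b" "b \<le> 1" and \<eta>: "\<eta> > 0" and \<sigma>: "1/2 < \<sigma>" "\<sigma> < 1"
  shows "\<exists>f. rough_block a b \<eta> \<sigma> M f"
proof -
  define e where "e = (b - a) / 5"
  have e: "e > 0" "b = a + 5 * e" using ab by (simp_all add: e_def field_simps)
  \<comment> \<open>Five equal parts: the profile lives on the middle three and is bounded below on
    the central one.\<close>
  define a' b' c d where "a' = a + e" "b' = a + 4 * e" "c = a + 2 * e" "d = a + 3 * e"
  have order: "a < a'" "a' < c" "c < d" "d < b'" "b' < b" using e by (auto simp: a'_b'_c_d_def)
  have "a' < b'" using order by linarith
  then obtain h where h: "smooth_on UNIV h" "\<And>x. 0 \<le> h x" "\<And>x. h x \<le> 1"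
    "\<And>x. a' < x \<Longrightarrow> x < b' \<Longrightarrow> 0 < h x" "\<And>x. x \<notin> {a'..b'} \<Longrightarrow> h x = 0"
    by (rule bump_exists) blast
  have Ck: "Ck n UNIV h" for n using h(1) smooth_on_iff_Ck by blast
  define h1 where "h1 = deriv h"
  define h2 where "h2 = deriv h1"
  have C3: "Ck (Suc (Suc (Suc 0))) UNIV h" by (rule Ck)
  have C2: "Ck (Suc (Suc 0)) UNIV h1" using Ck_SucD'[OF C3] by (simp only: h1_def)
  have C1: "Ck (Suc 0) UNIV h2" using Ck_SucD'[OF C2] by (simp only: h2_def)
  have dh: "(h has_real_derivative h1 t) (at t)" for t using Ck_SucD[OF C3] by (simp add: h1_def)
  have dh1: "(h1 has_real_derivative h2 t) (at t)" for t using Ck_SucD[OF C2] by (simp add: h2_def)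
  have dh2: "(h2 has_real_derivative deriv h2 t) (at t)" for t using Ck_SucD[OF C1] by simp
  have bd: "\<exists>M. \<forall>x. \<bar>g x\<bar> \<le> M" if g: "continuous_on {a'..b'} g" "\<And>x. x \<notin> {a'..b'} \<Longrightarrow> g x = 0" for g :: "real \<Rightarrow> real"
  proof -
    have "bounded (g ` {a'..b'})" using g by (intro compact_imp_bounded compact_continuous_image) auto
    then obtain M where M: "\<forall>y\<in>g ` {a'..b'}. norm y \<le> M" unfolding bounded_iff by blast
    have "\<bar>g x\<bar> \<le> max 0 M" for x
      by (cases "x \<in> {a'..b'}") (use M g(2) in \<open>auto simp: le_max_iff_disj\<close>)
    then show ?thesis by blast
  qed
  have z1: "h1 x = 0" if "x \<notin> {a'..b'}" for x unfolding h1_def by (rule deriv_eq_0_outside[OF h(5) that])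
  have z2: "h2 x = 0" if "x \<notin> {a'..b'}" for x unfolding h2_def by (rule deriv_eq_0_outside[OF z1 that])
  have ch: "continuous_on S h1" "continuous_on S h2" for S
    by (meson DERIV_isCont continuous_at_imp_continuous_on dh1 dh2)+
  obtain M1 where M1: "\<And>x. \<bar>h1 x\<bar> \<le> M1" using bd[OF ch(1) z1] by blast
  obtain M2 where M2: "\<And>x. \<bar>h2 x\<bar> \<le> M2" using bd[OF ch(2) z2] by blast
  define X where "X = max 1 (max M1 M2)"
  have X: "X \<ge> 1" "\<bar>h1 x\<bar> \<le> X" "\<bar>h2 x\<bar> \<le> X" for x
    using M1[of x] M2[of x] by (auto simp: X_def le_max_iff_disj)
  have "continuous_on {c..d} h" by (meson DERIV_isCont continuous_at_imp_continuous_on dh)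
  then obtain x0 where x0: "x0 \<in> {c..d}" "\<And>x. x \<in> {c..d} \<Longrightarrow> h x0 \<le> h x"
    using continuous_attains_inf[of "{c..d}" h] order by auto
  define m where "m = h x0"
  have m: "m > 0" "\<And>x. x \<in> {c..d} \<Longrightarrow> m \<le> h x" using x0 h(4)[of x0] order by (auto simp: m_def)
  define Lc where "Lc = 3 * X + 4"
  define k where "k = m * (d - c) / 4"
  have k: "k > 0" using m order by (simp add: k_def)
  \<comment> \<open>Strictly between 1/2 and \<sigma>: above 1/2 for the energy, below \<sigma> for
    the seminorm, and thus below 1 for the variation.\<close>
  define \<rho> where "\<rho> = (1/2 + \<sigma>) / 2"
  have \<rho>: "1/2 < \<rho>" "\<rho> < \<sigma>" "\<rho> < 1" using \<sigma> by (auto simp: \<rho>_def)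
  define s where "s = min (1/6) (\<eta> / 90)"
  have s: "s > 0" "s \<le> 1/6" "90 * s \<le> \<eta>" using \<eta> by (auto simp: s_def)
  have L0: "Lc > 0" using X by (simp add: Lc_def)
  define B where "B = 2 * (5 * X + 5) * (d - c)"
  have B: "B > 0" using X order by (auto simp: B_def)
  have lim0: "((\<lambda>N. N powr (- \<rho>)) \<longlongrightarrow> 0) at_top" "((\<lambda>N. N powr (- \<rho>) * (4 * Lc * sqrt N)) \<longlongrightarrow> 0) at_top"
    "((\<lambda>N. N powr (- \<rho>) * Lc) \<longlongrightarrow> 0) at_top"
    "((\<lambda>N. (N powr (- \<rho>))\<^sup>2 * N * (Lc / 2 + 16) * (Lc + 5 * Lc * ln (1 + sqrt N))) \<longlongrightarrow> 0) at_top"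
    "((\<lambda>N. (N powr (- \<rho>))\<^sup>2 * N * (Lc\<^sup>2 + 8 * Lc)) \<longlongrightarrow> 0) at_top"
    using \<rho> L0 by real_asymp+
  have limB: "((\<lambda>N. k / (B * N)) \<longlongrightarrow> 0) at_top" using k B by real_asymp
  have liminf: "filterlim (\<lambda>N. (k / (B * N)) powr (1 - \<sigma>) / 4 * (N powr (- \<rho>) * k * N)) at_top at_top"
    "filterlim (\<lambda>N. N powr (- \<rho>) * (k\<^sup>2 * N)) at_top at_top" "filterlim (\<lambda>N. k * N) at_top at_top"
    using k B \<rho> \<sigma> by real_asymp+
  have min0: "min (1/2) \<eta> > 0" and bd0: "b - d > 0" using \<eta> order by auto
  have "\<forall>\<^sub>F N in at_top. N \<ge> 1 \<and> N powr (- \<rho>) < min (1/2) \<eta> \<and> N powr (- \<rho>) * (4 * Lc * sqrt N) < s \<and> N powr (- \<rho>) * Lc < s \<and>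
      (N powr (- \<rho>))\<^sup>2 * N * (Lc / 2 + 16) * (Lc + 5 * Lc * ln (1 + sqrt N)) < s \<and>
      (N powr (- \<rho>))\<^sup>2 * N * (Lc\<^sup>2 + 8 * Lc) < s \<and> k / (B * N) < b - d \<and>
      M \<le> (k / (B * N)) powr (1 - \<sigma>) / 4 * (N powr (- \<rho>) * k * N) \<and>
      M * Lc * (d - c) \<le> N powr (- \<rho>) * (k\<^sup>2 * N) \<and> m / 2 + X * (d - c) \<le> k * N"
    using liminf unfolding filterlim_at_top
    by (intro eventually_conj order_tendstoD(2)[OF lim0(1) min0] order_tendstoD(2)[OF lim0(2) s(1)]
        order_tendstoD(2)[OF lim0(3) s(1)] order_tendstoD(2)[OF lim0(4) s(1)] order_tendstoD(2)[OF lim0(5) s(1)]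
        order_tendstoD(2)[OF limB bd0] eventually_ge_at_top) auto
  then obtain N where N: "N \<ge> 1" and e: "N powr (- \<rho>) < min (1/2) \<eta>" and s1: "N powr (- \<rho>) * (4 * Lc * sqrt N) < s" "N powr (- \<rho>) * Lc < s"
      "(N powr (- \<rho>))\<^sup>2 * N * (Lc / 2 + 16) * (Lc + 5 * Lc * ln (1 + sqrt N)) < s"
      "(N powr (- \<rho>))\<^sup>2 * N * (Lc\<^sup>2 + 8 * Lc) < s" and h0: "k / (B * N) < b - d"
      and g: "M \<le> (k / (B * N)) powr (1 - \<sigma>) / 4 * (N powr (- \<rho>) * k * N)"
      and v: "M * Lc * (d - c) \<le> N powr (- \<rho>) * (k\<^sup>2 * N)" and N1: "m / 2 + X * (d - c) \<le> k * N"
    using eventually_happens'[OF trivial_limit_at_top_linorder] by blast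
  define \<epsilon> where "\<epsilon> = N powr (- \<rho>)"
  have eps: "0 < \<epsilon>" "\<epsilon> \<le> 1/2" "\<epsilon> \<le> \<eta>" using N e by (auto simp: \<epsilon>_def)
  interpret chirp h h1 h2 X N \<epsilon>
    by unfold_locales (use dh dh1 X N eps h(2,3) in \<open>auto simp: abs_le_iff intro: order_trans[of _ 0]\<close>)
  have LL: "Lc = chirp.L X" by (simp add: Lc_def L_def)
  have df0: "deriv f = f'" using df DERIV_imp_deriv by blast
  have fz: "f x = 0" if "x \<notin> {a'..b'}" for x using h(5)[OF that] by (simp add: f_def)
  have "smooth_on UNIV f"
    unfolding smooth_on_iff_Ck
  proof
    fix n
    have 1: "Ck n UNIV (\<lambda>t. t + t * t * (1 / 2))"
      by (rule Ck_add[OF open_UNIV Ck_ident Ck_mult[OF open_UNIV Ck_mult[OF open_UNIV Ck_ident Ck_ident] Ck_const]])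
    have 2: "Ck n UNIV (\<lambda>t. sin (N * (t + t * t * (1 / 2))))"
      by (rule Ck_compose[OF open_UNIV open_UNIV Ck_sin Ck_mult[OF open_UNIV Ck_const 1] subset_UNIV])
    have "Ck n UNIV (\<lambda>t. \<epsilon> * (h t * sin (N * (t + t * t * (1 / 2)))))"
      by (rule Ck_mult[OF open_UNIV Ck_const Ck_mult[OF open_UNIV Ck 2]])
    then show "Ck n UNIV f" by (simp add: f_def[abs_def] \<phi>_def power2_eq_square)
  qed
  moreover have "\<exists>a' b'. a < a' \<and> b' < b \<and> (\<forall>x. x \<notin> {a'..b'} \<longrightarrow> f x = 0)" using order fz by blast
  moreover have "\<forall>x. \<bar>f x\<bar> \<le> \<eta>" by (intro allI order_trans[OF f_le eps(3)])
  moreover have "gain_bound f a b \<eta>"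
  proof -
    have "gain_bound f a b (90 * s)"
      by (rule gain[OF ab s(2)]) (use s1 in \<open>simp_all add: LL[symmetric] \<epsilon>_def[symmetric] less_imp_le\<close>)
    then show ?thesis
      unfolding gain_bound_def
    proof (intro allI impI ballI, goal_cases)
      case (1 \<mu> w w' t)
      then have "energy f \<mu> w w' t \<le> (1 + 90 * s) * energy f \<mu> w w' a" by blast
      also have "\<dots> \<le> (1 + \<eta>) * energy f \<mu> w w' a"
        using s by (intro mult_right_mono) (auto simp: energy_def)
      finally show ?case .
    qed
  qed
  moreover have "ennreal M \<le> gagliardo_exp \<sigma> a b f"
  proof -
    have "ennreal M \<le> ennreal ((k / (B * N)) powr (1 - \<sigma>) / 4 * (\<epsilon> * k * N))"
      using g by (intro ennreal_leI) (simp add: \<epsilon>_def)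
    also have "\<dots> \<le> gagliardo_exp \<sigma> a b f"
      unfolding k_def
      by (rule gagliardo_lower[of a c d b m]) (use ab order m N1 \<sigma> h0 in \<open>auto simp: k_def B_def\<close>)
    finally show ?thesis .
  qed
  moreover have "\<exists>S>0. (\<forall>x. \<bar>deriv f x\<bar> \<le> S) \<and> M * S \<le> integral {a..b} (\<lambda>x. (deriv f x)\<^sup>2)"
  proof (intro exI[of _ "\<epsilon> * Lc * N"] conjI allI)
    show "\<epsilon> * Lc * N > 0" using \<epsilon> L0 N by simp
    fix x
    show "\<bar>deriv f x\<bar> \<le> \<epsilon> * Lc * N"
    proof (cases "x \<in> {a'..b'}")
      case True
      then have "x \<in> {0..1}" using order ab by auto
      then show ?thesis unfolding df0 LL by (rule f'_le)
    next
      case False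
      then show ?thesis using deriv_eq_0_outside[OF fz False] \<epsilon> L0 N by simp
    qed
    \<comment> \<open>The squared integral is quadratic in \<epsilon> N whereas the supremum of |f'|
      is linear in it, so their quotient exceeds M once N^(1 - \<rho>) is large.\<close>
    have "M * (\<epsilon> * Lc * N) = \<epsilon> * N * (M * Lc * (d - c)) / (d - c)" using order by simp
    also have "\<dots> \<le> \<epsilon> * N * (\<epsilon> * (k\<^sup>2 * N)) / (d - c)"
      using v \<epsilon> N order by (intro divide_right_mono mult_left_mono) (auto simp: \<epsilon>_def)
    also have "\<dots> = (\<epsilon> * k * N)\<^sup>2 / (d - c)" by (simp add: power2_eq_square)
    also have "\<dots> \<le> integral {a..b} (\<lambda>x. (f' x)\<^sup>2)"
      unfolding k_def by (rule square_integral) (use ab order m N1 in \<open>auto simp: k_def\<close>)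
    finally show "M * (\<epsilon> * Lc * N) \<le> integral {a..b} (\<lambda>x. (deriv f x)\<^sup>2)" by (simp add: df0)
  qed
  ultimately show ?thesis unfolding rough_block_def by blast
qed

section \<open>The propagation speed\<close>

text \<open>Blocks accumulate at 0, so every (0, T) contains all blocks from some index on. The
  growth rates are summable, the orders tend to 1/2, and the seminorms to infinity. The shift by 3
  keeps the order below 1 already for n = 0.\<close>

locale speed_blocks =
  fixes f :: "nat \<Rightarrow> real \<Rightarrow> real"
  assumes block: "rough_block ((1/2) ^ Suc n) ((1/2) ^ n) ((1/2) ^ n / 4) (1/2 + 1 / (real n + 3)) (real n) (f n)"
begin

abbreviation p :: "nat \<Rightarrow> real" where "p n \<equiv> (1/2) ^ n"

lemma smooth: "smooth_on UNIV (f n)"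
  and supp: "\<exists>a b. p (Suc n) < a \<and> b < p n \<and> (\<forall>x. x \<notin> {a..b} \<longrightarrow> f n x = 0)"
  and bound: "\<bar>f n x\<bar> \<le> p n / 4"
  and gain: "gain_bound (f n) (p (Suc n)) (p n) (p n / 4)"
  and gag: "ennreal (real n) \<le> gagliardo_exp (1/2 + 1 / (real n + 3)) (p (Suc n)) (p n) (f n)"
  and var: "\<exists>S>0. (\<forall>x. \<bar>deriv (f n) x\<bar> \<le> S) \<and> real n * S \<le> integral {p (Suc n)..p n} (\<lambda>x. (deriv (f n) x)\<^sup>2)"
  using block[of n] unfolding rough_block_def by blast+

lemma p_pos: "p n > 0" and p_le_1: "p n \<le> 1" and p_Suc: "p (Suc n) < p n"
  by (simp_all add: power_le_one)

lemma p_mono: "m \<le> n \<Longrightarrow> p n \<le> p m"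
  by (rule power_decreasing) auto

lemma p_small: assumes "t > 0" shows "\<exists>n. p n < t"
  using real_arch_pow_inv[of t "1/2"] assms by auto

lemma f_zero: "t \<le> p (Suc n) \<or> p n \<le> t \<Longrightarrow> f n t = 0"
  using supp[of n] by force

text \<open>At every \<open>t\<close> at most one term of the series is nonzero.\<close>

definition F :: "real \<Rightarrow> real" where "F t = (\<Sum>n. f n t)"

definition c :: "real \<Rightarrow> real" where "c t = exp (F t)"

lemma F_block: assumes t: "t \<in> {p (Suc n)..p n}" shows "F t = f n t"
proof -
  have "f k t = 0" if "k \<noteq> n" for k
  proof (cases "k < n")
    case True
    then have "p n \<le> p (Suc k)" by (intro p_mono) auto
    then show ?thesis using t unfolding atLeastAtMost_iff by (intro f_zero disjI1) linarith
  next
    case False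
    then have "p k \<le> p (Suc n)" using that by (intro p_mono) auto
    then show ?thesis using t unfolding atLeastAtMost_iff by (intro f_zero disjI2) linarith
  qed
  then have "F t = (\<Sum>k\<in>{n}. f k t)" unfolding F_def by (intro suminf_finite) auto
  then show ?thesis by simp
qed

lemma F_finite: assumes t: "p m < t" shows "F t = (\<Sum>k<m. f k t)"
  unfolding F_def
proof (rule suminf_finite)
  fix k assume "k \<notin> {..<m}"
  then have "p k \<le> p m" by (intro p_mono) auto
  then show "f k t = 0" using t by (intro f_zero disjI2) linarith
qed simp

lemma F_ge_1: assumes "1 \<le> t" shows "F t = 0"
proof -
  have "f k t = 0" for k using p_le_1[of k] assms by (intro f_zero disjI2) linarith
  then show ?thesis by (simp add: F_def)
qed

lemma block_cases:
  assumes "t > 0"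
  obtains "t \<ge> 1" | n where "t \<in> {p (Suc n)..p n}"
proof (cases "t \<ge> 1")
  case False
  define n where "n = (LEAST n. p (Suc n) \<le> t)"
  obtain m where "p m < t" using p_small[OF assms] by blast
  then have "p (Suc m) \<le> t" using p_Suc[of m] by linarith
  then have 1: "p (Suc n) \<le> t" unfolding n_def by (rule LeastI)
  have 2: "t \<le> p n"
  proof (cases n)
    case (Suc k)
    have "\<not> p (Suc k) \<le> t" by (rule not_less_Least) (simp only: n_def[symmetric] Suc lessI)
    then show ?thesis using Suc by simp
  qed (use False in simp)
  show ?thesis using that(2)[of n] 1 2 by simp
qed (use that in blast)

lemma F_bound: assumes "t > 0" shows "\<bar>F t\<bar> \<le> 1/4"
  using assms
proof (cases rule: block_cases)
  case (2 n)
  then show ?thesis using F_block[OF 2] bound[of n t] p_le_1[of n] by simp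
qed (simp add: F_ge_1)

lemma c_bounds: assumes "t > 0" shows "c t \<in> {1/2..3/2}" "exp (- F t) \<in> {1/2..3/2}"
  using abs_exp_minus_1_le[of "F t"] abs_exp_minus_1_le[of "- F t"] F_bound[OF assms] by (auto simp: c_def)

text \<open>Away from 0 the series is locally a finite sum. The open half-line is exhausted by the
  sets t > p m, and differentiability at a point involves only one of them.\<close>

lemma smooth_c: "smooth_on {0<..} c"
  unfolding smooth_on_iff_Ck
proof
  fix n
  have m: "Ck n {p m<..} c" for m
  proof -
    have "Ck n {p m<..} (\<lambda>x. \<Sum>i<m. f i x)"
    proof (rule Ck_sum)
      fix i
      have "Ck n UNIV (f i)" using smooth[of i] unfolding smooth_on_iff_Ck by (rule spec)
      then show "Ck n {p m<..} (f i)" by (rule Ck_subset) simp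
    qed simp
    then have "Ck n {p m<..} F"
      by (rule Ck_cong[rotated -1]) (simp_all add: F_finite)
    then show ?thesis
      unfolding c_def[abs_def] by (intro Ck_compose[OF _ open_UNIV Ck_exp]) auto
  qed
  show "Ck n {0<..} c"
    unfolding Ck_iff
  proof (intro allI impI ballI)
    fix k x assume k: "k < n" and x: "x \<in> {0::real<..}"
    then obtain m where "p m < x" using p_small by auto
    then show "(deriv ^^ k) c field_differentiable at x" using m[of m] k by (simp add: Ck_iff)
  qed
qed

section \<open>Accumulated growth of the energy over all blocks\<close>

definition P :: "nat \<Rightarrow> real" where "P m = (\<Prod>k<m. 1 + p k / 4)"

lemma P_ge_1: "P m \<ge> 1"
  unfolding P_def by (rule prod_ge_1) simp

lemma P_le: "P m \<le> exp 1"
proof -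
  have "P m \<le> (\<Prod>k<m. exp (p k / 4))"
    unfolding P_def by (rule prod_mono) (use p_pos less_imp_le exp_ge_add_one_self in \<open>auto simp: add_pos_nonneg less_imp_le\<close>)
  also have "\<dots> = exp (\<Sum>k<m. p k / 4)" by (simp add: exp_sum)
  also have "\<dots> \<le> exp 1"
  proof -
    have "(\<Sum>k<m. p k / 4) = 1/2 - p m / 2" by (induction m) auto
    then have "(\<Sum>k<m. p k / 4) \<le> 1" using p_pos[of m] by linarith
    then show ?thesis by simp
  qed
  finally show ?thesis .
qed

lemma energy_nonneg: "energy g \<mu> w w' t \<ge> 0"
  by (simp add: energy_def)

text \<open>Solutions run through the blocks from left to right while the indices increase towards
  0, so the induction step puts a new block in front. The base case t \<ge> 1 has constant speed 1,
  where the energy is conserved.\<close>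

lemma energy_chain:
  assumes \<mu>: "\<mu> \<ge> 0" and ode: "\<And>t. 0 < t \<Longrightarrow> t < T \<Longrightarrow> wave_ode F \<mu> w w' t"
  shows "p m \<le> t \<Longrightarrow> t < T \<Longrightarrow> energy F \<mu> w w' t \<le> P m * energy F \<mu> w w' (p m)"
proof (induction m arbitrary: t)
  case 0
  define g where "g x = \<mu>\<^sup>2 * (w x)\<^sup>2 + (w' x)\<^sup>2" for x
  have "g t = g 1"
  proof (cases "t = 1")
    case False
    have d: "(g has_real_derivative 0) (at x)" if x: "1 \<le> x" "x \<le> t" for x
    proof -
      have "wave_ode F \<mu> w w' x" using ode x 0 by simp
      then have w: "(w has_real_derivative w' x) (at x)" "(w' has_real_derivative - (\<mu>\<^sup>2 * w x)) (at x)"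
        using F_ge_1[OF x(1)] by (simp_all add: wave_ode_def)
      show ?thesis unfolding g_def[abs_def]
        by (rule derivative_eq_intros w refl)+ (simp add: algebra_simps)
    qed
    have "continuous_on {1..t} g" by (intro continuous_at_imp_continuous_on ballI DERIV_isCont[OF d]) auto
    then show ?thesis by (intro DERIV_isconst2[of 1 t]) (use False 0 d in auto)
  qed simp
  then show ?case using F_ge_1[of t] F_ge_1[of 1] 0 by (simp add: P_def energy_def g_def)
next
  case (Suc m)
  have PS: "P (Suc m) = P m * (1 + p m / 4)" by (simp add: P_def)
  have step: "energy F \<mu> w w' t \<le> (1 + p m / 4) * energy F \<mu> w w' (p (Suc m))"
    if t: "t \<in> {p (Suc m)..p m}" "t < T" for t
  proof -
    have "energy (f m) \<mu> w w' t \<le> (1 + p m / 4) * energy (f m) \<mu> w w' (p (Suc m))"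
    proof -
      have "\<forall>x\<in>{p (Suc m)..t}. wave_ode (f m) \<mu> w w' x"
      proof
        fix x assume x: "x \<in> {p (Suc m)..t}"
        then have "0 < x" "x < T" using t p_pos[of "Suc m"] unfolding atLeastAtMost_iff by linarith+
        then have "wave_ode F \<mu> w w' x" by (rule ode)
        moreover have "F x = f m x" using x t by (intro F_block) auto
        ultimately show "wave_ode (f m) \<mu> w w' x" by (simp add: wave_ode_def)
      qed
      then show ?thesis using gain[of m] \<mu> t unfolding gain_bound_def by blast
    qed
    moreover have "F t = f m t" "F (p (Suc m)) = f m (p (Suc m))"
      using t p_Suc[of m] by (auto intro!: F_block)
    ultimately show ?thesis by (simp add: energy_def)
  qed
  show ?case
  proof (cases "t \<le> p m")
    case True
    have "energy F \<mu> w w' t \<le> (1 + p m / 4) * energy F \<mu> w w' (p (Suc m))"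
      by (rule step) (use True Suc.prems in auto)
    also have "\<dots> \<le> P m * ((1 + p m / 4) * energy F \<mu> w w' (p (Suc m)))"
      using mult_right_mono[OF P_ge_1[of m], of "(1 + p m / 4) * energy F \<mu> w w' (p (Suc m))"] energy_nonneg
      by (simp add: add_pos_nonneg)
    finally show ?thesis by (simp only: PS mult.assoc)
  next
    case False
    have "energy F \<mu> w w' t \<le> P m * energy F \<mu> w w' (p m)"
      by (rule Suc.IH) (use False Suc.prems in auto)
    also have "\<dots> \<le> P m * ((1 + p m / 4) * energy F \<mu> w w' (p (Suc m)))"
      using P_ge_1[of m] False Suc.prems p_Suc[of m] by (intro mult_left_mono step) auto
    finally show ?thesis by (simp only: PS mult.assoc)
  qed
qed

text \<open>The chain starts at p m > 0 with a constant independent of m. The limit towards 0 is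
  taken in E, which is continuous up to 0 by assumption on w and w'. Comparing \<open>energy\<close>
  and E costs a factor 2 at each end, whence 4, and the product of the growth factors is at most exp
  1.\<close>

lemma energy_bound: "scalar_energy_bound c"
  unfolding scalar_energy_bound_def
proof (intro allI impI exI[of _ "4 * exp 1"])
  fix T \<mu> :: real and w w' :: "real \<Rightarrow> real"
  assume T: "T > 0" and \<mu>: "\<mu> \<ge> 0"
    and a: "continuous_on {0..T} w \<and> continuous_on {0..T} w' \<and>
     (\<forall>t\<in>{0<..<T}. (w has_real_derivative w' t) (at t) \<and>
        (w' has_real_derivative - (\<mu>\<^sup>2 * (c t)\<^sup>2 * w t)) (at t))"
  define E where "E t = (w' t)\<^sup>2 + \<mu>\<^sup>2 * (w t)\<^sup>2" for t
  have Ec: "continuous_on {0..T} E" unfolding E_def[abs_def] using a by (intro continuous_intros) auto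
  have ode: "wave_ode F \<mu> w w' t" if "0 < t" "t < T" for t
    using a that by (simp add: wave_ode_def c_def)
  have E1: "energy F \<mu> w w' t \<le> 2 * E t" "E t \<le> 2 * energy F \<mu> w w' t" if t: "t > 0" for t
  proof -
    have e: "1/2 \<le> exp (F t)" "exp (F t) \<le> 2" "1/2 \<le> exp (- F t)" "exp (- F t) \<le> 2"
      using c_bounds[OF t] by (auto simp: c_def)
    have "exp (F t) * (\<mu>\<^sup>2 * (w t)\<^sup>2) \<le> 2 * (\<mu>\<^sup>2 * (w t)\<^sup>2)" "exp (- F t) * (w' t)\<^sup>2 \<le> 2 * (w' t)\<^sup>2"
      "1/2 * (\<mu>\<^sup>2 * (w t)\<^sup>2) \<le> exp (F t) * (\<mu>\<^sup>2 * (w t)\<^sup>2)" "1/2 * (w' t)\<^sup>2 \<le> exp (- F t) * (w' t)\<^sup>2"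
      by (intro mult_right_mono e; simp)+
    then show "energy F \<mu> w w' t \<le> 2 * E t" "E t \<le> 2 * energy F \<mu> w w' t"
      by (simp_all add: E_def energy_def mult_ac)
  qed
  have inner: "E t \<le> 4 * exp 1 * E 0" if t: "t \<in> {0<..<T}" for t
  proof -
    obtain m0 where m0: "p m0 < t" using p_small t by auto
    have ev: "\<forall>\<^sub>F m in sequentially. E t \<le> 4 * exp 1 * E (p m)"
      unfolding eventually_sequentially
    proof (intro exI[of _ m0] allI impI)
      fix m assume "m0 \<le> m"
      then have pm: "p m \<le> t" using p_mono m0 by (meson less_imp_le order_trans)
      have "energy F \<mu> w w' t \<le> P m * energy F \<mu> w w' (p m)"
        by (rule energy_chain[OF \<mu> ode pm]) (use t in auto)
      also have "\<dots> \<le> exp 1 * (2 * E (p m))"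
        using P_ge_1[of m] by (intro mult_mono P_le E1 p_pos energy_nonneg) auto
      finally show "E t \<le> 4 * exp 1 * E (p m)" using E1(2)[of t] t by simp
    qed
    have pl: "(\<lambda>m. p m) \<longlonglongrightarrow> 0" by (rule LIMSEQ_power_zero) simp
    have "\<forall>\<^sub>F m in sequentially. p m \<in> {0..T}"
    proof -
      have "\<forall>\<^sub>F m in sequentially. p m < T" by (rule order_tendstoD(2)[OF pl T])
      then show ?thesis by eventually_elim (simp add: less_imp_le)
    qed
    then have "(\<lambda>m. E (p m)) \<longlonglongrightarrow> E 0"
      using continuous_on_tendsto_compose[OF Ec pl] T by simp
    then have "(\<lambda>m. 4 * exp 1 * E (p m)) \<longlonglongrightarrow> 4 * exp 1 * E 0" by (intro tendsto_intros)
    then show ?thesis by (rule tendsto_lowerbound[OF _ ev]) simp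
  qed
  have "E t \<le> 4 * exp 1 * E 0" if t: "t \<in> {0..T}" for t
  proof (rule continuous_le_on_closure[of "{0<..<T}" E])
    show "continuous_on (closure {0<..<T}) E" using Ec T by simp
    show "t \<in> closure {0<..<T}" using t T by simp
  qed (rule inner)
  then show "\<forall>t\<in>{0..T}. (w' t)\<^sup>2 + \<mu>\<^sup>2 * (w t)\<^sup>2 \<le> 4 * exp 1 * ((w' 0)\<^sup>2 + \<mu>\<^sup>2 * (w 0)\<^sup>2)"
    by (simp add: E_def)
qed

section \<open>The speed lies in no Sobolev space of order above 1/2\<close>

lemma gagliardo_ge:
  assumes s: "1/2 + 1 / (real n + 3) \<le> s" and T: "p n < T"
  shows "ennreal (real n) \<le> gagliardo s T c"
proof -
  let ?\<sigma> = "1/2 + 1 / (real n + 3)"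
  let ?I = "{p (Suc n)<..<p n}"
  have point: "ennreal (\<bar>exp (f n y) - exp (f n x)\<bar> / \<bar>y - x\<bar> powr (1 + ?\<sigma>)) \<le> ennreal (\<bar>c y - c x\<bar> / \<bar>y - x\<bar> powr (1 + s))"
    if "y \<in> ?I" "x \<in> ?I" for x y
  proof -
    have c: "c y = exp (f n y)" "c x = exp (f n x)" using that by (simp_all add: c_def F_block)
    have "\<bar>exp (f n y) - exp (f n x)\<bar> / \<bar>y - x\<bar> powr (1 + ?\<sigma>) \<le> \<bar>exp (f n y) - exp (f n x)\<bar> / \<bar>y - x\<bar> powr (1 + s)"
    proof (cases "y = x")
      case False
      \<comment> \<open>Distances inside a block are at most 1, so raising the order enlarges the
        kernel: the block serves every s above its own order.\<close>
      have "\<bar>y - x\<bar> \<le> 1" using that p_le_1[of n] p_pos[of "Suc n"] unfolding abs_le_iff greaterThanLessThan_iff by linarith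
      then have "\<bar>y - x\<bar> powr (1 + s) \<le> \<bar>y - x\<bar> powr (1 + ?\<sigma>)" using s by (intro powr_mono') auto
      then show ?thesis using False by (intro divide_left_mono) auto
    qed simp
    then show ?thesis by (simp add: c ennreal_leI)
  qed
  have sub: "?I \<subseteq> {0<..<T}" using T p_pos[of "Suc n"] by auto
  have "gagliardo_exp ?\<sigma> (p (Suc n)) (p n) (f n) \<le> gagliardo s T c"
    unfolding gagliardo_def gagliardo_exp_def
  proof (intro nn_integral_mono)
    fix y
    show "(\<integral>\<^sup>+ x\<in>?I. ennreal (\<bar>exp (f n y) - exp (f n x)\<bar> / \<bar>y - x\<bar> powr (1 + ?\<sigma>)) \<partial>lborel) * indicator ?I y
      \<le> (\<integral>\<^sup>+ x\<in>{0<..<T}. ennreal (\<bar>c y - c x\<bar> / \<bar>y - x\<bar> powr (1 + s)) \<partial>lborel) * indicator {0<..<T} y"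
    proof (cases "y \<in> ?I")
      case True
      have "(\<integral>\<^sup>+ x\<in>?I. ennreal (\<bar>exp (f n y) - exp (f n x)\<bar> / \<bar>y - x\<bar> powr (1 + ?\<sigma>)) \<partial>lborel)
        \<le> (\<integral>\<^sup>+ x\<in>{0<..<T}. ennreal (\<bar>c y - c x\<bar> / \<bar>y - x\<bar> powr (1 + s)) \<partial>lborel)"
      proof (rule nn_integral_mono)
        fix x
        show "ennreal (\<bar>exp (f n y) - exp (f n x)\<bar> / \<bar>y - x\<bar> powr (1 + ?\<sigma>)) * indicator ?I x
          \<le> ennreal (\<bar>c y - c x\<bar> / \<bar>y - x\<bar> powr (1 + s)) * indicator {0<..<T} x"
        proof (cases "x \<in> ?I")
          case xI: True
          then have "x \<in> {0<..<T}" using sub by blast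
          then show ?thesis using point[OF True xI] xI by (simp only: indicator_simps mult_1_right)
        qed (simp add: indicator_def del: greaterThanLessThan_iff)
      qed
      moreover have "y \<in> {0<..<T}" using True sub by blast
      ultimately show ?thesis using True by (simp only: indicator_simps mult_1_right)
    qed (simp add: indicator_def del: greaterThanLessThan_iff)
  qed
  with gag[of n] show ?thesis by (rule order_trans)
qed

text \<open>Test with the derivative of f n. Integration by parts turns the pairing with g into the
  integral of exp(f) f'^2, at least half of that of f'^2 and hence at least n S / 2; on the other
  hand the pairing is at most S times the mass of g. Dividing by S leaves a bound that grows with
  n.\<close>

lemma weak_derivative_mass:
  assumes g: "set_integrable lborel {0<..<T} g" and weak: "weak_derivative T 1 c g" and T: "p n < T"
  shows "real n \<le> 2 * (LINT x:{0<..<T}|lborel. \<bar>g x\<bar>)"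
proof -
  let ?a = "p (Suc n)" and ?b = "p n"
  let ?\<phi> = "deriv (f n)"
  obtain a b where ab: "?a < a" "b < ?b" "\<And>x. x \<notin> {a..b} \<Longrightarrow> f n x = 0" using supp[of n] by blast
  obtain S where S: "S > 0" "\<And>x. \<bar>?\<phi> x\<bar> \<le> S" "real n * S \<le> integral {?a..?b} (\<lambda>x. (?\<phi> x)\<^sup>2)" using var[of n] by blast
  have Ck: "Ck k UNIV (f n)" for k using smooth[of n] unfolding smooth_on_iff_Ck by (rule spec)
  have d1: "(f n has_real_derivative ?\<phi> x) (at x)" for x by (rule Ck_SucD[OF Ck]) simp
  have d2: "(?\<phi> has_real_derivative deriv ?\<phi> x) (at x)" for x by (rule Ck_SucD[OF Ck_SucD'[OF Ck]]) simp
  have d3: "(deriv ?\<phi> has_real_derivative deriv (deriv ?\<phi>) x) (at x)" for x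
    by (rule Ck_SucD[OF Ck_SucD'[OF Ck_SucD'[OF Ck]]]) simp
  have z1: "?\<phi> x = 0" if "x \<notin> {a..b}" for x by (rule deriv_eq_0_outside[OF ab(3) that])
  have z2: "deriv ?\<phi> x = 0" if "x \<notin> {a..b}" for x by (rule deriv_eq_0_outside[OF z1 that])
  have cont: "continuous_on A (f n)" "continuous_on A ?\<phi>" "continuous_on A (deriv ?\<phi>)" for A
    by (meson DERIV_isCont continuous_at_imp_continuous_on d1 d2 d3)+
  have "test_function T ?\<phi>"
    unfolding test_function_def
  proof (intro conjI exI)
    show "smooth_on UNIV ?\<phi>" unfolding smooth_on_iff_Ck using Ck_SucD'[OF Ck] by blast
    show "0 < a" "b < T" using ab T p_pos[of "Suc n"] by linarith+
    show "\<forall>x. x \<notin> {a..b} \<longrightarrow> ?\<phi> x = 0" using z1 by blast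
  qed
  then have W: "(LINT x:{0<..<T}|lborel. c x * deriv ?\<phi> x) = - (LINT x:{0<..<T}|lborel. g x * ?\<phi> x)"
    using weak unfolding weak_derivative_def by simp
  have "(LINT x:{0<..<T}|lborel. c x * deriv ?\<phi> x) = (LINT x:{?a..?b}|lborel. exp (f n x) * deriv ?\<phi> x)"
    unfolding set_lebesgue_integral_def
  proof (rule Bochner_Integration.integral_cong[OF refl])
    fix x
    show "indicator {0<..<T} x *\<^sub>R (c x * deriv ?\<phi> x) = indicator {?a..?b} x *\<^sub>R (exp (f n x) * deriv ?\<phi> x)"
    proof (cases "x \<in> {?a..?b}")
      case True
      then have "x \<in> {0<..<T}" using T p_pos[of "Suc n"] unfolding greaterThanLessThan_iff atLeastAtMost_iff by linarith
      then show ?thesis using True F_block[OF True] by (simp only: indicator_simps c_def)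
    next
      case False
      then have "x \<notin> {a..b}" using ab unfolding atLeastAtMost_iff by linarith
      then have "deriv ?\<phi> x = 0" by (rule z2)
      then show ?thesis by simp
    qed
  qed
  also have "\<dots> = integral {?a..?b} (\<lambda>x. exp (f n x) * deriv ?\<phi> x)"
    by (intro set_borel_integral_eq_integral(2) borel_integrable_atLeastAtMost' continuous_intros cont)
  also have "\<dots> = - integral {?a..?b} (\<lambda>x. exp (f n x) * (?\<phi> x)\<^sup>2)"
  proof -
    have "((\<lambda>x. exp (f n x) * (?\<phi> x)\<^sup>2 + exp (f n x) * deriv ?\<phi> x) has_integral exp (f n ?b) * ?\<phi> ?b - exp (f n ?a) * ?\<phi> ?a) {?a..?b}"
    proof (rule fundamental_theorem_of_calculus)
      fix x
      have "((\<lambda>x. exp (f n x) * ?\<phi> x) has_real_derivative exp (f n x) * ?\<phi> x * ?\<phi> x + deriv ?\<phi> x * exp (f n x)) (at x)"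
        by (intro DERIV_mult DERIV_chain2[OF DERIV_exp] d1 d2)
      then have "((\<lambda>x. exp (f n x) * ?\<phi> x) has_real_derivative exp (f n x) * (?\<phi> x)\<^sup>2 + exp (f n x) * deriv ?\<phi> x) (at x)"
        by (simp add: power2_eq_square mult_ac)
      then show "((\<lambda>x. exp (f n x) * ?\<phi> x) has_vector_derivative exp (f n x) * (?\<phi> x)\<^sup>2 + exp (f n x) * deriv ?\<phi> x) (at x within {?a..?b})"
        by (simp only: has_real_derivative_iff_has_vector_derivative has_vector_derivative_at_within)
    qed (use p_Suc[of n] in linarith)
    moreover have "?\<phi> ?a = 0" "?\<phi> ?b = 0" using ab by (auto intro!: z1)
    ultimately have "integral {?a..?b} (\<lambda>x. exp (f n x) * (?\<phi> x)\<^sup>2 + exp (f n x) * deriv ?\<phi> x) = 0"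
      by (simp add: integral_unique)
    moreover have "integral {?a..?b} (\<lambda>x. exp (f n x) * (?\<phi> x)\<^sup>2 + exp (f n x) * deriv ?\<phi> x) =
        integral {?a..?b} (\<lambda>x. exp (f n x) * (?\<phi> x)\<^sup>2) + integral {?a..?b} (\<lambda>x. exp (f n x) * deriv ?\<phi> x)"
      by (intro Henstock_Kurzweil_Integration.integral_add integrable_continuous_real continuous_intros cont)
    ultimately show ?thesis by linarith
  qed
  finally have eq: "integral {?a..?b} (\<lambda>x. exp (f n x) * (?\<phi> x)\<^sup>2) = (LINT x:{0<..<T}|lborel. g x * ?\<phi> x)"
    using W by linarith
  have "real n * S / 2 \<le> integral {?a..?b} (\<lambda>x. (?\<phi> x)\<^sup>2) / 2" using S(3) by simp
  also have "\<dots> = integral {?a..?b} (\<lambda>x. 1/2 * (?\<phi> x)\<^sup>2)" by simp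
  also have "\<dots> \<le> integral {?a..?b} (\<lambda>x. exp (f n x) * (?\<phi> x)\<^sup>2)"
  proof (rule integral_le)
    fix x
    have "1/2 \<le> exp (f n x)" using abs_exp_minus_1_le[of "f n x"] bound[of n x] p_le_1[of n] by linarith
    then show "1/2 * (?\<phi> x)\<^sup>2 \<le> exp (f n x) * (?\<phi> x)\<^sup>2" by (intro mult_right_mono) auto
  qed (intro integrable_continuous_real continuous_intros cont)+
  also have "\<dots> \<le> (LINT x:{0<..<T}|lborel. \<bar>g x\<bar>) * S"
  proof -
    have "norm (LINT x:{0<..<T}|lborel. g x * ?\<phi> x) \<le> (LINT x|lborel. norm (indicator {0<..<T} x *\<^sub>R (g x * ?\<phi> x)))"
      unfolding set_lebesgue_integral_def by (rule integral_norm_bound)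
    also have "\<dots> \<le> (LINT x|lborel. (indicator {0<..<T} x *\<^sub>R \<bar>g x\<bar>) * S)"
    proof (rule integral_mono')
      have "set_integrable lborel {0<..<T} (\<lambda>x. \<bar>g x\<bar>)" using set_integrable_abs[OF g] .
      then show "integrable lborel (\<lambda>x. (indicator {0<..<T} x *\<^sub>R \<bar>g x\<bar>) * S)"
        unfolding set_integrable_def by (rule integrable_mult_left)
      fix x
      show "norm (indicator {0<..<T} x *\<^sub>R (g x * ?\<phi> x)) \<le> (indicator {0<..<T} x *\<^sub>R \<bar>g x\<bar>) * S"
        using mult_left_mono[OF S(2)[of x], of "\<bar>g x\<bar>"] by (simp add: indicator_def abs_mult)
      show "0 \<le> (indicator {0<..<T} x *\<^sub>R \<bar>g x\<bar>) * S" using S(1) by (simp add: indicator_def)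
    qed
    also have "\<dots> = (LINT x:{0<..<T}|lborel. \<bar>g x\<bar>) * S"
      unfolding set_lebesgue_integral_def by simp
    finally show ?thesis unfolding eq by simp
  qed
  finally have "real n / 2 * S \<le> (LINT x:{0<..<T}|lborel. \<bar>g x\<bar>) * S" by simp
  then show ?thesis using S(1) by simp
qed

lemma not_sobolev:
  assumes T: "T > 0" and s: "s > 1/2"
  shows "c \<notin> sobolev_W1 s T"
proof
  assume "c \<in> sobolev_W1 s T"
  then obtain g where g0: "g 0 = c"
    and g1: "\<And>k. k \<le> nat \<lfloor>s\<rfloor> \<Longrightarrow> set_integrable lborel {0<..<T} (g k) \<and> weak_derivative T k c (g k)"
    and g2: "frac s > 0 \<Longrightarrow> gagliardo (frac s) T (g (nat \<lfloor>s\<rfloor>)) < \<infinity>"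
    unfolding sobolev_W1_def by auto
  obtain n0 where n0: "p n0 < T" using p_small[OF T] by blast
  have pT: "p n < T" if "n0 \<le> n" for n using p_mono[OF that] n0 by linarith
  show False
  proof (cases "s < 1")
    case True
    then have fl: "\<lfloor>s\<rfloor> = 0" using s by (simp add: floor_eq_iff)
    then have "frac s = s" by (simp add: frac_def)
    then have "gagliardo s T c < \<infinity>" using g2 g0 fl s by simp
    then obtain r where r: "gagliardo s T c = ennreal r" "r \<ge> 0"
      by (metis ennreal_cases infinity_ennreal_def less_irrefl)
    obtain n1 :: nat where n1: "real n1 > 1 / (s - 1/2)" using reals_Archimedean2 by blast
    obtain n2 :: nat where n2: "real n2 > r" using reals_Archimedean2 by blast
    \<comment> \<open>n0 puts the block inside (0, T), n1 brings its order below s, and n2 lifts its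
      seminorm above r.\<close>
    define n where "n = max n0 (max n1 n2)"
    have n: "n0 \<le> n" "real n > 1 / (s - 1/2)" "real n > r" using n1 n2 by (auto simp: n_def)
    have "1 / (real n + 3) \<le> s - 1/2"
    proof -
      have "1 < real n * (s - 1/2)" using n(2) s by (simp add: pos_divide_less_eq)
      also have "\<dots> \<le> (real n + 3) * (s - 1/2)" using s by (intro mult_right_mono) auto
      finally show ?thesis by (simp add: pos_divide_le_eq mult.commute)
    qed
    then have "ennreal (real n) \<le> ennreal r"
      using gagliardo_ge[of n s T] pT[OF n(1)] r by simp
    then show False using n(3) r(2) by (simp add: ennreal_le_iff)
  next
    case False
    then have "1 \<le> nat \<lfloor>s\<rfloor>" by linarith
    then have g: "set_integrable lborel {0<..<T} (g 1)" "weak_derivative T 1 c (g 1)" using g1 by blast+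
    obtain n1 :: nat where n1: "real n1 > 2 * (LINT x:{0<..<T}|lborel. \<bar>g 1 x\<bar>)" using reals_Archimedean2 by blast
    have "real (max n0 n1) \<le> 2 * (LINT x:{0<..<T}|lborel. \<bar>g 1 x\<bar>)"
      by (rule weak_derivative_mass[OF g pT]) simp
    then show False using n1 by simp
  qed
qed

end

lemma rough_speed_exists: "\<exists>c. rough_speed c \<and> scalar_energy_bound c"
proof -
  have "\<exists>f. rough_block ((1/2) ^ Suc n) ((1/2) ^ n) ((1/2) ^ n / 4) (1/2 + 1 / (real n + 3)) (real n) f" for n
  proof (rule block_exists)
    show "(1/2::real) ^ n \<le> 1" by (simp add: power_le_one)
    show "1/2 + 1 / (real n + 3) < 1" by (simp add: field_simps)
  qed simp_all
  then obtain f where "\<And>n. rough_block ((1/2) ^ Suc n) ((1/2) ^ n) ((1/2) ^ n / 4) (1/2 + 1 / (real n + 3)) (real n) (f n)"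
    by metis
  then interpret speed_blocks f by (rule speed_blocks.intro)
  have "rough_speed c" unfolding rough_speed_def using smooth_c c_bounds(1) not_sobolev by blast
  then show ?thesis using energy_bound by blast
qed

section \<open>Functional calculus of an operator between 0 and 1\<close>

text \<open>Horner's scheme for p(R) x. Carrying the vector x along avoids powers of R as separate
  operators.\<close>

definition poly_op :: "('h::real_vector \<Rightarrow> 'h) \<Rightarrow> real poly \<Rightarrow> 'h \<Rightarrow> 'h" where
  "poly_op R p x = fold_coeffs (\<lambda>a y. a *\<^sub>R x + R y) p 0"

lemma poly_op_0 [simp]: "poly_op R 0 x = 0"
  by (simp add: poly_op_def)

text \<open>The \<open>k\<close>-th coefficient of \<open>t\<^sup>j\<close> in the Bernstein basis of degree \<open>n\<close>. It is close to \<open>(k/n)\<^sup>j\<close>, so that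
  a polynomial that is nonnegative on the unit interval has almost nonnegative Bernstein coefficients.\<close>

definition bernstein_ratio :: "nat \<Rightarrow> nat \<Rightarrow> nat \<Rightarrow> real" where
  "bernstein_ratio n k j = real (k choose j) / real (n choose j)"

lemma bernstein_ratio_Suc:
  assumes "j < n"
  shows "bernstein_ratio n k (Suc j) = bernstein_ratio n k j * ((real k - real j) / (real n - real j))"
proof -
  have *: "real (m choose Suc j) = real (m choose j) * (real m - real j) / real (Suc j)" for m
  proof (cases "j \<le> m")
    case True
    have "Suc j * (m choose Suc j) = (m - j) * (m choose j)"
      by (simp only: binomial_absorb_comp binomial_absorption)
    then have "real (Suc j) * real (m choose Suc j) = (real m - real j) * real (m choose j)"
      using True by (metis of_nat_diff of_nat_mult)
    then show ?thesis by (simp add: field_simps)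
  qed (simp add: binomial_eq_0)
  show ?thesis using assms by (simp add: bernstein_ratio_def *)
qed

text \<open>The threshold has to be uniform in k \<le> n. By the recursion in j each step multiplies
  by (k - j) / (n - j), which differs from k / n by at most j / (n - j).\<close>

lemma bernstein_ratio_limit:
  assumes "\<epsilon> > 0"
  shows "\<exists>n0. \<forall>n\<ge>n0. \<forall>k\<le>n. \<bar>bernstein_ratio n k j - (real k / real n) ^ j\<bar> \<le> \<epsilon>"
  using assms
proof (induction j arbitrary: \<epsilon>)
  case 0
  then show ?case by (intro exI[of _ 1]) (auto simp: bernstein_ratio_def)
next
  case (Suc j)
  obtain n0 where n0: "\<And>n k. n \<ge> n0 \<Longrightarrow> k \<le> n \<Longrightarrow> \<bar>bernstein_ratio n k j - (real k / real n) ^ j\<bar> \<le> \<epsilon>/2"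
    using Suc.IH[of "\<epsilon>/2"] Suc.prems by auto
  obtain n1 :: nat where n1: "real n1 > 2 * real j / \<epsilon>"
    using reals_Archimedean2 by blast
  show ?case
  proof (intro exI allI impI)
    \<comment> \<open>For k < j the factor y is negative; n \<ge> 2 j + 1 keeps |y| \<le> 1, and n -
      j \<ge> n1 makes j / (n - j) at most \<epsilon> / 2.\<close>
    fix n k assume n: "n \<ge> max n0 (n1 + 2 * j + 1)" and k: "k \<le> n"
    define x where "x = real k / real n"
    define y where "y = (real k - real j) / (real n - real j)"
    have npos: "real n > 0" "real n - real j > 0" using n by auto
    have "\<bar>y\<bar> \<le> 1"
      unfolding y_def using n k by (auto simp: abs_le_iff divide_simps)
    have x01: "0 \<le> x" "x \<le> 1" using npos k by (auto simp: x_def)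
    have "x - y = real j * (real n - real k) / (real n * (real n - real j))"
      using npos by (simp add: x_def y_def field_simps)
    also have "\<bar>\<dots>\<bar> = real j * ((real n - real k) / real n) / (real n - real j)"
      using npos k by (simp add: abs_mult)
    also have "\<dots> \<le> real j * 1 / (real n - real j)"
      using npos k by (intro divide_right_mono mult_left_mono) auto
    also have "\<dots> \<le> real j / real n1"
    proof (cases "n1 = 0")
      case True
      then have "real j = 0" using n1 Suc.prems by (simp add: field_simps mult_less_0_iff)
      then show ?thesis by simp
    qed (use npos n in \<open>auto intro!: divide_left_mono mult_pos_pos\<close>)
    also have "\<dots> \<le> \<epsilon>/2"
      using n1 Suc.prems by (cases "n1 = 0") (auto simp: field_simps)
    finally have xy: "\<bar>y - x\<bar> \<le> \<epsilon>/2" by (simp add: abs_minus_commute)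
    have "bernstein_ratio n k (Suc j) - x ^ Suc j =
      (bernstein_ratio n k j - x ^ j) * y + x ^ j * (y - x)"
    proof -
      have "bernstein_ratio n k (Suc j) = bernstein_ratio n k j * y"
        using bernstein_ratio_Suc[of j n k] n by (simp add: y_def)
      then show ?thesis by (simp add: algebra_simps)
    qed
    also have "\<bar>\<dots>\<bar> \<le> \<bar>bernstein_ratio n k j - x ^ j\<bar> * \<bar>y\<bar> + \<bar>x ^ j\<bar> * \<bar>y - x\<bar>"
      by (metis abs_mult abs_triangle_ineq)
    also have "\<dots> \<le> \<epsilon>/2 * 1 + 1 * (\<epsilon>/2)"
    proof (intro add_mono mult_mono)
      show "\<bar>bernstein_ratio n k j - x ^ j\<bar> \<le> \<epsilon> / 2"
        using n0[of n k] n k by (simp add: x_def)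
      show "\<bar>x ^ j\<bar> \<le> 1" using x01 by (simp add: power_le_one)
    qed (use \<open>\<bar>y\<bar> \<le> 1\<close> xy Suc.prems in auto)
    finally show "\<bar>bernstein_ratio n k (Suc j) - (real k / real n) ^ Suc j\<bar> \<le> \<epsilon>"
      by (simp add: x_def)
  qed
qed

text \<open>Multiply X^j by 1 = (X + Y)^(n - j) and expand; the binomial identity for products then
  produces the ratio.\<close>

lemma power_bernstein:
  fixes X Y :: "real poly"
  assumes "j \<le> n" "X + Y = 1"
  shows "(\<Sum>k\<le>n. smult (bernstein_ratio n k j * real (n choose k)) (X ^ k * Y ^ (n - k))) = X ^ j"
proof -
  have "X ^ j = X ^ j * (X + Y) ^ (n - j)" by (simp add: assms(2))
  also have "\<dots> = (\<Sum>i\<le>n - j. of_nat (n - j choose i) * X ^ (i + j) * Y ^ (n - j - i))"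
    by (simp add: binomial_ring sum_distrib_left power_add mult_ac)
  also have "\<dots> = (\<Sum>k\<in>{j..n}. of_nat (n - j choose (k - j)) * X ^ k * Y ^ (n - k))"
    by (rule sum.reindex_bij_witness[where i = "\<lambda>k. k - j" and j = "\<lambda>i. i + j"])
       (use assms in \<open>auto simp: algebra_simps\<close>)
  also have "\<dots> = (\<Sum>k\<in>{j..n}. smult (bernstein_ratio n k j * real (n choose k)) (X ^ k * Y ^ (n - k)))"
  proof (rule sum.cong[OF refl])
    fix k assume k: "k \<in> {j..n}"
    have "(n choose k) * (k choose j) = (n choose j) * (n - j choose (k - j))"
      using k by (intro choose_mult) auto
    then have "real (n choose k) * real (k choose j) = real (n choose j) * real (n - j choose (k - j))"
      by (metis of_nat_mult)
    then have "real (n - j choose (k - j)) = bernstein_ratio n k j * real (n choose k)"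
      using assms by (simp add: bernstein_ratio_def field_simps)
    then show "of_nat (n - j choose (k - j)) * X ^ k * Y ^ (n - k) =
        smult (bernstein_ratio n k j * real (n choose k)) (X ^ k * Y ^ (n - k))"
      by (simp add: of_nat_poly mult.assoc)
  qed
  also have "\<dots> = (\<Sum>k\<le>n. smult (bernstein_ratio n k j * real (n choose k)) (X ^ k * Y ^ (n - k)))"
    by (rule sum.mono_neutral_left) (auto simp: bernstein_ratio_def binomial_eq_0)
  finally show ?thesis by simp
qed

section \<open>Polynomials of a symmetric operator and their positivity\<close>

locale unit_interval_op =
  fixes R :: "'h::{real_inner, complete_space} \<Rightarrow> 'h"
  assumes lin: "bounded_linear R"
    and sym: "R x \<bullet> y = x \<bullet> R y"
    and nonneg: "0 \<le> R x \<bullet> x"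
    and le_one: "R x \<bullet> x \<le> x \<bullet> x"
begin

lemma R_lin: "linear R" by (simp add: bounded_linear.linear lin)

lemma poly_op_pCons [simp]: "poly_op R (pCons a p) x = a *\<^sub>R x + R (poly_op R p x)"
proof (cases "a = 0 \<and> p = 0")
  case True
  then show ?thesis using linear_0[OF R_lin] by (simp add: poly_op_def)
next
  case False
  then show ?thesis by (auto simp: poly_op_def fold_coeffs_pCons_coeff_not_0_eq fold_coeffs_pCons_not_0_0_eq)
qed

lemma poly_op_add: "poly_op R (p + q) x = poly_op R p x + poly_op R q x"
  by (induction p q rule: poly_induct2) (auto simp: algebra_simps linear_add[OF R_lin])

lemma poly_op_smult: "poly_op R (smult c p) x = c *\<^sub>R poly_op R p x"
  by (induction p) (auto simp: algebra_simps linear_scale[OF R_lin])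

lemma poly_op_mult: "poly_op R (p * q) x = poly_op R p (poly_op R q x)"
  by (induction p) (auto simp: poly_op_add poly_op_smult mult_pCons_left linear_0[OF R_lin])

lemma poly_op_1 [simp]: "poly_op R 1 x = x"
  by (simp add: one_pCons linear_0[OF R_lin])

lemma poly_op_X: "poly_op R [:0,1:] x = R x" and poly_op_1_minus_X: "poly_op R [:1,-1:] x = x - R x"
  by (simp_all add: linear_0[OF R_lin] linear_neg[OF R_lin])

lemma poly_op_uminus: "poly_op R (- p) x = - poly_op R p x"
  using poly_op_smult[of "-1" p x] by simp

lemma poly_op_diff: "poly_op R (p - q) x = poly_op R p x - poly_op R q x"
  using poly_op_add[of p "- q" x] by (simp add: poly_op_uminus)

lemma poly_op_sum: "poly_op R (\<Sum>i\<in>I. p i) x = (\<Sum>i\<in>I. poly_op R (p i) x)"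
  by (induction I rule: infinite_finite_induct) (auto simp: poly_op_add)

lemma poly_op_bounded_linear: "bounded_linear (poly_op R p)"
proof (induction p)
  case 0
  have "poly_op R 0 = (\<lambda>x. 0)" by auto
  then show ?case by simp
next
  case (pCons a p)
  have "poly_op R (pCons a p) = (\<lambda>x. a *\<^sub>R x + R (poly_op R p x))" by auto
  then show ?case
    using bounded_linear_compose[OF lin pCons(2)]
    by (simp add: bounded_linear_add bounded_linear_scaleR_right)
qed

lemma poly_op_sym: "poly_op R p x \<bullet> y = x \<bullet> poly_op R p y"
proof (induction p arbitrary: x y)
  case (pCons a p)
  have "R (poly_op R p x) \<bullet> y = x \<bullet> R (poly_op R p y)"
    by (metis pCons.IH poly_op_mult poly_op_pCons sym add_0 poly_op_X poly_op_1 mult.commute)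
  then show ?case by (simp add: inner_add_left inner_add_right)
qed simp

text \<open>By the parities of k and l, the product is a square times one of 1, t, 1 - t, t (1 - t),
  and squares can be moved to both sides of the inner product. The last factor reduces to the two
  hypotheses by t (1 - t) = (1 - t) t^2 + t (1 - t)^2. Thus no operator square root is presupposed,
  which would be circular.\<close>

lemma poly_op_bernstein_nonneg: "0 \<le> poly_op R ([:0,1:] ^ k * [:1,-1:] ^ l) x \<bullet> x"
proof -
  let ?X = "[:0,1:] :: real poly" and ?Y = "[:1,-1:] :: real poly"
  have sq: "0 \<le> poly_op R (p * (q * q)) x \<bullet> x" if "\<And>y. 0 \<le> poly_op R p y \<bullet> y" for p q x
  proof -
    have "poly_op R (p * (q * q)) x \<bullet> x = poly_op R (q * (p * q)) x \<bullet> x" by (simp add: mult_ac)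
    also have "\<dots> = poly_op R p (poly_op R q x) \<bullet> poly_op R q x" by (simp add: poly_op_mult poly_op_sym)
    finally show ?thesis using that by simp
  qed
  have pX: "0 \<le> poly_op R ?X y \<bullet> y" for y using nonneg by (simp only: poly_op_X)
  have pY: "0 \<le> poly_op R ?Y y \<bullet> y" for y
    using le_one by (simp only: poly_op_1_minus_X inner_diff_left) simp
  have "?X * ?Y = ?Y * (?X * ?X) + ?X * (?Y * ?Y)" by simp
  then have pXY: "0 \<le> poly_op R (?X * ?Y) y \<bullet> y" for y
    using sq[OF pX, of ?Y y] sq[OF pY, of ?X y] by (simp only: poly_op_add inner_add_left)
  define i where "i = k div 2"
  define a where "a = k mod 2"
  define j where "j = l div 2"
  define b where "b = l mod 2"
  have k: "k = a + (i + i)" "a = 0 \<or> a = 1" and l: "l = b + (j + j)" "b = 0 \<or> b = 1"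
    unfolding i_def a_def j_def b_def by presburger+
  have "0 \<le> poly_op R (?X ^ a * ?Y ^ b) y \<bullet> y" for y
    using k(2) l(2) pX pY pXY by (auto simp del: poly_op_pCons mult_pCons_left mult_pCons_right)
  from sq[OF this, of "?X ^ i * ?Y ^ j" x] show ?thesis
    by (simp add: k(1) l(1) power_add mult_ac del: poly_op_pCons mult_pCons_left mult_pCons_right)
qed


text \<open>Bernstein's argument: in degree n the coefficients of p are uniformly close to the
  values p(k/n) \<ge> 0, and the basis polynomials are positive operators that sum to the identity.
  The form is therefore at least an arbitrarily small negative multiple of the square of the
  norm.\<close>

lemma poly_op_nonneg:
  assumes "\<And>t. 0 \<le> t \<Longrightarrow> t \<le> 1 \<Longrightarrow> 0 \<le> poly p t"
  shows "0 \<le> poly_op R p x \<bullet> x"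
proof (rule field_le_epsilon)
  fix e :: real assume e: "e > 0"
  define d where "d = degree p"
  define C where "C = (\<Sum>j\<le>d. \<bar>coeff p j\<bar>)"
  define \<epsilon> where "\<epsilon> = e / ((1 + C) * (1 + x \<bullet> x))"
  have C0: "C \<ge> 0" by (simp add: C_def sum_nonneg)
  have eps: "\<epsilon> > 0"
    using e C0 inner_ge_zero[of x] by (auto simp: \<epsilon>_def intro!: divide_pos_pos mult_pos_pos add_pos_nonneg)
  obtain n0 where n0: "\<And>j n k. n \<ge> n0 j \<Longrightarrow> k \<le> n \<Longrightarrow> \<bar>bernstein_ratio n k j - (real k / real n) ^ j\<bar> \<le> \<epsilon>"
    using bernstein_ratio_limit[OF eps] by metis
  define n where "n = d + 1 + (\<Sum>j\<le>d. n0 j)"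
  have n: "n \<ge> n0 j" if "j \<le> d" for j
    unfolding n_def using that by (intro trans_le_add2 member_le_sum) auto
  have nd: "d \<le> n" "n > 0" by (auto simp: n_def)
  let ?Q = "\<lambda>k. [:0,1:] ^ k * [:1,-1:] ^ (n - k) :: real poly"
  define q where "q k = real (n choose k) * (poly_op R (?Q k) x \<bullet> x)" for k
  have q0: "q k \<ge> 0" for k
    unfolding q_def using poly_op_bernstein_nonneg by (intro mult_nonneg_nonneg) auto
  define b where "b k = (\<Sum>j\<le>d. coeff p j * bernstein_ratio n k j)" for k
  have expand: "poly_op R ([:0,1:] ^ j) x \<bullet> x = (\<Sum>k\<le>n. bernstein_ratio n k j * q k)" if "j \<le> n" for j
    by (subst power_bernstein[OF that, of _ "[:1,-1:]", symmetric])
       (simp_all add: poly_op_sum poly_op_smult inner_sum_left q_def mult.assoc one_pCons del: poly_op_pCons)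
  \<comment> \<open>The case j = 0: the weights q k are nonnegative and sum to the square of the
    norm, so an error in the coefficients is not amplified.\<close>
  have "poly_op R 1 x \<bullet> x = (\<Sum>k\<le>n. bernstein_ratio n k 0 * q k)"
    using expand[of 0] by simp
  then have sumq: "(\<Sum>k\<le>n. q k) = x \<bullet> x"
    by (simp add: bernstein_ratio_def)
  have "p = (\<Sum>j\<le>d. smult (coeff p j) ([:0,1:] ^ j))"
    unfolding d_def by (simp add: poly_as_sum_of_monoms monom_altdef[symmetric])
  then have "poly_op R p x = (\<Sum>j\<le>d. coeff p j *\<^sub>R poly_op R ([:0,1:] ^ j) x)"
    by (metis (no_types, lifting) poly_op_smult poly_op_sum sum.cong)
  then have "poly_op R p x \<bullet> x = (\<Sum>j\<le>d. coeff p j * (poly_op R ([:0,1:] ^ j) x \<bullet> x))"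
    by (simp add: inner_sum_left)
  also have "\<dots> = (\<Sum>j\<le>d. \<Sum>k\<le>n. coeff p j * bernstein_ratio n k j * q k)"
    using nd by (intro sum.cong refl) (simp add: expand sum_distrib_left mult.assoc)
  also have "\<dots> = (\<Sum>k\<le>n. b k * q k)"
    by (subst sum.swap) (simp add: b_def sum_distrib_right)
  finally have eq: "poly_op R p x \<bullet> x = (\<Sum>k\<le>n. b k * q k)" .
  have b: "b k \<ge> - (C * \<epsilon>)" if k: "k \<le> n" for k
  proof -
    let ?t = "real k / real n"
    have "\<bar>b k - poly p ?t\<bar> = \<bar>\<Sum>j\<le>d. coeff p j * (bernstein_ratio n k j - ?t ^ j)\<bar>"
      by (simp add: b_def poly_altdef d_def sum_subtractf right_diff_distrib)
    also have "\<dots> \<le> (\<Sum>j\<le>d. \<bar>coeff p j\<bar> * \<epsilon>)"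
      by (rule order_trans[OF sum_abs sum_mono])
         (use n0[OF n k] in \<open>auto simp: abs_mult intro!: mult_left_mono\<close>)
    also have "\<dots> = C * \<epsilon>" by (simp add: C_def sum_distrib_right)
    finally show ?thesis using assms[of ?t] k nd by (auto simp: abs_le_iff field_simps)
  qed
  have "- (C * \<epsilon>) * (x \<bullet> x) = (\<Sum>k\<le>n. - (C * \<epsilon>) * q k)"
    by (simp only: sum_distrib_left[symmetric] sumq)
  also have "\<dots> \<le> (\<Sum>k\<le>n. b k * q k)"
    by (intro sum_mono mult_right_mono b q0) auto
  finally have "poly_op R p x \<bullet> x \<ge> - (C * \<epsilon>) * (x \<bullet> x)" using eq by simp
  moreover have "C * \<epsilon> * (x \<bullet> x) \<le> e"
  proof -
    have "C * (x \<bullet> x) \<le> (1 + C) * (1 + x \<bullet> x)"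
      using C0 inner_ge_zero[of x] by (intro mult_mono) auto
    then show ?thesis
      using e C0 inner_ge_zero[of x] unfolding \<epsilon>_def
      by (subst times_divide_eq_right, subst times_divide_eq_left, subst divide_le_eq)
         (auto simp: mult_ac add_pos_nonneg)
  qed
  ultimately show "0 \<le> poly_op R p x \<bullet> x + e" by simp
qed

lemma norm_poly_op_le_poly_op:
  assumes "\<And>t. 0 \<le> t \<Longrightarrow> t \<le> 1 \<Longrightarrow> (poly p t)\<^sup>2 \<le> (poly q t)\<^sup>2"
  shows "norm (poly_op R p x) \<le> norm (poly_op R q x)"
proof -
  have "0 \<le> poly_op R (q * q - p * p) x \<bullet> x"
    by (rule poly_op_nonneg) (use assms in \<open>auto simp: power2_eq_square\<close>)
  then have "poly_op R p x \<bullet> poly_op R p x \<le> poly_op R q x \<bullet> poly_op R q x"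
    by (simp add: poly_op_diff poly_op_mult inner_diff_left poly_op_sym)
  then show ?thesis by (simp add: norm_eq_sqrt_inner)
qed

lemma norm_poly_op_le:
  assumes "\<And>t. 0 \<le> t \<Longrightarrow> t \<le> 1 \<Longrightarrow> \<bar>poly p t\<bar> \<le> M"
  shows "norm (poly_op R p x) \<le> M * norm x"
proof -
  have "M \<ge> 0" using assms[of 0] by auto
  have "norm (poly_op R p x) \<le> norm (poly_op R [:M:] x)"
    by (rule norm_poly_op_le_poly_op) (use assms \<open>M \<ge> 0\<close> in \<open>auto simp: abs_le_square_iff[symmetric]\<close>)
  then show ?thesis using \<open>M \<ge> 0\<close> by (simp add: linear_0[OF R_lin])
qed

end

section \<open>Passage from polynomials to continuous functions\<close>

definition uapprox :: "(real \<Rightarrow> real) \<Rightarrow> (nat \<Rightarrow> real poly) \<Rightarrow> bool" where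
  "uapprox f p \<longleftrightarrow> uniform_limit {0..1} (\<lambda>n. poly (p n)) f sequentially"

lemma uapprox_exists:
  assumes "continuous_on {0..1} f"
  shows "\<exists>p. uapprox f p"
proof -
  have "\<exists>p. \<forall>t\<in>{0..1}. \<bar>f t - poly p t\<bar> < inverse (real (Suc n))" for n
  proof -
    obtain g where g: "real_polynomial_function g" "\<And>t. t \<in> {0..1} \<Longrightarrow> \<bar>f t - g t\<bar> < inverse (real (Suc n))"
      using Stone_Weierstrass_real_polynomial_function[OF _ assms, of "inverse (real (Suc n))"] by auto
    obtain a m where "g = (\<lambda>x. \<Sum>i\<le>m. a i * x ^ i)"
      using g(1) real_polynomial_function_iff_sum by blast
    then have "g t = poly (\<Sum>i\<le>m. monom (a i) i) t" for t
      by (simp add: poly_sum poly_monom)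
    then show ?thesis using g(2) by (intro exI[of _ "\<Sum>i\<le>m. monom (a i) i"]) auto
  qed
  then obtain p where p: "\<And>n t. t \<in> {0..1} \<Longrightarrow> \<bar>f t - poly (p n) t\<bar> < inverse (real (Suc n))"
    by metis
  have "uniform_limit {0..1} (\<lambda>n. poly (p n)) f sequentially"
  proof (rule uniform_limitI)
    fix e :: real assume "e > 0"
    then have "\<forall>\<^sub>F n in sequentially. inverse (real (Suc n)) < e"
      using LIMSEQ_inverse_real_of_nat order_tendstoD(2) by blast
    then show "\<forall>\<^sub>F n in sequentially. \<forall>t\<in>{0..1}. dist (poly (p n) t) (f t) < e"
    proof eventually_elim
      case (elim n)
      show ?case
      proof
        fix t :: real assume "t \<in> {0..1}"
        from p[OF this, of n] elim show "dist (poly (p n) t) (f t) < e"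
          by (simp add: dist_real_def abs_minus_commute)
      qed
    qed
  qed
  then show ?thesis unfolding uapprox_def by blast
qed

lemma poly_eta:
  "poly (p + q) = (\<lambda>t. poly p t + poly q t)" "poly (smult c p) = (\<lambda>t. c * poly p t)"
  "poly (p * q) = (\<lambda>t. poly p t * poly q t)"
  for p q :: "real poly" by auto

lemma uapprox_eventually:
  assumes "uapprox f p" "e > 0"
  shows "\<forall>\<^sub>F n in sequentially. \<forall>t\<in>{0..1}. \<bar>poly (p n) t - f t\<bar> < e"
  using uniform_limitD[OF assms(1)[unfolded uapprox_def] assms(2)] by (simp only: dist_real_def)

context unit_interval_op
begin

text \<open>The approximating sequence is an arbitrary choice; \<open>Phi_limit\<close> shows that
  any other one has the same limit. The result is packaged as a bounded operator so that operator
  norms and derivatives with respect to time are available.\<close>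

definition Phi :: "(real \<Rightarrow> real) \<Rightarrow> 'h \<Rightarrow>\<^sub>L 'h" where
  "Phi f = Blinfun (\<lambda>x. lim (\<lambda>n. poly_op R ((SOME p. uapprox f p) n) x))"

lemma poly_op_convergent:
  assumes "uapprox f p"
  shows "convergent (\<lambda>n. poly_op R (p n) x)"
proof -
  have "Cauchy (\<lambda>n. poly_op R (p n) x)"
  proof (rule CauchyI)
    fix e :: real assume "e > 0"
    define d where "d = e / (1 + norm x) / 2"
    have d: "d > 0" using \<open>e > 0\<close> by (simp add: d_def add_pos_nonneg)
    then obtain N where N: "\<And>n t. n \<ge> N \<Longrightarrow> t \<in> {0..1} \<Longrightarrow> \<bar>poly (p n) t - f t\<bar> < d"
      using uapprox_eventually[OF assms d] unfolding eventually_sequentially by blast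
    show "\<exists>M. \<forall>m\<ge>M. \<forall>n\<ge>M. norm (poly_op R (p m) x - poly_op R (p n) x) < e"
    proof (intro exI allI impI)
      fix m n assume mn: "m \<ge> N" "n \<ge> N"
      have "norm (poly_op R (p m - p n) x) \<le> (2 * d) * norm x"
      proof (rule norm_poly_op_le)
        fix t :: real assume "0 \<le> t" "t \<le> 1"
        then show "\<bar>poly (p m - p n) t\<bar> \<le> 2 * d"
          using N[OF mn(1), of t] N[OF mn(2), of t] by auto
      qed
      also have "\<dots> < e"
        using \<open>e > 0\<close> by (auto simp: d_def field_simps add_pos_nonneg)
      finally show "norm (poly_op R (p m) x - poly_op R (p n) x) < e" by (simp add: poly_op_diff)
    qed
  qed
  then show ?thesis by (simp add: Cauchy_convergent)
qed

lemma poly_op_limit_unique: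
  assumes "uapprox f p" "uapprox f q" "(\<lambda>n. poly_op R (p n) x) \<longlonglongrightarrow> y"
  shows "(\<lambda>n. poly_op R (q n) x) \<longlonglongrightarrow> y"
proof -
  have "(\<lambda>n. poly_op R (q n) x - poly_op R (p n) x) \<longlonglongrightarrow> 0"
  proof (rule tendstoI)
    fix e :: real assume "e > 0"
    define d where "d = e / (1 + norm x) / 2"
    have d: "d > 0" using \<open>e > 0\<close> by (simp add: d_def add_pos_nonneg)
    show "\<forall>\<^sub>F n in sequentially. dist (poly_op R (q n) x - poly_op R (p n) x) 0 < e"
      using uapprox_eventually[OF assms(1) d] uapprox_eventually[OF assms(2) d]
    proof eventually_elim
      case (elim n)
      have "norm (poly_op R (q n - p n) x) \<le> (2 * d) * norm x"
      proof (rule norm_poly_op_le)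
        fix t :: real assume "0 \<le> t" "t \<le> 1"
        then have "\<bar>poly (p n) t - f t\<bar> < d" "\<bar>poly (q n) t - f t\<bar> < d" using elim by auto
        then show "\<bar>poly (q n - p n) t\<bar> \<le> 2 * d" by auto
      qed
      also have "\<dots> < e"
        using \<open>e > 0\<close> by (auto simp: d_def field_simps add_pos_nonneg)
      finally show ?case by (simp add: poly_op_diff)
    qed
  qed
  from tendsto_add[OF this assms(3)] show ?thesis by simp
qed

lemma norm_lim_poly_op_le:
  assumes "uapprox f p" "\<And>t. t \<in> {0..1} \<Longrightarrow> \<bar>f t\<bar> \<le> M" "(\<lambda>n. poly_op R (p n) x) \<longlonglongrightarrow> y"
  shows "norm y \<le> M * norm x"
proof (rule field_le_epsilon)
  fix e :: real assume e: "e > 0"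
  define d where "d = e / (1 + norm x)"
  have d: "d > 0" using e by (simp add: d_def add_pos_nonneg)
  have ev: "\<forall>\<^sub>F n in sequentially. norm (poly_op R (p n) x) \<le> (M + d) * norm x"
    using uapprox_eventually[OF assms(1) d]
  proof eventually_elim
    case (elim n)
    show ?case
    proof (rule norm_poly_op_le)
      fix t :: real assume "0 \<le> t" "t \<le> 1"
      then show "\<bar>poly (p n) t\<bar> \<le> M + d" using elim assms(2)[of t] by (force simp: abs_le_iff abs_less_iff)
    qed
  qed
  have "norm y \<le> (M + d) * norm x"
    by (rule tendsto_upperbound[OF tendsto_norm[OF assms(3)] ev]) simp
  also have "\<dots> \<le> M * norm x + e"
    using e by (simp add: d_def field_simps add_pos_nonneg)
  finally show "norm y \<le> M * norm x + e" .
qed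

lemma Phi_limit:
  assumes "continuous_on {0..1} f" "uapprox f p"
  shows "(\<lambda>n. poly_op R (p n) x) \<longlonglongrightarrow> Phi f x"
proof -
  let ?q = "SOME p. uapprox f p"
  let ?L = "\<lambda>x. lim (\<lambda>n. poly_op R (?q n) x)"
  have q: "uapprox f ?q" using uapprox_exists[OF assms(1)] by (rule someI_ex)
  have L: "(\<lambda>n. poly_op R (?q n) x) \<longlonglongrightarrow> ?L x" for x
    using poly_op_convergent[OF q] by (simp add: convergent_LIMSEQ_iff)
  have "bounded (f ` {0..1})"
    using assms(1) compact_continuous_image compact_imp_bounded by blast
  then obtain M where M: "\<And>t. t \<in> {0..1} \<Longrightarrow> \<bar>f t\<bar> \<le> M"
    unfolding bounded_iff real_norm_def by blast
  have "bounded_linear ?L"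
  proof (rule bounded_linear_intro)
    fix x y :: 'h and r :: real
    have "(\<lambda>n. poly_op R (?q n) (x + y)) \<longlonglongrightarrow> ?L x + ?L y"
      using tendsto_add[OF L[of x] L[of y]]
      by (simp add: bounded_linear.linear[OF poly_op_bounded_linear] linear_add)
    then show "?L (x + y) = ?L x + ?L y" by (rule limI)
    have "(\<lambda>n. poly_op R (?q n) (r *\<^sub>R x)) \<longlonglongrightarrow> r *\<^sub>R ?L x"
      using tendsto_scaleR[OF tendsto_const L[of x]]
      by (simp add: bounded_linear.linear[OF poly_op_bounded_linear] linear_scale)
    then show "?L (r *\<^sub>R x) = r *\<^sub>R ?L x" by (rule limI)
    show "norm (?L x) \<le> norm x * M"
      using norm_lim_poly_op_le[OF q M L] by (simp add: mult.commute)
  qed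
  then have "Phi f x = ?L x" unfolding Phi_def by (simp add: bounded_linear_Blinfun_apply)
  then show ?thesis using poly_op_limit_unique[OF q assms(2) L] by simp
qed

lemma norm_Phi_apply_le:
  assumes "continuous_on {0..1} f" "\<And>t. t \<in> {0..1} \<Longrightarrow> \<bar>f t\<bar> \<le> M"
  shows "norm (Phi f x) \<le> M * norm x"
  using uapprox_exists[OF assms(1)] Phi_limit[OF assms(1)] norm_lim_poly_op_le assms(2) by metis

lemma norm_Phi_le:
  assumes "continuous_on {0..1} f" "\<And>t. t \<in> {0..1} \<Longrightarrow> \<bar>f t\<bar> \<le> M"
  shows "norm (Phi f) \<le> M"
  using norm_Phi_apply_le[OF assms] assms(2)[of 0] by (intro norm_blinfun_bound) auto

text \<open>Only the values on the unit interval count. This is used for identities between symbols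
  that fail elsewhere, such as sqrt t * sqrt t = t.\<close>

lemma Phi_cong:
  assumes "continuous_on {0..1} f" "\<And>t. t \<in> {0..1} \<Longrightarrow> f t = g t"
  shows "Phi f = Phi g"
proof (rule blinfun_eqI)
  fix x
  obtain p where p: "uapprox f p" using uapprox_exists[OF assms(1)] by blast
  then have "uapprox g p"
    unfolding uapprox_def by (rule uniform_limit_cong'[THEN iffD1, rotated -1]) (simp_all add: assms(2))
  moreover have "continuous_on {0..1} g" using assms continuous_on_cong by (metis (full_types))
  ultimately show "Phi f x = Phi g x"
    using Phi_limit[OF assms(1) p] Phi_limit LIMSEQ_unique by blast
qed

lemma Phi_poly: "Phi (poly p) x = poly_op R p x"
proof -
  have "uapprox (poly p) (\<lambda>n. p)" by (simp add: uapprox_def uniform_limit_const)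
  moreover have "continuous_on {0..1} (poly p)" by (intro continuous_intros)
  ultimately have "(\<lambda>n. poly_op R p x) \<longlonglongrightarrow> Phi (poly p) x" by (intro Phi_limit)
  then show ?thesis by (simp add: LIMSEQ_const_iff)
qed

lemma Phi_1 [simp]: "Phi (\<lambda>t. 1) x = x"
proof -
  have "poly 1 = (\<lambda>t::real. 1)" by auto
  then show ?thesis using Phi_poly[of 1 x] by simp
qed

lemma Phi_id: "Phi (\<lambda>t. t) x = R x"
proof -
  have "poly [:0,1:] = (\<lambda>t::real. t)" by auto
  then show ?thesis using Phi_poly[of "[:0,1:]" x] by (simp only: poly_op_X)
qed

lemma Phi_add:
  assumes "continuous_on {0..1} f" "continuous_on {0..1} g"
  shows "Phi (\<lambda>t. f t + g t) x = Phi f x + Phi g x"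
proof -
  obtain p q where pq: "uapprox f p" "uapprox g q" using uapprox_exists assms by metis
  have "uapprox (\<lambda>t. f t + g t) (\<lambda>n. p n + q n)"
    using uniform_limit_add[OF pq[unfolded uapprox_def]] by (simp add: uapprox_def poly_eta)
  from Phi_limit[OF continuous_on_add[OF assms] this, of x]
  show ?thesis
    using tendsto_add[OF Phi_limit[OF assms(1) pq(1), of x] Phi_limit[OF assms(2) pq(2), of x]]
    by (simp add: poly_op_add LIMSEQ_unique)
qed

lemma Phi_scale:
  assumes "continuous_on {0..1} f"
  shows "Phi (\<lambda>t. c * f t) x = c *\<^sub>R Phi f x"
proof -
  obtain p where p: "uapprox f p" using uapprox_exists assms by metis
  have "uapprox (\<lambda>t. c * f t) (\<lambda>n. smult c (p n))"
    using bounded_linear.uniform_limit[OF bounded_linear_mult_right p[unfolded uapprox_def], of c]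
    by (simp add: uapprox_def poly_eta)
  from Phi_limit[OF continuous_on_mult[OF continuous_on_const assms] this, of x]
  show ?thesis
    using tendsto_scaleR[OF tendsto_const Phi_limit[OF assms p, of x], of c]
    by (simp add: poly_op_smult LIMSEQ_unique)
qed

lemma Phi_diff:
  assumes "continuous_on {0..1} f" "continuous_on {0..1} g"
  shows "Phi (\<lambda>t. f t - g t) x = Phi f x - Phi g x"
  using Phi_add[OF assms(1) continuous_on_mult[OF continuous_on_const[of _ "- 1"] assms(2)], of x]
    Phi_scale[OF assms(2), of "- 1" x] by simp

lemma Phi_sym:
  assumes "continuous_on {0..1} f"
  shows "Phi f x \<bullet> y = x \<bullet> Phi f y"
proof -
  obtain p where p: "uapprox f p" using uapprox_exists assms by metis
  have "(\<lambda>n. poly_op R (p n) x \<bullet> y) \<longlonglongrightarrow> Phi f x \<bullet> y" "(\<lambda>n. x \<bullet> poly_op R (p n) y) \<longlonglongrightarrow> x \<bullet> Phi f y"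
    by (intro tendsto_inner tendsto_const Phi_limit[OF assms p])+
  then show ?thesis by (simp add: poly_op_sym LIMSEQ_unique)
qed

lemma poly_op_Phi:
  assumes "continuous_on {0..1} f"
  shows "Phi (\<lambda>t. poly q t * f t) x = poly_op R q (Phi f x)"
proof -
  obtain p where p: "uapprox f p" using uapprox_exists assms by metis
  have "bounded (f ` {0..1})" "bounded (poly q ` {0..1})"
    using assms by (auto intro!: compact_imp_bounded compact_continuous_image continuous_intros)
  then have "uapprox (\<lambda>t. poly q t * f t) (\<lambda>n. q * p n)"
    using uniform_lim_mult[OF uniform_limit_const p[unfolded uapprox_def], of "poly q"]
    by (simp add: uapprox_def poly_eta)
  then have "(\<lambda>n. poly_op R (q * p n) x) \<longlonglongrightarrow> Phi (\<lambda>t. poly q t * f t) x"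
    using assms by (intro Phi_limit continuous_intros) auto
  moreover have "(\<lambda>n. poly_op R q (poly_op R (p n) x)) \<longlonglongrightarrow> poly_op R q (Phi f x)"
    by (intro bounded_linear.tendsto[OF poly_op_bounded_linear] Phi_limit[OF assms p])
  ultimately show ?thesis by (simp add: poly_op_mult LIMSEQ_unique)
qed

text \<open>Multiplicativity for a polynomial first factor is already known; approximating only this
  factor, with g fixed and bounded, gives the general case.\<close>

lemma Phi_mult:
  assumes "continuous_on {0..1} f" "continuous_on {0..1} g"
  shows "Phi (\<lambda>t. f t * g t) x = Phi f (Phi g x)"
proof -
  obtain p where p: "uapprox f p" using uapprox_exists assms by metis
  have bd: "bounded (f ` {0..1})" "bounded (g ` {0..1})"
    using assms by (auto intro!: compact_imp_bounded compact_continuous_image continuous_intros)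
  then obtain M where M: "\<And>t. t \<in> {0..1} \<Longrightarrow> \<bar>g t\<bar> \<le> M"
    unfolding bounded_iff real_norm_def by blast
  have "(\<lambda>n. Phi (\<lambda>t. poly (p n) t * g t) x) \<longlonglongrightarrow> Phi (\<lambda>t. f t * g t) x"
  proof (rule tendstoI)
    fix e :: real assume e: "e > 0"
    define d where "d = e / ((1 + \<bar>M\<bar>) * (1 + norm x))"
    have d: "d > 0" using e by (simp add: d_def add_pos_nonneg)
    show "\<forall>\<^sub>F n in sequentially. dist (Phi (\<lambda>t. poly (p n) t * g t) x) (Phi (\<lambda>t. f t * g t) x) < e"
      using uapprox_eventually[OF p d]
    proof eventually_elim
      case (elim n)
      have c: "continuous_on {0..1} (\<lambda>t. poly (p n) t * g t)" "continuous_on {0..1} (\<lambda>t. f t * g t)"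
        using assms by (auto intro!: continuous_intros)
      have "norm (Phi (\<lambda>t. poly (p n) t * g t - f t * g t) x) \<le> (d * \<bar>M\<bar>) * norm x"
      proof (rule norm_Phi_apply_le)
        show "continuous_on {0..1} (\<lambda>t. poly (p n) t * g t - f t * g t)"
          by (rule continuous_on_diff[OF c])
        fix t :: real assume t: "t \<in> {0..1}"
        have "\<bar>poly (p n) t - f t\<bar> * \<bar>g t\<bar> \<le> d * \<bar>M\<bar>"
          using bspec[OF elim t] M[OF t] d by (intro mult_mono) auto
        then show "\<bar>poly (p n) t * g t - f t * g t\<bar> \<le> d * \<bar>M\<bar>"
          by (simp add: abs_mult[symmetric] left_diff_distrib)
      qed
      also have "\<dots> < d * ((1 + \<bar>M\<bar>) * (1 + norm x))"
        unfolding mult.assoc using d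
        by (intro mult_strict_left_mono mult_strict_mono) (auto simp: add_pos_nonneg)
      also have "\<dots> = e" unfolding d_def using e
        by (smt (verit, best) abs_ge_zero divide_eq_0_iff mult_eq_0_iff nonzero_eq_divide_eq norm_ge_zero)
      finally show ?case by (simp add: dist_norm Phi_diff[OF c])
    qed
  qed
  then have "(\<lambda>n. poly_op R (p n) (Phi g x)) \<longlonglongrightarrow> Phi (\<lambda>t. f t * g t) x"
    by (simp add: poly_op_Phi[OF assms(2)])
  then show ?thesis using Phi_limit[OF assms(1) p] LIMSEQ_unique by blast
qed

lemma Phi_nonneg:
  assumes "continuous_on {0..1} f" "\<And>t. t \<in> {0..1} \<Longrightarrow> 0 \<le> f t"
  shows "0 \<le> Phi f x \<bullet> x"
proof -
  let ?s = "\<lambda>t. sqrt (f t)"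
  have s: "continuous_on {0..1} ?s" using assms by (intro continuous_intros)
  have "Phi f = Phi (\<lambda>t. ?s t * ?s t)" by (rule Phi_cong[OF assms(1)]) (use assms(2) in auto)
  then have "Phi f x \<bullet> x = Phi ?s x \<bullet> Phi ?s x" by (simp only: Phi_mult[OF s s] Phi_sym[OF s])
  then show ?thesis by simp
qed

text \<open>Positivity of g^2 - f^2. The comparison holds at every vector, which is stronger than
  one of operator norms: in the energy estimate g is the symbol of the cut-off operator, whose norm
  is not bounded as the cut-off is removed.\<close>

lemma norm_Phi_le_Phi:
  assumes "continuous_on {0..1} f" "continuous_on {0..1} g"
    "\<And>t. t \<in> {0..1} \<Longrightarrow> (f t)\<^sup>2 \<le> (g t)\<^sup>2"
  shows "norm (Phi f x) \<le> norm (Phi g x)"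
proof -
  have c: "continuous_on {0..1} (\<lambda>t. f t * f t)" "continuous_on {0..1} (\<lambda>t. g t * g t)"
    using assms by (auto intro!: continuous_intros)
  have "0 \<le> Phi (\<lambda>t. g t * g t - f t * f t) x \<bullet> x"
    by (rule Phi_nonneg) (use assms c in \<open>auto intro!: continuous_intros simp: power2_eq_square\<close>)
  then have "Phi f x \<bullet> Phi f x \<le> Phi g x \<bullet> Phi g x"
    using assms by (simp add: Phi_diff[OF c(2,1)] Phi_mult inner_diff_left Phi_sym)
  then show ?thesis by (simp add: norm_eq_sqrt_inner)
qed

end

section \<open>Resolvents and square roots\<close>

text \<open>The projection theorem: a minimizing sequence is Cauchy by the parallelogram law, and
  the vector from the nearest point is orthogonal to M. It yields surjectivity of 1 + A.\<close>

lemma closed_subspace_eq_UNIV: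
  fixes M :: "'h::{real_inner, complete_space} set"
  assumes "subspace M" "closed M" and orth: "\<And>y. (\<And>x. x \<in> M \<Longrightarrow> x \<bullet> y = 0) \<Longrightarrow> y = 0"
  shows "M = UNIV"
proof -
  have "a \<in> M" for a
  proof -
    define D where "D = (INF x\<in>M. (norm (a - x))\<^sup>2)"
    have M0: "0 \<in> M" using assms(1) subspace_0 by blast
    have bdd: "bdd_below ((\<lambda>x. (norm (a - x))\<^sup>2) ` M)" by (rule bdd_belowI[of _ 0]) auto
    have D_le: "D \<le> (norm (a - x))\<^sup>2" if "x \<in> M" for x
      unfolding D_def by (rule cINF_lower[OF bdd that])
    have "\<exists>x\<in>M. (norm (a - x))\<^sup>2 < D + inverse (real (Suc n))" for n
      using cInf_lessD[of "(\<lambda>x. (norm (a - x))\<^sup>2) ` M" "D + inverse (real (Suc n))"] M0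
      by (force simp: D_def)
    then obtain x where xM: "\<And>n. x n \<in> M" and x: "\<And>n. (norm (a - x n))\<^sup>2 < D + inverse (real (Suc n))"
      by metis
    have close: "(norm (x m - x n))\<^sup>2 \<le> 2 * inverse (real (Suc m)) + 2 * inverse (real (Suc n))" for m n
    proof -
      have "(1/2) *\<^sub>R (x m + x n) \<in> M"
        using assms(1) xM by (simp add: subspace_add subspace_scale)
      then have "4 * D \<le> 4 * (norm (a - (1/2) *\<^sub>R (x m + x n)))\<^sup>2" using D_le by simp
      moreover have "(norm (x m - x n))\<^sup>2 = 2 * (norm (a - x m))\<^sup>2 + 2 * (norm (a - x n))\<^sup>2
          - 4 * (norm (a - (1/2) *\<^sub>R (x m + x n)))\<^sup>2"
        by (simp add: power2_norm_eq_inner inner_diff_left inner_diff_right inner_add_left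
            inner_add_right inner_commute algebra_simps)
      ultimately show ?thesis using x[of m] x[of n] by linarith
    qed
    have "Cauchy x"
    proof (rule CauchyI)
      fix e :: real assume e: "e > 0"
      obtain N where N: "inverse (real (Suc N)) < e\<^sup>2 / 4"
        using reals_Archimedean[of "e\<^sup>2 / 4"] e by auto
      show "\<exists>N. \<forall>m\<ge>N. \<forall>n\<ge>N. norm (x m - x n) < e"
      proof (intro exI allI impI)
        fix m n assume mn: "N \<le> m" "N \<le> n"
        have "inverse (real (Suc k)) \<le> inverse (real (Suc N))" if "N \<le> k" for k
          using that by (intro le_imp_inverse_le) auto
        from this[OF mn(1)] this[OF mn(2)] have "(norm (x m - x n))\<^sup>2 < e\<^sup>2"
          using close[of m n] N by linarith
        then show "norm (x m - x n) < e" using e by (simp add: power_less_imp_less_base)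
      qed
    qed
    then obtain l where l: "x \<longlonglongrightarrow> l" using Cauchy_convergent convergent_def by blast
    have lM: "l \<in> M" using assms(2) xM l closed_sequentially by blast
    have "(norm (a - l))\<^sup>2 \<le> D + 0"
    proof (rule LIMSEQ_le)
      show "(\<lambda>n. (norm (a - x n))\<^sup>2) \<longlonglongrightarrow> (norm (a - l))\<^sup>2"
        by (intro tendsto_intros l)
      show "(\<lambda>n. D + inverse (real (Suc n))) \<longlonglongrightarrow> D + 0"
        by (intro tendsto_intros LIMSEQ_inverse_real_of_nat)
    qed (use x less_imp_le in blast)
    then have min: "(norm (a - l))\<^sup>2 \<le> (norm (a - y))\<^sup>2" if "y \<in> M" for y
      using D_le[OF that] by linarith
    have "v \<bullet> (a - l) = 0" if v: "v \<in> M" for v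
    proof (cases "v = 0")
      case False
      define t where "t = (v \<bullet> (a - l)) / (v \<bullet> v)"
      have "l + t *\<^sub>R v \<in> M" using lM v assms(1) by (simp add: subspace_add subspace_scale)
      from min[OF this] have "(a - l) \<bullet> (a - l) \<le> (a - l - t *\<^sub>R v) \<bullet> (a - l - t *\<^sub>R v)"
        by (simp add: power2_norm_eq_inner algebra_simps)
      also have "\<dots> = (a - l) \<bullet> (a - l) - 2 * t * (v \<bullet> (a - l)) + t * t * (v \<bullet> v)"
        by (simp add: inner_diff_left inner_diff_right inner_commute algebra_simps)
      also have "t * t * (v \<bullet> v) = t * (v \<bullet> (a - l))" using False by (simp add: t_def)
      finally have "t * (v \<bullet> (a - l)) \<le> 0" by simp
      then have "(v \<bullet> (a - l))\<^sup>2 / (v \<bullet> v) \<le> 0" by (simp add: t_def power2_eq_square)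
      moreover have "v \<bullet> v > 0" using False by simp
      ultimately show ?thesis by (simp add: divide_le_0_iff)
    qed simp
    from orth[OF this] show "a \<in> M" using lM by simp
  qed
  then show ?thesis by blast
qed

lemma adjoint_opD: "(y, z) \<in> adjoint_op A \<Longrightarrow> (x, w) \<in> A \<Longrightarrow> w \<bullet> y = x \<bullet> z"
  by (auto simp: adjoint_op_def)

lemma self_adjoint_closed:
  fixes A :: "('h::real_inner \<times> 'h) set"
  assumes "self_adjoint_op A" "\<And>n. (x n, y n) \<in> A" "x \<longlonglongrightarrow> a" "y \<longlonglongrightarrow> b"
  shows "(a, b) \<in> A"
proof -
  have A: "adjoint_op A = A" using assms(1) by (simp add: self_adjoint_op_def)
  have "q \<bullet> a = p \<bullet> b" if "(p, q) \<in> A" for p q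
  proof -
    have "q \<bullet> x n = p \<bullet> y n" for n using assms(2)[of n] that A adjoint_opD by blast
    moreover have "(\<lambda>n. q \<bullet> x n) \<longlonglongrightarrow> q \<bullet> a" "(\<lambda>n. p \<bullet> y n) \<longlonglongrightarrow> p \<bullet> b"
      by (intro tendsto_intros assms)+
    ultimately show ?thesis using LIMSEQ_unique by simp
  qed
  then have "(a, b) \<in> adjoint_op A" by (auto simp: adjoint_op_def)
  then show ?thesis using A by simp
qed

text \<open>\<open>R = (1 + A)\<^sup>-\<^sup>1\<close>.\<close>

definition is_resolvent :: "('h::{real_inner, complete_space} \<times> 'h) set \<Rightarrow> ('h \<Rightarrow> 'h) \<Rightarrow> bool" where
  "is_resolvent A R \<longleftrightarrow> unit_interval_op R \<and> A = range (\<lambda>z. (R z, z - R z)) \<and>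
     closure (range R) = UNIV \<and> inj R"

text \<open>Nonnegativity makes 1 + A coercive, |x + y|^2 \<ge> |x|^2 + |y|^2 on the graph; this
  gives injectivity and, as the graph is closed, closed range. A vector y orthogonal to the range
  satisfies (y, -y) in the graph of the adjoint, which is A itself, and nonnegativity forces y =
  0.\<close>

lemma resolvent_exists:
  fixes A :: "('h::{real_inner, complete_space} \<times> 'h) set"
  assumes sa: "self_adjoint_op A" and "nonneg_op A"
  shows "\<exists>R. is_resolvent A R"
proof -
  have sub: "subspace A" and sv: "single_valued A" and dense: "closure (Domain A) = UNIV"
    and adj: "adjoint_op A = A"
    using sa by (auto simp: self_adjoint_op_def)
  have nn: "0 \<le> y \<bullet> x" if "(x, y) \<in> A" for x y
    using assms(2) that by (auto simp: nonneg_op_def)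
  have add: "(x + x', y + y') \<in> A" if "(x, y) \<in> A" "(x', y') \<in> A" for x x' y y'
    using subspace_add[OF sub that] by simp
  have scale: "(c *\<^sub>R x, c *\<^sub>R y) \<in> A" if "(x, y) \<in> A" for x y c
    using subspace_scale[OF sub that, of c] by simp
  have diff: "(x - x', y - y') \<in> A" if "(x, y) \<in> A" "(x', y') \<in> A" for x x' y y'
    using subspace_diff[OF sub that] by simp
  have coer: "(norm x)\<^sup>2 + (norm y)\<^sup>2 \<le> (norm (x + y))\<^sup>2" if "(x, y) \<in> A" for x y
    using nn[OF that] by (simp add: power2_norm_eq_inner inner_add_left inner_add_right inner_commute)
  have coer1: "norm x \<le> norm (x + y)" "norm y \<le> norm (x + y)" if "(x, y) \<in> A" for x y
  proof -
    have "(norm x)\<^sup>2 \<le> (norm (x + y))\<^sup>2" "(norm y)\<^sup>2 \<le> (norm (x + y))\<^sup>2"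
      using coer[OF that] zero_le_power2[of "norm x"] zero_le_power2[of "norm y"] by linarith+
    then show "norm x \<le> norm (x + y)" "norm y \<le> norm (x + y)"
      by (metis norm_ge_zero power2_le_imp_le)+
  qed
  define M where "M = (\<lambda>(x, y). x + y) ` A"
  have "M = UNIV"
  proof (rule closed_subspace_eq_UNIV)
    show "subspace M"
      unfolding M_def by (rule linear_subspace_image[OF _ sub])
         (auto simp: linear_iff algebra_simps)
    show "closed M"
      unfolding closed_sequential_limits
    proof (intro allI impI, elim conjE)
      fix w l assume w: "\<forall>n. w n \<in> M" and l: "w \<longlonglongrightarrow> l"
      have "\<forall>n. \<exists>x y. (x, y) \<in> A \<and> w n = x + y" using w unfolding M_def by fast
      then obtain x y where xy: "\<And>n. (x n, y n) \<in> A" "\<And>n. w n = x n + y n" by metis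
      have cw: "Cauchy w" using l LIMSEQ_imp_Cauchy by blast
      have d: "norm (x m - x n) \<le> norm (w m - w n)" "norm (y m - y n) \<le> norm (w m - w n)" for m n
        using coer1[OF diff[OF xy(1)[of m] xy(1)[of n]]] by (simp_all add: xy(2) algebra_simps)
      have "Cauchy x" "Cauchy y"
        using cw d unfolding Cauchy_iff by (meson order_le_less_trans)+
      then obtain a b where ab: "x \<longlonglongrightarrow> a" "y \<longlonglongrightarrow> b" using Cauchy_convergent convergent_def by metis
      then have "(a, b) \<in> A" by (rule self_adjoint_closed[OF sa, of x y, OF xy(1)])
      moreover have "w = (\<lambda>n. x n + y n)" using xy(2) by auto
      then have "l = a + b" using LIMSEQ_unique[OF _ tendsto_add[OF ab]] l by simp
      ultimately show "l \<in> M" by (auto simp: M_def)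
    qed
    fix y assume o: "\<And>x. x \<in> M \<Longrightarrow> x \<bullet> y = 0"
    have "(y, - y) \<in> adjoint_op A"
      unfolding adjoint_op_def
    proof (clarsimp)
      fix p q assume "(p, q) \<in> A"
      then have "(p + q) \<bullet> y = 0" using o by (force simp: M_def)
      then show "q \<bullet> y = - (p \<bullet> y)" by (simp add: inner_add_left)
    qed
    then have "0 \<le> - y \<bullet> y" using adj nn by blast
    then show "y = 0" by (metis inner_eq_zero_iff inner_ge_zero inner_minus_left neg_0_le_iff_le order_antisym_conv)
  qed
  then have "\<exists>x. (x, w - x) \<in> A" for w
  proof -
    have "w \<in> M" using \<open>M = UNIV\<close> by simp
    then obtain x y where "(x, y) \<in> A" "w = x + y" by (auto simp: M_def)
    then show ?thesis by (intro exI[of _ x]) simp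
  qed
  then obtain R where R: "\<And>w. (R w, w - R w) \<in> A" by metis
  have uniq: "x = R w" if "(x, w - x) \<in> A" for x w
    using coer1(1)[OF diff[OF that R[of w]]] by simp
  have Radd: "R (v + w) = R v + R w" for v w
    by (rule uniq[symmetric]) (use add[OF R[of v] R[of w]] in \<open>simp add: algebra_simps\<close>)
  have Rscale: "R (c *\<^sub>R w) = c *\<^sub>R R w" for c w
    by (rule uniq[symmetric]) (use scale[OF R[of w], of c] in \<open>simp add: algebra_simps\<close>)
  have Rnorm: "norm (R w) \<le> norm w * 1" for w using coer1(1)[OF R[of w]] by simp
  have bl: "bounded_linear R" by (rule bounded_linear_intro[OF Radd Rscale Rnorm])
  have nnR: "0 \<le> (x - R x) \<bullet> R x" for x by (rule nn[OF R])
  have "unit_interval_op R"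
  proof (rule unit_interval_op.intro)
    show "bounded_linear R" by (rule bl)
    fix x y
    have "(R y, y - R y) \<in> adjoint_op A" using R[of y] adj by simp
    then have "(x - R x) \<bullet> R y = R x \<bullet> (y - R y)" by (rule adjoint_opD[OF _ R[of x]])
    then show "R x \<bullet> y = x \<bullet> R y" by (simp add: inner_diff_left inner_diff_right)
    show "0 \<le> R x \<bullet> x"
      using nnR[of x] inner_ge_zero[of "R x"] unfolding inner_diff_left inner_commute[of x] by linarith
    have "(x - R x) \<bullet> (x - R x) \<ge> 0" by simp
    then show "R x \<bullet> x \<le> x \<bullet> x"
      using nnR[of x] by (simp add: inner_diff_left inner_diff_right inner_commute)
  qed
  moreover have eq: "A = range (\<lambda>z. (R z, z - R z))"
  proof (intro equalityI subsetI)
    fix p assume p: "p \<in> A"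
    obtain x y where xy: "p = (x, y)" by (cases p)
    have "x = R (x + y)" by (rule uniq) (use p xy in simp)
    then have "p = (R (x + y), (x + y) - R (x + y))" using xy by simp
    then show "p \<in> range (\<lambda>z. (R z, z - R z))" by blast
  qed (use R in auto)
  moreover have "closure (range R) = UNIV"
  proof -
    have "Domain A = range R" by (subst eq) auto
    then show ?thesis using dense by simp
  qed
  moreover have "inj R"
  proof (rule injI)
    fix x y assume e: "R x = R y"
    then show "x = y" using sv R[of x] R[of y] unfolding single_valued_def
      by (metis diff_add_cancel)
  qed
  ultimately show ?thesis unfolding is_resolvent_def by blast
qed

text \<open>The resolvent of A is used here, that of the square root later on. Both symbols sqrt r
  and sqrt (1 - r) are continuous and their squares sum to 1; describing the graph as the set of
  pairs (S z, C z) avoids dividing by S.\<close>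

lemma sqrt_exists:
  fixes A :: "('h::{real_inner, complete_space} \<times> 'h) set"
  assumes "self_adjoint_op A" and "nonneg_op A"
  shows "\<exists>B. self_adjoint_op B \<and> nonneg_op B \<and> B O B = A"
proof -
  obtain R where "is_resolvent A R" using resolvent_exists[OF assms] by blast
  then have uio: "unit_interval_op R" and A: "A = range (\<lambda>z. (R z, z - R z))"
    and dense: "closure (range R) = UNIV" and inj: "inj R"
    by (auto simp: is_resolvent_def)
  interpret unit_interval_op R by (rule uio)
  define S where "S = Phi (\<lambda>t. sqrt t)"
  define C where "C = Phi (\<lambda>t. sqrt (1 - t))"
  have c: "continuous_on {0..1} (\<lambda>t. sqrt t)" "continuous_on {0..1} (\<lambda>t. sqrt (1 - t))"
    "continuous_on {0..1} (\<lambda>t::real. t)" "continuous_on {0..1} (\<lambda>t. 1::real)"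
    by (auto intro!: continuous_intros)
  have SS: "S (S x) = R x" for x
  proof -
    have "Phi (\<lambda>t. sqrt t * sqrt t) = Phi (\<lambda>t. t)"
      by (rule Phi_cong) (auto intro!: continuous_intros)
    then show ?thesis by (metis S_def Phi_mult[OF c(1) c(1)] Phi_id)
  qed
  have CC: "C (C x) = x - R x" for x
  proof -
    have "Phi (\<lambda>t. sqrt (1 - t) * sqrt (1 - t)) = Phi (\<lambda>t. 1 - t)"
      by (rule Phi_cong) (auto intro!: continuous_intros)
    then show ?thesis by (metis C_def Phi_mult[OF c(2) c(2)] Phi_diff[OF c(4) c(3)] Phi_id Phi_1)
  qed
  have SC: "S (C x) = C (S x)" for x
    unfolding S_def C_def Phi_mult[OF c(1) c(2), symmetric] Phi_mult[OF c(2) c(1), symmetric]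
    by (simp add: mult.commute)
  have symS: "S x \<bullet> y = x \<bullet> S y" and symC: "C x \<bullet> y = x \<bullet> C y" for x y
    unfolding S_def C_def by (rule Phi_sym[OF c(1)], rule Phi_sym[OF c(2)])
  \<comment> \<open>As \<open>A = (1 - R) / R\<close>, its square root is \<open>C / S\<close>.\<close>
  define B where "B = range (\<lambda>z. (S z, C z))"
  have B_iff: "(x, y) \<in> B \<longleftrightarrow> C x = S y" for x y
  proof
    assume "(x, y) \<in> B"
    then show "C x = S y" by (auto simp: B_def SC)
  next
    assume e: "C x = S y"
    \<comment> \<open>Since S^2 + C^2 = 1, the parameter of a pair with C x = S y is S x + C y. The
      description by this equation reduces self-adjointness and single-valuedness to short
      computations.\<close>
    define z where "z = S x + C y"
    have "S z = S (S x) + C (S y)" by (simp add: z_def blinfun.add_right SC)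
    then have "S z = x" by (simp add: e[symmetric] SS CC)
    moreover have "C z = S (C x) + C (C y)" by (simp add: z_def blinfun.add_right SC)
    then have "C z = y" by (simp add: e SS CC)
    ultimately have "(x, y) = (S z, C z)" by simp
    then show "(x, y) \<in> B" unfolding B_def by (rule range_eqI)
  qed
  have Sinj: "x = 0" if "S x = 0" for x
  proof -
    have "R x = R 0" using SS[of x] SS[of 0] that by simp
    then show ?thesis using inj by (simp add: inj_eq)
  qed
  have "self_adjoint_op B"
    unfolding self_adjoint_op_def
  proof (intro conjI)
    show "subspace B"
      by (auto simp: subspace_def B_iff blinfun.add_right blinfun.scaleR_right zero_prod_def)
    show "single_valued B"
    proof (rule single_valuedI)
      fix x y z assume "(x, y) \<in> B" "(x, z) \<in> B"
      then have "S (y - z) = 0" by (simp add: B_iff blinfun.diff_right)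
      then show "y = z" using Sinj by fastforce
    qed
    have "(S (S x), C (S x)) \<in> B" for x unfolding B_def by blast
    then have "range R \<subseteq> Domain B" unfolding SS by blast
    then show "closure (Domain B) = UNIV" using dense closure_mono by blast
    have "(y, z) \<in> adjoint_op B \<longleftrightarrow> (y, z) \<in> B" for y z
    proof -
      have "(y, z) \<in> adjoint_op B \<longleftrightarrow> (\<forall>v. v \<bullet> (C y - S z) = 0)"
        by (simp add: adjoint_op_def B_def symS symC inner_diff_right)
      also have "\<dots> \<longleftrightarrow> (y, z) \<in> B"
        by (metis B_iff eq_iff_diff_eq_0 inner_eq_zero_iff inner_zero_right)
      finally show ?thesis .
    qed
    then show "adjoint_op B = B" by auto
  qed
  moreover have "nonneg_op B"
  proof -
    have "0 \<le> C z \<bullet> S z" for z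
    proof -
      have "C z \<bullet> S z = Phi (\<lambda>t. sqrt t * sqrt (1 - t)) z \<bullet> z"
        unfolding Phi_mult[OF c(1,2)] by (simp add: symS S_def[symmetric] C_def[symmetric])
      also have "\<dots> \<ge> 0" by (rule Phi_nonneg) (auto intro!: continuous_intros)
      finally show ?thesis .
    qed
    then show ?thesis by (auto simp: nonneg_op_def B_def)
  qed
  moreover have "B O B = A"
  proof (intro equalityI subsetI)
    fix p assume "p \<in> B O B"
    then obtain x y u where p: "p = (x, u)" "(x, y) \<in> B" "(y, u) \<in> B" by blast
    obtain z where z: "x = S z" "y = C z" using p(2) unfolding B_def by blast
    obtain z' where z': "y = S z'" "u = C z'" using p(3) unfolding B_def by blast
    \<comment> \<open>The two parametrizations of the intermediate vector agree, which puts (z, z')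
      itself into B; this produces one v with x = S (S v) and u = C (C v).\<close>
    have "C z = S z'" using z(2) z'(1) by (rule subst)
    then have "(z, z') \<in> B" by (simp add: B_iff)
    then obtain v where "z = S v" "z' = C v" unfolding B_def by blast
    then show "p \<in> A" using p(1) z(1) z'(2) by (simp add: A SS CC)
  next
    fix p assume "p \<in> A"
    then obtain v where "p = (S (S v), C (C v))" by (auto simp: A SS CC)
    moreover have "(S (S v), C (S v)) \<in> B" unfolding B_def by blast
    moreover have "(S (C v), C (C v)) \<in> B" unfolding B_def by blast
    then have "(C (S v), C (C v)) \<in> B" by (simp only: SC)
    ultimately show "p \<in> B O B" by blast
  qed
  ultimately show ?thesis by blast
qed

lemma sqrt_op:
  fixes A :: "('h::{real_inner, complete_space} \<times> 'h) set"
  assumes "self_adjoint_op A" and "nonneg_op A"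
  shows "self_adjoint_op (sqrt_op A)" "nonneg_op (sqrt_op A)"
  using someI_ex[OF sqrt_exists[OF assms]] by (auto simp: sqrt_op_def)

section \<open>Fundamental solutions of the component equations\<close>

locale bounded_coefficient =
  fixes q :: "real \<Rightarrow> real" and C :: real
  assumes q_cont: "continuous_on {0<..} q" and q_le: "\<bar>q t\<bar> \<le> C"
begin

lemma C_nonneg: "C \<ge> 0" using q_le[of 0] by auto

text \<open>Continuity can fail only at 0. Measurability on the open half-line and boundedness give
  integrability, and the single point is a null set.\<close>

lemma q_mult_integrable:
  assumes f: "continuous_on {0..} f" and "0 \<le> a"
  shows "(\<lambda>r. q r * f r) integrable_on {a..b}"
proof -
  let ?g = "\<lambda>r. indicator {0<..} r *\<^sub>R (q r * f r)"
  have m: "?g \<in> borel_measurable borel"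
    by (rule borel_measurable_continuous_on_indicator)
       (auto intro!: continuous_on_mult[OF q_cont continuous_on_subset[OF f]])
  have "bounded (f ` {a..b})"
    using assms by (intro compact_imp_bounded compact_continuous_image continuous_on_subset[OF f]) auto
  then obtain M where M: "\<And>r. r \<in> {a..b} \<Longrightarrow> \<bar>f r\<bar> \<le> M"
    unfolding bounded_iff real_norm_def by blast
  have "integrable lborel (\<lambda>r. indicator {a..b} r *\<^sub>R ?g r)"
  proof (rule integrableI_bounded_set_indicator)
    show "AE x in lborel. x \<in> {a..b} \<longrightarrow> norm (?g x) \<le> C * M"
    proof (intro AE_I2 impI)
      fix x assume "x \<in> {a..b}"
      then have "\<bar>q x\<bar> * \<bar>f x\<bar> \<le> C * M" by (intro mult_mono q_le M C_nonneg) auto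
      moreover then have "0 \<le> C * M" by (meson abs_ge_zero mult_nonneg_nonneg order_trans)
      ultimately show "norm (?g x) \<le> C * M" by (auto simp: abs_mult indicator_def)
    qed
  qed (use m in \<open>auto simp: emeasure_lborel_Icc_eq\<close>)
  then have "?g integrable_on {a..b}"
    using set_borel_integral_eq_integral(1)[of "{a..b}" ?g] by (simp add: set_integrable_def)
  then show ?thesis
    by (rule integrable_spike[of _ _ "{0}"]) (use assms in auto)
qed

definition J :: "(real \<Rightarrow> real) \<Rightarrow> real \<Rightarrow> real" where
  "J f t = integral {0..t} (\<lambda>r. q r * f r)"

lemma J_continuous:
  assumes "continuous_on {0..} f"
  shows "continuous_on {0..} (J f)"
proof -
  have "continuous (at x within {0..}) (J f)" if x: "x \<ge> 0" for x
  proof -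
    have "continuous_on {0..x+1} (J f)"
      unfolding J_def by (rule indefinite_integral_continuous_1[OF q_mult_integrable[OF assms]]) simp
    then have "continuous (at x within {0..x+1}) (J f)" using x by (simp add: continuous_on_eq_continuous_within)
    moreover have "at x within {0..x+1} = at x within {0..}"
      by (rule at_within_nhd[of _ "{x-1<..<x+1}"]) auto
    ultimately show ?thesis by simp
  qed
  then show ?thesis by (simp add: continuous_on_eq_continuous_within)
qed

lemma J_deriv:
  assumes f: "continuous_on {0..} f" and t: "t > 0"
  shows "(J f has_real_derivative q t * f t) (at t)"
proof -
  let ?g = "\<lambda>r. q r * f r"
  \<comment> \<open>Splitting at t/2 keeps the variable endpoint away from 0, where q may
    jump.\<close>
  have "continuous_on {t/2..t+1} ?g"
    using t by (intro continuous_on_mult continuous_on_subset[OF q_cont] continuous_on_subset[OF f]) auto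
  then have "((\<lambda>u. integral {t/2..u} ?g) has_real_derivative ?g t) (at t within {t/2..t+1})"
    using t by (intro integral_has_real_derivative) auto
  moreover have "at t within {t/2..t+1} = at t"
    using t by (intro at_within_interior) auto
  ultimately have "((\<lambda>u. integral {0..t/2} ?g + integral {t/2..u} ?g) has_real_derivative ?g t) (at t)"
    by (auto intro!: derivative_eq_intros)
  then show ?thesis
  proof (rule has_field_derivative_transform_within_open[of _ _ _ "{t/2<..}"])
    fix u assume "u \<in> {t/2<..}"
    then show "integral {0..t/2} ?g + integral {t/2..u} ?g = J f u"
      unfolding J_def using t by (intro Henstock_Kurzweil_Integration.integral_combine q_mult_integrable[OF f]) auto
  qed (use t in auto)
qed

lemma J_bound:
  assumes f: "continuous_on {0..} f" and t: "t \<ge> 0" and M: "\<And>r. 0 \<le> r \<Longrightarrow> r \<le> t \<Longrightarrow> \<bar>f r\<bar> \<le> M"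
  shows "\<bar>J f t\<bar> \<le> C * M * t"
proof -
  have "M \<ge> 0" using M[of 0] t by auto
  have "((\<lambda>r. q r * f r) has_integral J f t) (cbox 0 t)"
    unfolding J_def cbox_interval by (intro integrable_integral q_mult_integrable[OF f]) simp
  then have "norm (J f t) \<le> (C * M) * measure lborel (cbox 0 t)"
  proof (rule has_integral_bound[rotated])
    fix x assume "x \<in> cbox 0 t"
    then show "norm (q x * f x) \<le> C * M"
      by (auto simp: abs_mult intro!: mult_mono q_le M C_nonneg)
  qed (use C_nonneg \<open>M \<ge> 0\<close> in auto)
  then show ?thesis using t by simp
qed

text \<open>The solutions of \<open>w'' = - q l w\<close> are power series in \<open>l\<close> with coefficients \<open>coef\<close>. They are obtained by
  integration because \<open>q\<close> is not assumed to have a limit at \<open>0\<close>.\<close>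

primrec coef :: "real \<Rightarrow> real \<Rightarrow> nat \<Rightarrow> real \<Rightarrow> real" where
  "coef \<alpha> \<beta> 0 = (\<lambda>t. \<alpha> + \<beta> * t)"
| "coef \<alpha> \<beta> (Suc k) = (\<lambda>t. - integral {0..t} (J (coef \<alpha> \<beta> k)))"

definition dcoef :: "real \<Rightarrow> real \<Rightarrow> nat \<Rightarrow> real \<Rightarrow> real" where
  "dcoef \<alpha> \<beta> k t = (case k of 0 \<Rightarrow> \<beta> | Suc j \<Rightarrow> - J (coef \<alpha> \<beta> j) t)"

lemma integral_deriv:
  assumes "continuous_on {0..} f" "t \<ge> 0"
  shows "((\<lambda>u. integral {0..u} f) has_real_derivative f t) (at t within {0..})"
proof -
  have "continuous_on {0..t+1} f" by (rule continuous_on_subset[OF assms(1)]) auto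
  then have "((\<lambda>u. integral {0..u} f) has_real_derivative f t) (at t within {0..t+1})"
    using assms(2) by (intro integral_has_real_derivative) auto
  moreover have "at t within {0..t+1} = at t within {0..}"
    by (rule at_within_nhd[of _ "{t-1<..<t+1}"]) auto
  ultimately show ?thesis by simp
qed

lemma coef_continuous: "continuous_on {0..} (coef \<alpha> \<beta> k)"
proof (induction k)
  case 0
  show ?case by (auto intro!: continuous_intros)
next
  case (Suc k)
  have "(coef \<alpha> \<beta> (Suc k) has_real_derivative - J (coef \<alpha> \<beta> k) t) (at t within {0..})" if "t \<ge> 0" for t
    using DERIV_minus[OF integral_deriv[OF J_continuous[OF Suc] that]] by simp
  then show ?case
    by (metis DERIV_continuous atLeast_iff continuous_on_eq_continuous_within)
qed

lemma coef_deriv: "t \<ge> 0 \<Longrightarrow> (coef \<alpha> \<beta> k has_real_derivative dcoef \<alpha> \<beta> k t) (at t within {0..})"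
proof (cases k)
  case 0
  then show ?thesis by (auto simp: dcoef_def intro!: derivative_eq_intros)
next
  case (Suc j)
  assume "t \<ge> 0"
  from DERIV_minus[OF integral_deriv[OF J_continuous[OF coef_continuous] this]] show ?thesis
    by (simp add: Suc dcoef_def)
qed

lemma dcoef_deriv:
  "t > 0 \<Longrightarrow> (dcoef \<alpha> \<beta> k has_real_derivative (case k of 0 \<Rightarrow> 0 | Suc j \<Rightarrow> - (q t * coef \<alpha> \<beta> j t))) (at t)"
  using DERIV_minus[OF J_deriv[OF coef_continuous]]
  by (cases k) (auto simp: dcoef_def[abs_def])

lemma dcoef_continuous: "continuous_on {0..} (dcoef \<alpha> \<beta> k)"
  using continuous_on_minus[OF J_continuous[OF coef_continuous]]
  by (cases k) (auto simp: dcoef_def[abs_def])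

section \<open>Majorants and convergence of the series in the spectral parameter\<close>

context
  fixes T \<alpha> \<beta> P :: real
  assumes T: "T > 0"
  defines "P \<equiv> \<bar>\<alpha>\<bar> + \<bar>\<beta>\<bar> * T"
begin

lemma P_nonneg: "P \<ge> 0" using T by (simp add: P_def)

text \<open>Each step integrates twice. The inner integration is estimated crudely by the factor C
  T, the outer one raises the power of t and the factorial; one factorial per step already makes the
  series converge for every l.\<close>

lemma coef_bound:
  "0 \<le> t \<Longrightarrow> t \<le> T \<Longrightarrow> \<bar>coef \<alpha> \<beta> k t\<bar> \<le> P * (C * T) ^ k * (t ^ k / fact k)"
proof (induction k arbitrary: t)
  case 0
  have "\<bar>\<beta> * t\<bar> \<le> \<bar>\<beta>\<bar> * T" using 0 by (simp add: abs_mult mult_left_mono)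
  then show ?case using abs_triangle_ineq[of \<alpha> "\<beta> * t"] by (simp add: P_def)
next
  case (Suc k)
  let ?K = "P * (C * T) ^ Suc k"
  have K: "?K \<ge> 0" using P_nonneg C_nonneg T by (intro mult_nonneg_nonneg) auto
  have bound: "\<bar>J (coef \<alpha> \<beta> k) s\<bar> \<le> ?K * (s ^ k / fact k)" if s: "s \<in> {0..t}" for s
  proof -
    have "\<bar>J (coef \<alpha> \<beta> k) s\<bar> \<le> C * (P * (C * T) ^ k * (s ^ k / fact k)) * s"
    proof (rule J_bound[OF coef_continuous])
      fix r assume r: "0 \<le> r" "r \<le> s"
      have "\<bar>coef \<alpha> \<beta> k r\<bar> \<le> P * (C * T) ^ k * (r ^ k / fact k)" using r s Suc by auto
      also have "\<dots> \<le> P * (C * T) ^ k * (s ^ k / fact k)"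
        using r P_nonneg C_nonneg T by (intro mult_left_mono divide_right_mono power_mono mult_nonneg_nonneg) auto
      finally show "\<bar>coef \<alpha> \<beta> k r\<bar> \<le> P * (C * T) ^ k * (s ^ k / fact k)" .
    qed (use s in auto)
    also have "\<dots> \<le> C * (P * (C * T) ^ k * (s ^ k / fact k)) * T"
      using s Suc.prems P_nonneg C_nonneg T by (intro mult_left_mono mult_nonneg_nonneg) auto
    finally show ?thesis by (simp add: mult_ac)
  qed
  have "((\<lambda>s. ?K * (s ^ k / fact k)) has_integral ?K * (t ^ Suc k / fact (Suc k)) - ?K * (0 ^ Suc k / fact (Suc k))) {0..t}"
  proof (rule fundamental_theorem_of_calculus)
    fix x
    have "((\<lambda>s. s ^ Suc k / fact (Suc k)) has_real_derivative x ^ k / fact k) (at x within {0..t})"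
      using DERIV_cdivide[OF DERIV_pow[of "Suc k" x], of "fact (Suc k)"] by (simp add: fact_Suc del: of_nat_Suc)
    from DERIV_cmult[OF this, of ?K]
    show "((\<lambda>s. ?K * (s ^ Suc k / fact (Suc k))) has_vector_derivative ?K * (x ^ k / fact k)) (at x within {0..t})"
      by (simp only: has_real_derivative_iff_has_vector_derivative)
  qed (use Suc.prems in simp)
  then have hi: "((\<lambda>s. ?K * (s ^ k / fact k)) has_integral ?K * (t ^ Suc k / fact (Suc k))) {0..t}" by simp
  have "norm (integral {0..t} (J (coef \<alpha> \<beta> k))) \<le> integral {0..t} (\<lambda>s. ?K * (s ^ k / fact k))"
  proof (rule integral_norm_bound_integral)
    show "J (coef \<alpha> \<beta> k) integrable_on {0..t}"
      by (intro integrable_continuous_real continuous_on_subset[OF J_continuous[OF coef_continuous]]) auto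
    show "(\<lambda>s. ?K * (s ^ k / fact k)) integrable_on {0..t}" using hi by blast
  qed (use bound in auto)
  then show ?case using integral_unique[OF hi] by simp
qed

lemma coef_bound':
  assumes "0 \<le> t" "t \<le> T"
  shows "\<bar>coef \<alpha> \<beta> k t\<bar> \<le> P * ((C * T * T) ^ k / fact k)"
proof -
  have "\<bar>coef \<alpha> \<beta> k t\<bar> \<le> P * (C * T) ^ k * (t ^ k / fact k)" by (rule coef_bound[OF assms])
  also have "\<dots> \<le> P * (C * T) ^ k * (T ^ k / fact k)"
    using assms P_nonneg C_nonneg T by (intro mult_left_mono divide_right_mono power_mono mult_nonneg_nonneg) auto
  finally show ?thesis by (simp add: power_mult_distrib mult_ac)
qed

lemma dcoef_bound:
  assumes "0 \<le> t" "t \<le> T"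
  shows "\<bar>dcoef \<alpha> \<beta> (Suc k) t\<bar> \<le> C * T * P * ((C * T * T) ^ k / fact k)"
proof -
  have "\<bar>J (coef \<alpha> \<beta> k) t\<bar> \<le> C * (P * ((C * T * T) ^ k / fact k)) * t"
    using assms coef_bound' by (intro J_bound coef_continuous) auto
  also have "\<dots> \<le> C * (P * ((C * T * T) ^ k / fact k)) * T"
    using assms P_nonneg C_nonneg T by (intro mult_left_mono mult_nonneg_nonneg) auto
  finally show ?thesis by (simp add: dcoef_def mult_ac)
qed

lemma summable_majorant: "summable (\<lambda>k. K * (x ^ k / fact k :: real))"
  using summable_exp[of x] by (intro summable_mult) (simp add: divide_inverse mult.commute)

context
  fixes \<Lambda> :: real
  assumes \<Lambda>: "\<Lambda> \<ge> 0"
begin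

lemma term_bound:
  assumes "0 \<le> t" "t \<le> T" "0 \<le> l" "l \<le> \<Lambda>"
  shows "\<bar>l ^ k * coef \<alpha> \<beta> k t\<bar> \<le> P * ((\<Lambda> * (C * T * T)) ^ k / fact k)"
proof -
  have "l ^ k * \<bar>coef \<alpha> \<beta> k t\<bar> \<le> \<Lambda> ^ k * (P * ((C * T * T) ^ k / fact k))"
    using assms coef_bound'[of t k] P_nonneg \<Lambda> by (intro mult_mono power_mono) auto
  then show ?thesis using assms by (simp add: abs_mult power_mult_distrib mult_ac)
qed

lemma summable_terms:
  assumes "0 \<le> t" "t \<le> T" "0 \<le> l" "l \<le> \<Lambda>"
  shows "summable (\<lambda>k. l ^ k * coef \<alpha> \<beta> k t)"
  by (rule summable_comparison_test'[OF summable_majorant[of P "\<Lambda> * (C * T * T)"], of 0])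
     (use term_bound[OF assms] in simp)

lemma dterm_bound:
  assumes "0 \<le> t" "t \<le> T" "0 \<le> l" "l \<le> \<Lambda>"
  shows "\<bar>l ^ Suc k * dcoef \<alpha> \<beta> (Suc k) t\<bar> \<le> (\<Lambda> * (C * T * P)) * ((\<Lambda> * (C * T * T)) ^ k / fact k)"
proof -
  have "l ^ Suc k * \<bar>dcoef \<alpha> \<beta> (Suc k) t\<bar> \<le> \<Lambda> ^ Suc k * (C * T * P * ((C * T * T) ^ k / fact k))"
    using assms dcoef_bound[of t k] P_nonneg \<Lambda> by (intro mult_mono power_mono) auto
  then show ?thesis using assms by (simp add: abs_mult power_mult_distrib mult_ac)
qed

definition dmaj :: "nat \<Rightarrow> real" where
  "dmaj k = (case k of 0 \<Rightarrow> \<bar>\<beta>\<bar> | Suc j \<Rightarrow> (\<Lambda> * (C * T * P)) * ((\<Lambda> * (C * T * T)) ^ j / fact j))"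

lemma dmaj: "summable dmaj"
  "\<And>t l. 0 \<le> t \<Longrightarrow> t \<le> T \<Longrightarrow> 0 \<le> l \<Longrightarrow> l \<le> \<Lambda> \<Longrightarrow> \<bar>l ^ k * dcoef \<alpha> \<beta> k t\<bar> \<le> dmaj k"
proof -
  have "summable (\<lambda>k. dmaj (Suc k))" unfolding dmaj_def nat.case by (rule summable_majorant)
  then show "summable dmaj" by (simp add: summable_Suc_iff)
  show "\<bar>l ^ k * dcoef \<alpha> \<beta> k t\<bar> \<le> dmaj k" if "0 \<le> t" "t \<le> T" "0 \<le> l" "l \<le> \<Lambda>" for t l
    using dterm_bound[OF that, of "k - 1"] by (cases k) (auto simp: dmaj_def dcoef_def)
qed

definition w :: "real \<Rightarrow> real \<Rightarrow> real" where "w t l = (\<Sum>k. l ^ k * coef \<alpha> \<beta> k t)"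
definition w' :: "real \<Rightarrow> real \<Rightarrow> real" where "w' t l = (\<Sum>k. l ^ k * dcoef \<alpha> \<beta> k t)"

text \<open>Joint continuity is what the functional calculus asks for: with l = (h r)^2 it gives
  symbols continuous in r, uniformly in time.\<close>

lemma w_continuous: "continuous_on ({0..T} \<times> {0..\<Lambda>}) (\<lambda>(t, l). w t l)"
proof -
  have "uniform_limit ({0..T} \<times> {0..\<Lambda>}) (\<lambda>n x. \<Sum>k<n. snd x ^ k * coef \<alpha> \<beta> k (fst x))
      (\<lambda>x. \<Sum>k. snd x ^ k * coef \<alpha> \<beta> k (fst x)) sequentially"
    by (rule Weierstrass_m_test[OF _ summable_majorant[of P "\<Lambda> * (C * T * T)"]])
       (auto intro!: term_bound simp del: times_divide_eq_right)
  then have "continuous_on ({0..T} \<times> {0..\<Lambda>}) (\<lambda>x. \<Sum>k. snd x ^ k * coef \<alpha> \<beta> k (fst x))"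
    by (rule uniform_limit_theorem[rotated])
       (auto intro!: always_eventually continuous_intros continuous_on_compose2[OF coef_continuous])
  then show ?thesis by (simp add: w_def case_prod_unfold)
qed

lemma w'_continuous: "continuous_on ({0..T} \<times> {0..\<Lambda>}) (\<lambda>(t, l). w' t l)"
proof -
  have "uniform_limit ({0..T} \<times> {0..\<Lambda>}) (\<lambda>n x. \<Sum>k<n. snd x ^ k * dcoef \<alpha> \<beta> k (fst x))
      (\<lambda>x. \<Sum>k. snd x ^ k * dcoef \<alpha> \<beta> k (fst x)) sequentially"
    by (rule Weierstrass_m_test[OF _ dmaj(1)]) (auto intro!: dmaj(2))
  then have "continuous_on ({0..T} \<times> {0..\<Lambda>}) (\<lambda>x. \<Sum>k. snd x ^ k * dcoef \<alpha> \<beta> k (fst x))"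
    by (rule uniform_limit_theorem[rotated])
       (auto intro!: always_eventually continuous_intros continuous_on_compose2[OF dcoef_continuous])
  then show ?thesis by (simp add: w'_def case_prod_unfold)
qed

lemma w_deriv:
  assumes "0 \<le> t" "t \<le> T" "0 \<le> l" "l \<le> \<Lambda>"
  shows "((\<lambda>t. w t l) has_real_derivative w' t l) (at t within {0..T})"
proof -
  have "\<exists>g. \<forall>x\<in>{0..T}. (\<lambda>k. l ^ k * coef \<alpha> \<beta> k x) sums g x \<and>
      (g has_field_derivative w' x l) (at x within {0..T})"
  proof (rule has_field_derivative_series)
    show "((\<lambda>t. l ^ k * coef \<alpha> \<beta> k t) has_field_derivative l ^ k * dcoef \<alpha> \<beta> k x) (at x within {0..T})"
      if "x \<in> {0..T}" for k x
      using that by (intro DERIV_cmult has_field_derivative_subset[OF coef_deriv]) auto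
    show "uniform_limit {0..T} (\<lambda>n x. \<Sum>k<n. l ^ k * dcoef \<alpha> \<beta> k x) (\<lambda>x. w' x l) sequentially"
      unfolding w'_def by (rule Weierstrass_m_test[OF _ dmaj(1)]) (use assms in \<open>auto intro!: dmaj(2)\<close>)
    show "summable (\<lambda>k. l ^ k * coef \<alpha> \<beta> k 0)" using assms T by (intro summable_terms) auto
  qed (use T in auto)
  then obtain g where g0: "\<forall>x\<in>{0..T}. (\<lambda>k. l ^ k * coef \<alpha> \<beta> k x) sums g x \<and>
      (g has_field_derivative w' x l) (at x within {0..T})" ..
  have g: "g x = w x l" "(g has_field_derivative w' x l) (at x within {0..T})" if "x \<in> {0..T}" for x
    using bspec[OF g0 that] by (auto simp: w_def dest: sums_unique)
  have t: "t \<in> {0..T}" using assms by auto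
  show ?thesis by (rule has_field_derivative_transform_within[OF g(2)[OF t] zero_less_one t]) (simp add: g(1))
qed

lemma w'_deriv:
  assumes "0 < t" "t < T" "0 \<le> l" "l \<le> \<Lambda>"
  shows "((\<lambda>t. w' t l) has_real_derivative - (q t * l * w t l)) (at t)"
proof -
  \<comment> \<open>The derivative of \<open>dcoef\<close>. Shifting the index by one, l^(k+1) times
    this is - q l times the k-th term of w, which is the differential equation.\<close>
  define e where "e k x = (case k of 0 \<Rightarrow> 0 | Suc j \<Rightarrow> - (q x * coef \<alpha> \<beta> j x))" for k x
  define M where "M k = (case k of 0 \<Rightarrow> 0 | Suc j \<Rightarrow> \<Lambda> * C * P * ((\<Lambda> * (C * T * T)) ^ j / fact j))" for k
  have "summable (\<lambda>k. M (Suc k))" unfolding M_def nat.case by (rule summable_majorant)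
  then have M: "summable M" by (simp add: summable_Suc_iff)
  have eM: "\<bar>l ^ k * e k x\<bar> \<le> M k" if "0 < x" "x < T" for k x
  proof (cases k)
    case (Suc j)
    have "\<bar>l ^ j * coef \<alpha> \<beta> j x\<bar> \<le> P * ((\<Lambda> * (C * T * T)) ^ j / fact j)"
      by (rule term_bound) (use that assms in auto)
    then have "l * (\<bar>q x\<bar> * \<bar>l ^ j * coef \<alpha> \<beta> j x\<bar>) \<le> \<Lambda> * (C * (P * ((\<Lambda> * (C * T * T)) ^ j / fact j)))"
      using assms C_nonneg \<Lambda> q_le by (intro mult_mono) auto
    then show ?thesis using assms by (simp add: Suc e_def M_def abs_mult mult_ac)
  qed (simp add: e_def M_def)
  have sum_e: "(\<Sum>k. l ^ k * e k x) = - (q x * l * w x l)" if "0 < x" "x < T" for x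
  proof -
    have s: "(\<lambda>k. l ^ k * coef \<alpha> \<beta> k x) sums w x l"
      unfolding w_def using that assms by (intro summable_sums summable_terms) auto
    then have "(\<lambda>k. - (q x * l) * (l ^ k * coef \<alpha> \<beta> k x)) sums (- (q x * l) * w x l)"
      by (rule sums_mult)
    then have "(\<lambda>k. l ^ Suc k * e (Suc k) x) sums (- (q x * l) * w x l)"
      by (simp add: e_def mult_ac)
    from sums_Suc[OF this] have "(\<lambda>k. l ^ k * e k x) sums (- (q x * l) * w x l)" by (simp add: e_def)
    from sums_unique[OF this] show ?thesis by simp
  qed
  have "\<exists>g. \<forall>x\<in>{0<..<T}. (\<lambda>k. l ^ k * dcoef \<alpha> \<beta> k x) sums g x \<and>
      (g has_field_derivative (\<Sum>k. l ^ k * e k x)) (at x within {0<..<T})"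
  proof (rule has_field_derivative_series)
    show "((\<lambda>t. l ^ k * dcoef \<alpha> \<beta> k t) has_field_derivative l ^ k * e k x) (at x within {0<..<T})"
      if "x \<in> {0<..<T}" for k x
      unfolding e_def by (rule DERIV_cmult[OF has_field_derivative_at_within[OF dcoef_deriv]]) (use that in simp)
    show "uniform_limit {0<..<T} (\<lambda>n x. \<Sum>k<n. l ^ k * e k x) (\<lambda>x. \<Sum>k. l ^ k * e k x) sequentially"
      by (rule Weierstrass_m_test[OF _ M]) (auto intro!: eM)
    show "summable (\<lambda>k. l ^ k * dcoef \<alpha> \<beta> k t)"
      by (rule summable_comparison_test'[OF dmaj(1), of 0]) (use dmaj(2)[of t l] assms in auto)
  qed (use assms in auto)
  then obtain g where g0: "\<forall>x\<in>{0<..<T}. (\<lambda>k. l ^ k * dcoef \<alpha> \<beta> k x) sums g x \<and>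
      (g has_field_derivative (\<Sum>k. l ^ k * e k x)) (at x within {0<..<T})" ..
  have g: "g x = w' x l" "(g has_field_derivative (\<Sum>k. l ^ k * e k x)) (at x within {0<..<T})"
    if "x \<in> {0<..<T}" for x
    using bspec[OF g0 that] by (auto simp: w'_def dest: sums_unique)
  have t: "t \<in> {0<..<T}" using assms by auto
  have "((\<lambda>t. w' t l) has_field_derivative (\<Sum>k. l ^ k * e k t)) (at t within {0<..<T})"
    by (rule has_field_derivative_transform_within[OF g(2)[OF t] zero_less_one t]) (simp add: g(1))
  then show ?thesis using t by (simp add: at_within_open[of t "{0<..<T}"] sum_e)
qed

lemma w_0: "w 0 l = \<alpha>" and w'_0: "w' 0 l = \<beta>"
proof -
  have "coef \<alpha> \<beta> k 0 = (if k = 0 then \<alpha> else 0)" for k by (cases k) auto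
  then have "(\<lambda>k. l ^ k * coef \<alpha> \<beta> k 0) = (\<lambda>k. if k = 0 then \<alpha> else 0)" by auto
  then show "w 0 l = \<alpha>" using sums_single[of 0 "\<lambda>_. \<alpha>"] by (simp add: w_def sums_iff)
  have "dcoef \<alpha> \<beta> k 0 = (if k = 0 then \<beta> else 0)" for k by (cases k) (auto simp: dcoef_def J_def)
  then have "(\<lambda>k. l ^ k * dcoef \<alpha> \<beta> k 0) = (\<lambda>k. if k = 0 then \<beta> else 0)" by auto
  then show "w' 0 l = \<beta>" using sums_single[of 0 "\<lambda>_. \<beta>"] by (simp add: w'_def sums_iff)
qed

end
end

lemma fundamental_solution:
  assumes "T > 0" "\<Lambda> \<ge> 0"
  obtains w w' where
    "continuous_on ({0..T} \<times> {0..\<Lambda>}) (\<lambda>(t, l). w t l)"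
    "continuous_on ({0..T} \<times> {0..\<Lambda>}) (\<lambda>(t, l). w' t l)"
    "\<And>t l. t \<in> {0..T} \<Longrightarrow> l \<in> {0..\<Lambda>} \<Longrightarrow> ((\<lambda>t. w t l) has_real_derivative w' t l) (at t within {0..T})"
    "\<And>t l. t \<in> {0<..<T} \<Longrightarrow> l \<in> {0..\<Lambda>} \<Longrightarrow> ((\<lambda>t. w' t l) has_real_derivative - (q t * l * w t l)) (at t)"
    "\<And>l. w 0 l = \<alpha>" "\<And>l. w' 0 l = \<beta>"
proof (rule that[of "w \<alpha> \<beta>" "w' \<alpha> \<beta>"])
qed (simp_all add: w_continuous[OF assms] w'_continuous[OF assms] w_deriv[OF assms] w'_deriv[OF assms]
    w_0[OF assms] w'_0[OF assms] del: minus_mult_minus)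

end

section \<open>The wave equation with a bounded operator\<close>

lemma continuous_on_slice:
  assumes "continuous_on (I \<times> S) (\<lambda>(s, r). F s r)" "s \<in> I"
  shows "continuous_on S (F s)"
proof -
  have "continuous_on S ((\<lambda>(s, r). F s r) \<circ> Pair s)"
    by (rule continuous_on_compose)
       (auto intro!: continuous_intros continuous_on_subset[OF assms(1)] simp: assms(2))
  then show ?thesis by (simp add: o_def)
qed

text \<open>The sort \<open>{real_inner, complete_space}\<close> is not contained in \<open>banach\<close>, so the library theorems on
  derivatives of limits and integrals do not apply; derivatives are taken weakly instead.\<close>

lemma weak_derivative_imp_strong:
  fixes m F :: "real \<Rightarrow> 'h::real_inner"
  assumes weak: "\<And>y t. t \<in> S \<Longrightarrow> ((\<lambda>s. m s \<bullet> y) has_real_derivative F t \<bullet> y) (at t within S)"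
    and S: "convex S" and F: "continuous_on S F" and t: "t \<in> S"
  shows "(m has_vector_derivative F t) (at t within S)"
  unfolding has_vector_derivative_def has_derivative_within_alt
proof (intro conjI allI impI)
  show "bounded_linear (\<lambda>h. h *\<^sub>R F t)" by (rule bounded_linear_scaleR_left)
  fix e :: real assume e: "e > 0"
  obtain d where d: "d > 0" "\<And>s. s \<in> S \<Longrightarrow> dist s t < d \<Longrightarrow> dist (F s) (F t) < e"
    using F t e unfolding continuous_on_iff by meson
  show "\<exists>d>0. \<forall>y\<in>S. norm (y - t) < d \<longrightarrow> norm (m y - m t - (y - t) *\<^sub>R F t) \<le> e * norm (y - t)"
  proof (intro exI[of _ d] conjI ballI impI d(1))
    fix y assume yS: "y \<in> S" and y: "norm (y - t) < d"
    \<comment> \<open>Testing the remainder with itself: the scalar mean value inequality in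
      direction D gives |D|^2 \<le> e |y - t| |D|.\<close>
    define D where "D = m y - m t - (y - t) *\<^sub>R F t"
    have "norm ((m y \<bullet> D - y * (F t \<bullet> D)) - (m t \<bullet> D - t * (F t \<bullet> D))) \<le> (e * norm D) * norm (y - t)"
    proof (rule field_differentiable_bound[of "S \<inter> ball t d" _ "\<lambda>s. F s \<bullet> D - F t \<bullet> D"])
      fix s assume "s \<in> S \<inter> ball t d"
      then have s: "s \<in> S" "dist s t < d" by (auto simp: dist_commute)
      have "((\<lambda>s. m s \<bullet> D) has_real_derivative F s \<bullet> D) (at s within S \<inter> ball t d)"
        by (rule has_field_derivative_subset[OF weak[OF s(1)]]) simp
      then show "((\<lambda>s. m s \<bullet> D - s * (F t \<bullet> D)) has_real_derivative F s \<bullet> D - F t \<bullet> D) (at s within S \<inter> ball t d)"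
        by (auto intro!: derivative_eq_intros)
      have "\<bar>(F s - F t) \<bullet> D\<bar> \<le> norm (F s - F t) * norm D" by (rule Cauchy_Schwarz_ineq2)
      also have "\<dots> \<le> e * norm D"
        using d(2)[OF s] by (intro mult_right_mono) (auto simp: dist_norm)
      finally show "norm (F s \<bullet> D - F t \<bullet> D) \<le> e * norm D" by (simp add: inner_diff_left)
    qed (use y yS t d S in \<open>auto simp: dist_norm norm_minus_commute convex_Int\<close>)
    also have "(m y \<bullet> D - y * (F t \<bullet> D)) - (m t \<bullet> D - t * (F t \<bullet> D)) = D \<bullet> D"
      by (simp add: D_def inner_diff_left inner_diff_right algebra_simps)
    finally have "norm D * norm D \<le> norm D * (e * norm (y - t))"
      by (simp add: dot_square_norm power2_eq_square mult_ac)
    then have "norm D \<le> e * norm (y - t)"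
      using e by (cases "D = 0") auto
    then show "norm (m y - m t - (y - t) *\<^sub>R F t) \<le> e * norm (y - t)" by (simp add: D_def)
  qed
qed

lemma derivative_of_uniform_limit:
  fixes f f' :: "nat \<Rightarrow> real \<Rightarrow> real"
  assumes S: "convex S" and t: "t \<in> S"
    and der: "\<And>n x. x \<in> S \<Longrightarrow> (f n has_real_derivative f' n x) (at x within S)"
    and lim: "\<And>x. x \<in> S \<Longrightarrow> (\<lambda>n. f n x) \<longlonglongrightarrow> F x" and ul: "uniform_limit S f' F' sequentially"
  shows "(F has_real_derivative F' t) (at t within S)"
proof -
  have "\<exists>g. \<forall>x\<in>S. (\<lambda>n. f n x) \<longlonglongrightarrow> g x \<and> (g has_derivative (\<lambda>h. h * F' x)) (at x within S)"
  proof (rule has_derivative_sequence[OF S])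
    show "(f n has_derivative (\<lambda>h. h * f' n x)) (at x within S)" if "x \<in> S" for n x
      using der[OF that] by (simp add: has_field_derivative_def mult.commute[of _ "f' n x"] mult_commute_abs)
    fix e :: real assume "e > 0"
    from uniform_limitD[OF ul this]
    show "\<forall>\<^sub>F n in sequentially. \<forall>x\<in>S. \<forall>h. norm (h * f' n x - h * F' x) \<le> e * norm h"
    proof eventually_elim
      case (elim n)
      show ?case
      proof (intro ballI allI)
        fix x h :: real assume "x \<in> S"
        then have "\<bar>f' n x - F' x\<bar> \<le> e" using elim by (simp add: dist_real_def less_imp_le)
        then have "\<bar>h\<bar> * \<bar>f' n x - F' x\<bar> \<le> \<bar>h\<bar> * e" by (intro mult_left_mono) auto
        then show "norm (h * f' n x - h * F' x) \<le> e * norm h"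
          by (simp add: right_diff_distrib[symmetric] abs_mult mult.commute)
      qed
    qed
  qed (use t lim in auto)
  then obtain g where g: "\<forall>x\<in>S. (\<lambda>n. f n x) \<longlonglongrightarrow> g x \<and> (g has_derivative (\<lambda>h. h * F' x)) (at x within S)" ..
  have eq: "g x = F x" if "x \<in> S" for x
    using LIMSEQ_unique lim[OF that] bspec[OF g that] by blast
  have "(g has_real_derivative F' t) (at t within S)"
    using bspec[OF g t] by (simp add: has_field_derivative_def mult_commute_abs)
  then show ?thesis
    by (rule has_field_derivative_transform_within[OF _ zero_less_one t]) (simp add: eq)
qed

section \<open>Continuity and differentiability of functions of R in time\<close>

context unit_interval_op
begin

lemma Phi_diff_eq:
  assumes "continuous_on {0..1} f" "continuous_on {0..1} g"
  shows "Phi (\<lambda>t. f t - g t) = Phi f - Phi g"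
  by (rule blinfun_eqI) (simp add: Phi_diff[OF assms] blinfun.diff_left)

lemma Phi_scale_eq:
  assumes "continuous_on {0..1} f"
  shows "Phi (\<lambda>t. c * f t) = c *\<^sub>R Phi f"
  by (rule blinfun_eqI) (simp add: Phi_scale[OF assms] blinfun.scaleR_left)

lemma Phi_0 [simp]: "Phi (\<lambda>t. 0) = 0"
  using Phi_scale_eq[of "\<lambda>t. 1" 0] by simp

lemma Phi_commute:
  assumes "continuous_on {0..1} f" "continuous_on {0..1} g"
  shows "Phi f (Phi g x) = Phi g (Phi f x)"
  using Phi_mult[OF assms, of x] Phi_mult[OF assms(2,1), of x] by (simp add: mult.commute)

lemma Phi_continuous_on:
  fixes I :: "real set"
  assumes F: "continuous_on (I \<times> {0..1}) (\<lambda>(s, r). F s r)"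
  shows "continuous_on I (\<lambda>s. Phi (F s))"
  unfolding continuous_on_iff
proof (intro ballI allI impI)
  fix t and e :: real assume t: "t \<in> I" and e: "e > 0"
  have "e/2 > 0" using e by simp
  from continuous_on_prod_compactE[OF F compact_Icc t this]
  obtain X where X: "t \<in> X" "open X"
    "\<forall>s\<in>X \<inter> I. \<forall>r\<in>{0..1}. dist (case (s, r) of (s, r) \<Rightarrow> F s r) (case (t, r) of (s, r) \<Rightarrow> F s r) \<le> e/2"
    by metis
  obtain d where d: "d > 0" "ball t d \<subseteq> X" using X open_contains_ball by blast
  show "\<exists>d>0. \<forall>s\<in>I. dist s t < d \<longrightarrow> dist (Phi (F s)) (Phi (F t)) < e"
  proof (intro exI[of _ d] conjI ballI impI d(1))
    fix s assume s: "s \<in> I" "dist s t < d"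
    then have sX: "s \<in> X \<inter> I" using d(2) by (auto simp: dist_commute subset_iff)
    have c: "continuous_on {0..1} (F s)" "continuous_on {0..1} (F t)"
      using continuous_on_slice[OF F] s t by auto
    have "norm (Phi (\<lambda>r. F s r - F t r)) \<le> e/2"
      by (rule norm_Phi_le[OF continuous_on_diff[OF c]]) (use X(3) sX in \<open>auto simp: dist_real_def\<close>)
    then show "dist (Phi (F s)) (Phi (F t)) < e"
      using e by (simp add: Phi_diff_eq[OF c] dist_norm)
  qed
qed

text \<open>The mean value inequality for each r has a uniform error, because continuity of G in
  time is uniform over the compact unit interval; the bound of \<open>Phi\<close> by the supremum of
  the symbol transports it to the operator norm.\<close>

lemma Phi_has_vector_derivative:
  assumes I: "convex I" and t: "t \<in> I"
    and F: "\<And>s. s \<in> I \<Longrightarrow> continuous_on {0..1} (F s)"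
    and G: "continuous_on (I \<times> {0..1}) (\<lambda>(s, r). G s r)"
    and D: "\<And>s r. s \<in> I \<Longrightarrow> r \<in> {0..1} \<Longrightarrow> ((\<lambda>s. F s r) has_real_derivative G s r) (at s within I)"
  shows "((\<lambda>s. Phi (F s)) has_vector_derivative Phi (G t)) (at t within I)"
  unfolding has_vector_derivative_def has_derivative_within_alt
proof (intro conjI allI impI)
  show "bounded_linear (\<lambda>h. h *\<^sub>R Phi (G t))" by (rule bounded_linear_scaleR_left)
  fix e :: real assume e: "e > 0"
  from continuous_on_prod_compactE[OF G compact_Icc t e]
  obtain X where X: "t \<in> X" "open X"
    "\<forall>s\<in>X \<inter> I. \<forall>r\<in>{0..1}. dist (case (s, r) of (s, r) \<Rightarrow> G s r) (case (t, r) of (s, r) \<Rightarrow> G s r) \<le> e"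
    by metis
  obtain d where d: "d > 0" "ball t d \<subseteq> X" using X open_contains_ball by blast
  show "\<exists>d>0. \<forall>y\<in>I. norm (y - t) < d \<longrightarrow>
      norm (Phi (F y) - Phi (F t) - (y - t) *\<^sub>R Phi (G t)) \<le> e * norm (y - t)"
  proof (intro exI[of _ d] conjI ballI impI d(1))
    fix y assume y: "y \<in> I" "norm (y - t) < d"
    have c: "continuous_on {0..1} (F y)" "continuous_on {0..1} (F t)" "continuous_on {0..1} (G t)"
      "continuous_on {0..1} (\<lambda>r. F y r - F t r)" "continuous_on {0..1} (\<lambda>r. (y - t) * G t r)"
      using F y t continuous_on_slice[OF G t] by (auto intro!: continuous_intros)
    have "Phi (F y) - Phi (F t) - (y - t) *\<^sub>R Phi (G t) = Phi (\<lambda>r. (F y r - F t r) - (y - t) * G t r)"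
      by (simp only: Phi_diff_eq[OF c(4,5)] Phi_diff_eq[OF c(1,2)] Phi_scale_eq[OF c(3)])
    also have "norm \<dots> \<le> e * norm (y - t)"
    proof (rule norm_Phi_le[OF continuous_on_diff[OF c(4,5)]])
      fix r :: real assume r: "r \<in> {0..1}"
      have "norm ((F y r - y * G t r) - (F t r - t * G t r)) \<le> e * norm (y - t)"
      proof (rule field_differentiable_bound[of "I \<inter> ball t d" _ "\<lambda>s. G s r - G t r"])
        fix s assume s: "s \<in> I \<inter> ball t d"
        have "((\<lambda>s. F s r) has_real_derivative G s r) (at s within I \<inter> ball t d)"
          by (rule has_field_derivative_subset[OF D[OF _ r]]) (use s in auto)
        then show "((\<lambda>s. F s r - s * G t r) has_real_derivative G s r - G t r) (at s within I \<inter> ball t d)"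
          by (auto intro!: derivative_eq_intros)
        show "norm (G s r - G t r) \<le> e" using X(3) s d(2) r by (auto simp: dist_real_def subset_iff)
      qed (use y t d I in \<open>auto simp: dist_norm norm_minus_commute convex_Int\<close>)
      then show "\<bar>F y r - F t r - (y - t) * G t r\<bar> \<le> e * norm (y - t)" by (simp add: algebra_simps)
    qed
    finally show "norm (Phi (F y) - Phi (F t) - (y - t) *\<^sub>R Phi (G t)) \<le> e * norm (y - t)" .
  qed
qed

end

text \<open>All that the operator argument takes from the speed: continuity and a bound for t > 0,
  and the scalar energy estimate on one interval with one constant K for all \<mu>.\<close>

locale bounded_wave = unit_interval_op R for R :: "'h::{real_inner, complete_space} \<Rightarrow> 'h" +
  fixes c :: "real \<Rightarrow> real" and T K :: real
  assumes c_cont: "continuous_on {0<..} c" and c_le: "\<And>t. t > 0 \<Longrightarrow> \<bar>c t\<bar> \<le> 3/2"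
    and T: "T > 0" and K: "K \<ge> 0"
    and energy: "\<And>\<mu> w w'. \<mu> \<ge> 0 \<Longrightarrow> continuous_on {0..T} w \<Longrightarrow> continuous_on {0..T} w' \<Longrightarrow>
      (\<And>t. t \<in> {0<..<T} \<Longrightarrow> (w has_real_derivative w' t) (at t)) \<Longrightarrow>
      (\<And>t. t \<in> {0<..<T} \<Longrightarrow> (w' has_real_derivative - (\<mu>\<^sup>2 * (c t)\<^sup>2 * w t)) (at t)) \<Longrightarrow>
      (\<And>t. t \<in> {0..T} \<Longrightarrow> (w' t)\<^sup>2 + \<mu>\<^sup>2 * (w t)\<^sup>2 \<le> K * ((w' 0)\<^sup>2 + \<mu>\<^sup>2 * (w 0)\<^sup>2))"
begin

text \<open>A pair \<open>f, g\<close> solving the component equation with parameter \<open>\<mu> = h r\<close> for every \<open>r\<close>, as functions on the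
  unit interval to which \<open>Phi\<close> applies.\<close>

definition fund :: "(real \<Rightarrow> real) \<Rightarrow> real \<Rightarrow> real \<Rightarrow> (real \<Rightarrow> real \<Rightarrow> real) \<Rightarrow> (real \<Rightarrow> real \<Rightarrow> real) \<Rightarrow> bool" where
  "fund h \<alpha> \<beta> f g \<longleftrightarrow>
    continuous_on ({0..T} \<times> {0..1}) (\<lambda>(t, r). f t r) \<and>
    continuous_on ({0..T} \<times> {0..1}) (\<lambda>(t, r). g t r) \<and>
    (\<forall>t\<in>{0..T}. \<forall>r\<in>{0..1}. ((\<lambda>t. f t r) has_real_derivative g t r) (at t within {0..T})) \<and>
    (\<forall>t\<in>{0<..<T}. \<forall>r\<in>{0..1}. ((\<lambda>t. g t r) has_real_derivative - ((c t)\<^sup>2 * ((h r)\<^sup>2 * f t r))) (at t)) \<and>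
    (\<forall>r. f 0 r = \<alpha>) \<and> (\<forall>r. g 0 r = \<beta>)"

lemma fund_exists:
  assumes h: "continuous_on {0..1} h"
  shows "\<exists>f g. fund h \<alpha> \<beta> f g"
proof -
  \<comment> \<open>The speed is controlled for t > 0 only, whereas the series construction asks for
    a global bound; 9/4 is the square of 3/2.\<close>
  define q where "q t = (if t > 0 then (c t)\<^sup>2 else 0)" for t
  have qc: "continuous_on {0<..} q"
  proof -
    have "continuous_on {0<..} (\<lambda>t. (c t)\<^sup>2)" by (intro continuous_intros c_cont)
    then show ?thesis by (rule continuous_on_eq) (simp add: q_def)
  qed
  interpret bounded_coefficient q "9/4"
  proof
    show "\<bar>q t\<bar> \<le> 9/4" for t
      using abs_le_square_iff[of "c t" "3/2"] c_le[of t] by (auto simp: q_def power2_eq_square)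
  qed (rule qc)
  have "bounded (h ` {0..1})"
    using h by (intro compact_imp_bounded compact_continuous_image) auto
  then obtain M where M: "\<And>r. r \<in> {0..1} \<Longrightarrow> \<bar>h r\<bar> \<le> M"
    unfolding bounded_iff real_norm_def by blast
  have hM: "(h r)\<^sup>2 \<in> {0..M\<^sup>2}" if "r \<in> {0..1}" for r
    using M[OF that] abs_le_square_iff[of "h r" M] by simp
  obtain w w' where w:
    "continuous_on ({0..T} \<times> {0..M\<^sup>2}) (\<lambda>(t, l). w t l)"
    "continuous_on ({0..T} \<times> {0..M\<^sup>2}) (\<lambda>(t, l). w' t l)"
    "\<And>t l. t \<in> {0..T} \<Longrightarrow> l \<in> {0..M\<^sup>2} \<Longrightarrow> ((\<lambda>t. w t l) has_real_derivative w' t l) (at t within {0..T})"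
    "\<And>t l. t \<in> {0<..<T} \<Longrightarrow> l \<in> {0..M\<^sup>2} \<Longrightarrow> ((\<lambda>t. w' t l) has_real_derivative - (q t * l * w t l)) (at t)"
    "\<And>l. w 0 l = \<alpha>" "\<And>l. w' 0 l = \<beta>"
    by (rule fundamental_solution[OF T, of "M\<^sup>2" \<alpha> \<beta>]) auto
  have comp: "continuous_on ({0..T} \<times> {0..1}) (\<lambda>(t, r). z t ((h r)\<^sup>2))"
    if z: "continuous_on ({0..T} \<times> {0..M\<^sup>2}) (\<lambda>(t, l). z t l)" for z
  proof -
    have "continuous_on ({0..T} \<times> {0..1}) (\<lambda>x. h (snd x))"
      by (rule continuous_on_compose2[OF h continuous_on_snd[OF continuous_on_id]]) auto
    then have "continuous_on ({0..T} \<times> {0..1}) (\<lambda>x. (fst x, (h (snd x))\<^sup>2))"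
      by (intro continuous_intros)
    from continuous_on_compose2[OF z this] show ?thesis
      unfolding case_prod_unfold using hM by force
  qed
  have "fund h \<alpha> \<beta> (\<lambda>t r. w t ((h r)\<^sup>2)) (\<lambda>t r. w' t ((h r)\<^sup>2))"
    unfolding fund_def
  proof (intro conjI ballI)
    fix t r :: real assume t: "t \<in> {0<..<T}" and r: "r \<in> {0..1}"
    have "q t = (c t)\<^sup>2" using t by (simp add: q_def)
    then show "((\<lambda>t. w' t ((h r)\<^sup>2)) has_real_derivative - ((c t)\<^sup>2 * ((h r)\<^sup>2 * w t ((h r)\<^sup>2)))) (at t)"
      using w(4)[OF t hM[OF r]] by (simp add: mult.assoc)
  qed (use w comp hM in auto)
  then show ?thesis by blast
qed

lemma fund_cont:
  assumes "fund h \<alpha> \<beta> f g" "t \<in> {0..T}"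
  shows "continuous_on {0..1} (f t)" "continuous_on {0..1} (g t)"
  using continuous_on_slice[OF _ assms(2)] assms(1) unfolding fund_def by blast+

lemma fund_cont_t:
  assumes "fund h \<alpha> \<beta> f g" "r \<in> {0..1}"
  shows "continuous_on {0..T} (\<lambda>t. f t r)" "continuous_on {0..T} (\<lambda>t. g t r)"
proof -
  have *: "continuous_on {0..T} (\<lambda>t. z t r)" if "continuous_on ({0..T} \<times> {0..1}) (\<lambda>(t, r). z t r)" for z :: "real \<Rightarrow> real \<Rightarrow> real"
  proof -
    have "continuous_on {0..T} ((\<lambda>(t, r). z t r) \<circ> (\<lambda>t. (t, r)))"
      by (rule continuous_on_compose)
         (use assms(2) in \<open>auto intro!: continuous_intros continuous_on_subset[OF that]\<close>)
    then show ?thesis by (simp add: o_def)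
  qed
  show "continuous_on {0..T} (\<lambda>t. f t r)" "continuous_on {0..T} (\<lambda>t. g t r)"
    using assms(1) * unfolding fund_def by blast+
qed

lemma fund_deriv:
  assumes "fund h \<alpha> \<beta> f g" "r \<in> {0..1}" "t \<in> {0<..<T}"
  shows "((\<lambda>t. f t r) has_real_derivative g t r) (at t)"
    "((\<lambda>t. g t r) has_real_derivative - ((c t)\<^sup>2 * ((h r)\<^sup>2 * f t r))) (at t)"
proof -
  have "((\<lambda>t. f t r) has_real_derivative g t r) (at t within {0..T})"
    using assms unfolding fund_def by auto
  moreover have "at t within {0..T} = at t" using assms(3) by (intro at_within_interior) auto
  ultimately show "((\<lambda>t. f t r) has_real_derivative g t r) (at t)" by simp
  show "((\<lambda>t. g t r) has_real_derivative - ((c t)\<^sup>2 * ((h r)\<^sup>2 * f t r))) (at t)"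
    using assms unfolding fund_def by blast
qed

lemma fund_energy:
  assumes f: "fund h \<alpha> \<beta> f g" and r: "r \<in> {0..1}" and h: "h r \<ge> 0" and t: "t \<in> {0..T}"
  shows "(g t r)\<^sup>2 + (h r)\<^sup>2 * (f t r)\<^sup>2 \<le> K * (\<beta>\<^sup>2 + (h r)\<^sup>2 * \<alpha>\<^sup>2)"
proof -
  have "(g t r)\<^sup>2 + (h r)\<^sup>2 * (f t r)\<^sup>2 \<le> K * ((g 0 r)\<^sup>2 + (h r)\<^sup>2 * (f 0 r)\<^sup>2)"
  proof (rule energy[OF h _ _ _ _ t])
    fix s assume s: "s \<in> {0<..<T}"
    show "((\<lambda>t. g t r) has_real_derivative - ((h r)\<^sup>2 * (c s)\<^sup>2 * f s r)) (at s)"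
      using fund_deriv(2)[OF f r s] by (simp add: mult_ac)
  qed (rule fund_cont_t[OF f r] fund_deriv(1)[OF f r]; assumption?)+
  then show ?thesis using f by (simp add: fund_def)
qed

text \<open>Determinant 1 makes the fundamental matrix invertible with explicit inverse, for every r
  at once.\<close>

lemma fund_wronskian:
  assumes 1: "fund h 1 0 f1 g1" and 2: "fund h 0 1 f2 g2" and r: "r \<in> {0..1}" and t: "t \<in> {0..T}"
  shows "f1 t r * g2 t r - g1 t r * f2 t r = 1"
proof -
  have "f1 t r * g2 t r - g1 t r * f2 t r = f1 0 r * g2 0 r - g1 0 r * f2 0 r"
  proof (rule DERIV_isconst2[OF T])
    show "continuous_on {0..T} (\<lambda>t. f1 t r * g2 t r - g1 t r * f2 t r)"
      by (intro continuous_intros fund_cont_t[OF 1 r] fund_cont_t[OF 2 r])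
    fix s assume "0 < s" "s < T"
    then have s: "s \<in> {0<..<T}" by simp
    show "((\<lambda>t. f1 t r * g2 t r - g1 t r * f2 t r) has_real_derivative 0) (at s)"
      by (rule DERIV_cong[OF DERIV_diff[OF DERIV_mult[OF fund_deriv(1)[OF 1 r s] fund_deriv(2)[OF 2 r s]]
              DERIV_mult[OF fund_deriv(2)[OF 1 r s] fund_deriv(1)[OF 2 r s]]]])
         (simp add: algebra_simps)
  qed (use t in auto)
  then show ?thesis using 1 2 by (simp add: fund_def)
qed

lemma fund_op_cont:
  assumes "fund h \<alpha> \<beta> f g"
  shows "continuous_on {0..T} (\<lambda>t. Phi (f t))" "continuous_on {0..T} (\<lambda>t. Phi (g t))"
  using assms unfolding fund_def by (auto intro!: Phi_continuous_on)

lemma fund_op_deriv: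
  assumes f: "fund h \<alpha> \<beta> f g" and t: "t \<in> {0..T}"
  shows "((\<lambda>t. Phi (f t)) has_vector_derivative Phi (g t)) (at t within {0..T})"
  by (rule Phi_has_vector_derivative[OF _ t fund_cont(1)[OF f]]) (use f in \<open>auto simp: fund_def\<close>)

lemma fund_op_deriv2:
  assumes f: "fund h \<alpha> \<beta> f g" and h: "continuous_on {0..1} h" and t: "t \<in> {0<..<T}"
  shows "\<exists>G. ((\<lambda>t. Phi (g t)) has_vector_derivative G) (at t) \<and>
    (\<forall>x. G x = (- (c t)\<^sup>2) *\<^sub>R Phi h (Phi h (Phi (f t) x)))"
proof -
  have t': "t \<in> {0..T}" using t by simp
  have cf: "continuous_on {0..1} (\<lambda>r. (h r)\<^sup>2 * f t r)"
    by (intro continuous_intros h fund_cont(1)[OF f t'])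
  have "((\<lambda>t. Phi (g t)) has_vector_derivative Phi (\<lambda>r. (- (c t)\<^sup>2) * ((h r)\<^sup>2 * f t r))) (at t within {0<..<T})"
  proof (rule Phi_has_vector_derivative[OF _ t])
    show "continuous_on ({0<..<T} \<times> {0..1}) (\<lambda>(s, r). (- (c s)\<^sup>2) * ((h r)\<^sup>2 * f s r))"
    proof -
      have 1: "continuous_on ({0<..<T} \<times> {0..1::real}) (\<lambda>x. c (fst x))"
        by (rule continuous_on_compose2[OF c_cont continuous_on_fst[OF continuous_on_id]]) auto
      have 2: "continuous_on ({0<..<T} \<times> {0..1}) (\<lambda>x. h (snd x))"
        by (rule continuous_on_compose2[OF h continuous_on_snd[OF continuous_on_id]]) auto
      have 3: "continuous_on ({0<..<T} \<times> {0..1}) (\<lambda>x. f (fst x) (snd x))"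
        by (rule continuous_on_subset[of "{0..T} \<times> {0..1}"])
           (use f in \<open>auto simp: fund_def case_prod_unfold\<close>)
      show ?thesis unfolding case_prod_unfold by (intro continuous_intros 1 2 3)
    qed
    show "continuous_on {0..1} (g s)" if "s \<in> {0<..<T}" for s
      using fund_cont(2)[OF f] that by simp
    show "((\<lambda>s. g s r) has_real_derivative (- (c s)\<^sup>2) * ((h r)\<^sup>2 * f s r)) (at s within {0<..<T})"
      if "s \<in> {0<..<T}" "r \<in> {0..1}" for s r
      using has_field_derivative_at_within[OF fund_deriv(2)[OF f that(2,1)]] by simp
  qed simp
  then have "((\<lambda>t. Phi (g t)) has_vector_derivative (- (c t)\<^sup>2) *\<^sub>R Phi (\<lambda>r. (h r)\<^sup>2 * f t r)) (at t)"
    unfolding Phi_scale_eq[OF cf] using t by (simp only: at_within_open[OF t open_greaterThanLessThan])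
  moreover have "Phi (\<lambda>r. (h r)\<^sup>2 * f t r) x = Phi h (Phi h (Phi (f t) x))" for x
  proof -
    have "Phi (\<lambda>r. h r * (h r * f t r)) x = Phi h (Phi h (Phi (f t) x))"
      using h fund_cont(1)[OF f t'] by (simp add: Phi_mult continuous_on_mult)
    then show ?thesis by (simp add: power2_eq_square mult.assoc)
  qed
  moreover have "((- (c t)\<^sup>2) *\<^sub>R Phi (\<lambda>r. (h r)\<^sup>2 * f t r)) x = (- (c t)\<^sup>2) *\<^sub>R Phi (\<lambda>r. (h r)\<^sup>2 * f t r) x" for x
    by (rule blinfun.scaleR_left)
  ultimately show ?thesis by (metis (no_types, lifting))
qed

lemma op_constant:
  fixes z :: "real \<Rightarrow> 'h"
  assumes "continuous_on {0..T} z" "\<And>t. t \<in> {0<..<T} \<Longrightarrow> (z has_vector_derivative 0) (at t)" "t \<in> {0..T}"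
  shows "z t = z 0"
proof -
  have "z t \<bullet> y = z 0 \<bullet> y" for y
  proof (rule DERIV_isconst2[OF T])
    show "continuous_on {0..T} (\<lambda>t. z t \<bullet> y)" by (intro continuous_intros assms)
    fix s assume "0 < s" "s < T"
    then have "(z has_vector_derivative 0) (at s)" using assms(2) by simp
    from bounded_linear.has_vector_derivative[OF bounded_linear_inner_left this, of y]
    show "((\<lambda>t. z t \<bullet> y) has_real_derivative 0) (at s)"
      by (simp add: has_real_derivative_iff_has_vector_derivative)
  qed (use assms in auto)
  then show ?thesis by (metis inner_eq_zero_iff inner_diff_left right_minus_eq)
qed

text \<open>Uniqueness comes with the formula. For a given solution v and a fundamental pair f, g
  the operator Wronskian \<open>Phi (g t) (v t) - Phi (f t) (v' t)\<close> is constant, because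
  functions of R commute. The two pairs give a linear system for v and v', which the scalar
  Wronskian identity inverts.\<close>

lemma op_solution_representation:
  assumes h: "continuous_on {0..1} h"
    and 1: "fund h 1 0 f1 g1" and 2: "fund h 0 1 f2 g2"
    and vc: "continuous_on {0..T} v" "continuous_on {0..T} v'"
    and v: "\<And>t. t \<in> {0<..<T} \<Longrightarrow> (v has_vector_derivative v' t) (at t)"
    and v': "\<And>t. t \<in> {0<..<T} \<Longrightarrow>
        (v' has_vector_derivative (- (c t)\<^sup>2) *\<^sub>R Phi h (Phi h (v t))) (at t)"
    and t: "t \<in> {0..T}"
  shows "v t = Phi (f1 t) (v 0) + Phi (f2 t) (v' 0)" "v' t = Phi (g1 t) (v 0) + Phi (g2 t) (v' 0)"
proof -
  have const: "Phi (g t) (v t) - Phi (f t) (v' t) = Phi (g 0) (v 0) - Phi (f 0) (v' 0)"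
    if f: "fund h \<alpha> \<beta> f g" for f g \<alpha> \<beta>
  proof (rule op_constant[OF _ _ t])
    show "continuous_on {0..T} (\<lambda>t. Phi (g t) (v t) - Phi (f t) (v' t))"
      by (intro continuous_intros blinfun.continuous_on fund_op_cont[OF f] vc)
    fix s assume s: "s \<in> {0<..<T}"
    then have s': "s \<in> {0..T}" and at: "at s within {0..T} = at s"
      by (auto intro!: at_within_interior)
    note cf = fund_cont[OF f s']
    have df: "((\<lambda>t. Phi (f t)) has_vector_derivative Phi (g s)) (at s)"
      using fund_op_deriv[OF f s'] by (simp only: at)
    have cg: "continuous_on {0..1} (\<lambda>r. (h r)\<^sup>2 * f s r)"
      by (intro continuous_intros h cf)
    obtain G where G: "((\<lambda>t. Phi (g t)) has_vector_derivative G) (at s)"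
      and Gx: "\<And>x. G x = (- (c s)\<^sup>2) *\<^sub>R Phi h (Phi h (Phi (f s) x))"
      using fund_op_deriv2[OF f h s] by blast
    note D = has_vector_derivative_diff[OF
        bounded_bilinear.has_vector_derivative[OF bounded_bilinear_blinfun_apply G v[OF s]]
        bounded_bilinear.has_vector_derivative[OF bounded_bilinear_blinfun_apply df v'[OF s]]]
    have comm: "Phi (f s) (Phi h (Phi h (v s))) = Phi h (Phi h (Phi (f s) (v s)))"
      by (simp only: Phi_commute[OF cf(1) h])
    show "((\<lambda>t. Phi (g t) (v t) - Phi (f t) (v' t)) has_vector_derivative 0) (at s)"
      by (rule has_vector_derivative_eq_rhs[OF D]) (simp add: Gx blinfun.scaleR_right blinfun.minus_right comm)
  qed
  have init: "Phi (f1 0) x = x" "Phi (g1 0) x = 0" "Phi (f2 0) x = 0" "Phi (g2 0) x = x" for x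
    using 1 2 by (simp_all add: fund_def fun_eq_iff[symmetric] cong: Phi_cong)
  note c1 = fund_cont[OF 1 t] and c2 = fund_cont[OF 2 t]
  have z1: "Phi (g2 t) (v t) - Phi (f2 t) (v' t) = v 0"
    using const[OF 2] by (simp add: init)
  have z2: "Phi (f1 t) (v' t) - Phi (g1 t) (v t) = v' 0"
    using arg_cong[OF const[OF 1], of uminus] by (simp add: init)
  have wr: "Phi (f1 t) (Phi (g2 t) x) - Phi (g1 t) (Phi (f2 t) x) = x" for x
  proof -
    have "Phi (\<lambda>r. f1 t r * g2 t r - g1 t r * f2 t r) = Phi (\<lambda>r. 1)"
      by (rule Phi_cong) (auto intro!: continuous_intros c1 c2 simp: fund_wronskian[OF 1 2 _ t])
    then have "Phi (\<lambda>r. f1 t r * g2 t r - g1 t r * f2 t r) x = x" by simp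
    then show ?thesis
      by (simp add: Phi_diff Phi_mult continuous_on_mult c1 c2)
  qed
  show "v t = Phi (f1 t) (v 0) + Phi (f2 t) (v' 0)"
  proof -
    have "Phi (f1 t) (v 0) + Phi (f2 t) (v' 0) =
        (Phi (f1 t) (Phi (g2 t) (v t)) - Phi (f2 t) (Phi (g1 t) (v t)))
        + (Phi (f2 t) (Phi (f1 t) (v' t)) - Phi (f1 t) (Phi (f2 t) (v' t)))"
      by (simp add: z1[symmetric] z2[symmetric] blinfun.diff_right)
    then show ?thesis
      by (simp add: Phi_commute[OF c2(1) c1(1)] Phi_commute[OF c2(1) c1(2)] wr)
  qed
  show "v' t = Phi (g1 t) (v 0) + Phi (g2 t) (v' 0)"
  proof -
    have "Phi (g1 t) (v 0) + Phi (g2 t) (v' 0) =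
        (Phi (g1 t) (Phi (g2 t) (v t)) - Phi (g2 t) (Phi (g1 t) (v t)))
        + (Phi (g2 t) (Phi (f1 t) (v' t)) - Phi (g1 t) (Phi (f2 t) (v' t)))"
      by (simp add: z1[symmetric] z2[symmetric] blinfun.diff_right)
    then show ?thesis
      by (simp add: Phi_commute[OF c2(2) c1(1)] Phi_commute[OF c2(2) c1(2)] wr)
  qed
qed

text \<open>The scalar estimate for the initial values (1, 0) and (0, 1) bounds the symbols
  pointwise: g1 and h f1 by sqrt K h, g2 and h f2 by sqrt K. By \<open>norm_Phi_le_Phi\<close> these
  become estimates at vectors, with a constant that does not depend on h.\<close>

lemma op_energy:
  assumes h: "continuous_on {0..1} h" "\<And>r. r \<in> {0..1} \<Longrightarrow> h r \<ge> 0"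
    and vc: "continuous_on {0..T} v" "continuous_on {0..T} v'"
    and v: "\<And>t. t \<in> {0<..<T} \<Longrightarrow> (v has_vector_derivative v' t) (at t)"
    and v': "\<And>t. t \<in> {0<..<T} \<Longrightarrow>
        (v' has_vector_derivative (- (c t)\<^sup>2) *\<^sub>R Phi h (Phi h (v t))) (at t)"
    and t: "t \<in> {0..T}"
  shows "norm (v' t) \<le> sqrt K * (norm (Phi h (v 0)) + norm (v' 0))"
    "norm (Phi h (v t)) \<le> sqrt K * (norm (Phi h (v 0)) + norm (v' 0))"
proof -
  obtain f1 g1 f2 g2 where 1: "fund h 1 0 f1 g1" and 2: "fund h 0 1 f2 g2"
    using fund_exists[OF h(1)] by metis
  have rep: "v t = Phi (f1 t) (v 0) + Phi (f2 t) (v' 0)" "v' t = Phi (g1 t) (v 0) + Phi (g2 t) (v' 0)"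
    by (rule op_solution_representation[OF h(1) 1 2 vc _ _ t]; (rule v | rule v'); assumption)+
  note c1 = fund_cont[OF 1 t] and c2 = fund_cont[OF 2 t]
  have bd: "norm (Phi z x) \<le> sqrt K * norm (Phi y x)"
    if "continuous_on {0..1} z" "continuous_on {0..1} y" "\<And>r. r \<in> {0..1} \<Longrightarrow> (z r)\<^sup>2 \<le> K * (y r)\<^sup>2" for z y x
  proof -
    have "norm (Phi z x) \<le> norm (Phi (\<lambda>r. sqrt K * y r) x)"
      by (rule norm_Phi_le_Phi) (use that K in \<open>auto intro!: continuous_intros simp: power_mult_distrib\<close>)
    then show ?thesis using K by (simp add: Phi_scale[OF that(2)])
  qed
  have sq: "a\<^sup>2 + b\<^sup>2 * d\<^sup>2 \<le> e \<Longrightarrow> a\<^sup>2 \<le> e \<and> (b * d)\<^sup>2 \<le> e" for a b d e :: real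
    using zero_le_power2[of a] zero_le_power2[of "b * d"] unfolding power_mult_distrib by linarith
  have e1: "(g1 t r)\<^sup>2 \<le> K * (h r)\<^sup>2" "(h r * f1 t r)\<^sup>2 \<le> K * (h r)\<^sup>2"
    and e2: "(g2 t r)\<^sup>2 \<le> K * 1\<^sup>2" "(h r * f2 t r)\<^sup>2 \<le> K * 1\<^sup>2" if "r \<in> {0..1}" for r
    using sq[OF fund_energy[OF 1 that h(2)[OF that] t]] sq[OF fund_energy[OF 2 that h(2)[OF that] t]] by simp_all
  have "norm (v' t) \<le> norm (Phi (g1 t) (v 0)) + norm (Phi (g2 t) (v' 0))"
    by (simp only: rep(2) norm_triangle_ineq)
  also have "\<dots> \<le> sqrt K * norm (Phi h (v 0)) + sqrt K * norm (Phi (\<lambda>r. 1) (v' 0))"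
    by (intro add_mono bd c1 c2 h continuous_intros e1 e2)
  finally show "norm (v' t) \<le> sqrt K * (norm (Phi h (v 0)) + norm (v' 0))"
    by (simp add: distrib_left)
  have "Phi h (v t) = Phi (\<lambda>r. h r * f1 t r) (v 0) + Phi (\<lambda>r. h r * f2 t r) (v' 0)"
    by (simp add: rep(1) blinfun.add_right Phi_mult h c1 c2)
  then have "norm (Phi h (v t)) \<le> norm (Phi (\<lambda>r. h r * f1 t r) (v 0)) + norm (Phi (\<lambda>r. h r * f2 t r) (v' 0))"
    by (simp only: norm_triangle_ineq)
  also have "\<dots> \<le> sqrt K * norm (Phi h (v 0)) + sqrt K * norm (Phi (\<lambda>r. 1) (v' 0))"
    by (intro add_mono bd c1 c2 h continuous_intros e1 e2)
  finally show "norm (Phi h (v t)) \<le> sqrt K * (norm (Phi h (v 0)) + norm (v' 0))"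
    by (simp add: distrib_left)
qed

end

section \<open>The wave equation in the energy space\<close>

text \<open>B plays the role of the square root of A, and R is its resolvent (1 + B)^(-1); the range
  of R is the space of initial positions.\<close>

locale wave_problem = bounded_wave R c T K for R :: "'h::{real_inner, complete_space} \<Rightarrow> 'h" and c T K +
  fixes B :: "('h \<times> 'h) set"
  assumes B: "B = range (\<lambda>z. (R z, z - R z))" and dense: "closure (range R) = UNIV" and inj: "inj R"
begin

abbreviation "Bop \<equiv> op_apply B"

lemma Bop_R: "Bop (R z) = z - R z"
  unfolding op_apply_def by (rule the_equality) (use inj in \<open>auto simp: B inj_eq\<close>)

lemma Domain_B: "Domain B = range R"
  by (auto simp: B)

lemma Domain_BE:
  assumes "x \<in> Domain B" obtains z where "x = R z" "Bop x = z - R z"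
  using assms Bop_R by (auto simp: Domain_B)

lemma R_diff: "R (x - y) = R x - R y"
  by (rule linear_diff[OF R_lin])

lemma Domain_B_diff: "x \<in> Domain B \<Longrightarrow> y \<in> Domain B \<Longrightarrow> x - y \<in> Domain B"
  unfolding Domain_B by (auto simp: R_diff[symmetric])

lemma Bop_diff: "x \<in> Domain B \<Longrightarrow> y \<in> Domain B \<Longrightarrow> Bop (x - y) = Bop x - Bop y"
  by (elim Domain_BE) (simp add: R_diff[symmetric] Bop_R, simp add: R_diff)

lemma Domain_B_closed:
  assumes "\<And>n. x n \<in> Domain B" "x \<longlonglongrightarrow> a" "(\<lambda>n. Bop (x n)) \<longlonglongrightarrow> b"
  shows "a \<in> Domain B" "Bop a = b"
proof -
  have eq: "x n = R (x n + Bop (x n))" for n using assms(1)[of n] by (elim Domain_BE) simp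
  have "(\<lambda>n. R (x n + Bop (x n))) \<longlonglongrightarrow> R (a + b)"
    by (intro bounded_linear.tendsto[OF lin] tendsto_add assms)
  then have "x \<longlonglongrightarrow> R (a + b)" by (simp add: eq[symmetric])
  then have "a = R (a + b)" using assms(2) LIMSEQ_unique by blast
  then show "a \<in> Domain B" "Bop a = b" using Bop_R[of "a + b"] by (auto simp: Domain_B)
qed

text \<open>\<open>B\<close> corresponds to the function \<open>(1 - r) / r\<close> of \<open>r\<close>. On the range of \<open>Phi (cut \<epsilon>)\<close>, a spectral cut-off
  that removes \<open>r \<le> \<epsilon>\<close>, it agrees with the bounded operator \<open>Phi (symb \<epsilon>)\<close>; \<open>cutq \<epsilon> r\<close> is \<open>cut \<epsilon> r / r\<close>.\<close>

definition cut :: "real \<Rightarrow> real \<Rightarrow> real" where "cut \<epsilon> r = min 1 (max 0 (r / \<epsilon> - 1))"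
definition cutq :: "real \<Rightarrow> real \<Rightarrow> real" where "cutq \<epsilon> r = cut \<epsilon> r / max r \<epsilon>"
definition symb :: "real \<Rightarrow> real \<Rightarrow> real" where "symb \<epsilon> r = (1 - r) / max r \<epsilon>"

section \<open>The spectral cut-off and the truncated equation\<close>

context
  fixes \<epsilon> :: real assumes eps: "\<epsilon> > 0"
begin

lemma cut_continuous: "continuous_on {0..1} (cut \<epsilon>)" "continuous_on {0..1} (cutq \<epsilon>)"
    "continuous_on {0..1} (symb \<epsilon>)"
  unfolding cut_def[abs_def] cutq_def[abs_def] symb_def[abs_def]
  using eps by (auto intro!: continuous_intros)

lemma symb_nonneg: "r \<in> {0..1} \<Longrightarrow> symb \<epsilon> r \<ge> 0"
  using eps by (auto simp: symb_def)

lemma cut_eq_0: "r \<le> \<epsilon> \<Longrightarrow> cut \<epsilon> r = 0"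
  using eps by (simp add: cut_def)

lemma cutq_mult: "cutq \<epsilon> r * r = cut \<epsilon> r"
  using eps cut_eq_0[of r] by (cases "r \<le> \<epsilon>") (auto simp: cutq_def)

lemma symb_cut: "symb \<epsilon> r * cut \<epsilon> r = cutq \<epsilon> r * (1 - r)"
  by (simp add: symb_def cutq_def)

lemma symb_id_cut: "symb \<epsilon> r * (r * cut \<epsilon> r) = (1 - r) * cut \<epsilon> r"
  using eps cut_eq_0[of r] by (cases "r \<le> \<epsilon>") (auto simp: symb_def)

abbreviation "G \<equiv> Phi (cut \<epsilon>)"
abbreviation "Q \<equiv> Phi (cutq \<epsilon>)"
abbreviation "H \<equiv> Phi (symb \<epsilon>)"

lemma R_Phi: "continuous_on {0..1} f \<Longrightarrow> R (Phi f x) = Phi f (R x)"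
  using Phi_commute[of "\<lambda>t. t" f x] by (simp add: Phi_id continuous_on_id)

lemma Q_R: "Q (R x) = G x" 
proof -
  have "Phi (\<lambda>r. cutq \<epsilon> r * r) x = Q (R x)"
    by (simp add: Phi_mult cut_continuous continuous_on_id Phi_id)
  then show ?thesis by (simp add: cutq_mult)
qed

lemma Q_1_minus_R: "Q (x - R x) = H (G x)"
proof -
  have "Phi (\<lambda>r. cutq \<epsilon> r * (1 - r)) x = Q (x - R x)"
    by (simp add: Phi_mult Phi_diff cut_continuous continuous_on_id continuous_on_diff Phi_id)
  moreover have "Phi (\<lambda>r. symb \<epsilon> r * cut \<epsilon> r) x = H (G x)"
    by (simp add: Phi_mult cut_continuous)
  ultimately show ?thesis by (simp add: symb_cut)
qed

lemma H_R_G: "H (R (G x)) = G x - R (G x)"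
proof -
  have "Phi (\<lambda>r. symb \<epsilon> r * (r * cut \<epsilon> r)) x = H (R (G x))"
    by (simp add: Phi_mult cut_continuous continuous_on_id continuous_on_mult Phi_id)
  moreover have "Phi (\<lambda>r. (1 - r) * cut \<epsilon> r) x = G x - R (G x)"
    by (simp add: Phi_mult Phi_diff cut_continuous continuous_on_id continuous_on_diff Phi_id)
  ultimately show ?thesis by (simp add: symb_id_cut)
qed

lemma G_Domain: "G x \<in> Domain B" and Bop_G: "Bop (G x) = H (G x)"
proof -
  have eq: "G x = R (Q x)" using Q_R R_Phi[OF cut_continuous(2)] by simp
  then show "G x \<in> Domain B" by (simp add: Domain_B)
  show "Bop (G x) = H (G x)"
    using Bop_R[of "Q x"] Q_1_minus_R[of x] by (simp add: eq[symmetric] blinfun.diff_right Q_R)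
qed

lemma G_Bop:
  assumes "x \<in> Domain B" shows "G (Bop x) = H (G x)"
proof -
  obtain z where z: "x = R z" "Bop x = z - R z" using assms by (rule Domain_BE)
  have "H (G (R z)) = G z - G (R z)"
    using H_R_G[of z] by (simp add: R_Phi[OF cut_continuous(1)])
  then show ?thesis by (simp add: z(1) Bop_R blinfun.diff_right)
qed

lemma norm_G_le: "norm (G x) \<le> norm x"
  using norm_Phi_apply_le[OF cut_continuous(1), of 1 x] by (auto simp: cut_def)

text \<open>The cut-off differs from 1 only for r < 2 \<epsilon>, where the extra factor r is small:
  on the range of R it converges with a rate.\<close>

lemma norm_G_R_diff: "norm (G (R y) - R y) \<le> 2 * \<epsilon> * norm y"
proof -
  have "norm (Phi (\<lambda>r. cut \<epsilon> r * r - r) y) \<le> 2 * \<epsilon> * norm y"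
  proof (rule norm_Phi_apply_le)
    show "continuous_on {0..1} (\<lambda>r. cut \<epsilon> r * r - r)" by (intro continuous_intros cut_continuous)
    fix r :: real assume r: "r \<in> {0..1}"
    show "\<bar>cut \<epsilon> r * r - r\<bar> \<le> 2 * \<epsilon>"
    proof (cases "r \<ge> 2 * \<epsilon>")
      case True
      then have "cut \<epsilon> r = 1" using eps by (simp add: cut_def field_simps)
      then show ?thesis using eps by simp
    next
      case False
      have "cut \<epsilon> r * r \<le> 1 * r" using r by (intro mult_right_mono) (auto simp: cut_def)
      then have "\<bar>cut \<epsilon> r * r - r\<bar> = (1 - cut \<epsilon> r) * r" by (simp add: left_diff_distrib)
      also have "\<dots> \<le> 1 * r" using r by (intro mult_right_mono) (auto simp: cut_def)
      finally show ?thesis using False by simp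
    qed
  qed
  then show ?thesis by (simp add: Phi_diff Phi_mult cut_continuous continuous_on_id continuous_on_mult Phi_id)
qed

text \<open>For a weak solution u'' need not exist in H, so \<open>op_energy\<close> cannot be
  applied to u. Testing with vectors R y shows that R u' is differentiable in H; applying Q, with Q
  R = G, gives a genuine second order equation for G u with the bounded operator H. The bound is
  independent of \<epsilon>.\<close>

lemma G_apriori:
  assumes sol: "wave_solution c B T u0 u1 u u'" and t: "t \<in> {0..T}"
  shows "norm (G (u' t)) \<le> sqrt K * (norm (Bop u0) + norm u1)"
    "norm (G (Bop (u t))) \<le> sqrt K * (norm (Bop u0) + norm u1)"
proof -
  have dom: "\<And>t. t \<in> {0..T} \<Longrightarrow> u t \<in> Domain B"
    and cont: "continuous_on {0..T} u" "continuous_on {0..T} (\<lambda>t. Bop (u t))" "continuous_on {0..T} u'"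
    and der: "\<And>t. t \<in> {0..T} \<Longrightarrow> (u has_vector_derivative u' t) (at t within {0..T})"
    and init: "u 0 = u0" "u' 0 = u1"
    and weak: "\<And>v t. v \<in> Domain B \<Longrightarrow> t \<in> {0<..<T} \<Longrightarrow>
      ((\<lambda>r. u' r \<bullet> v) has_real_derivative - ((c t)\<^sup>2 * (Bop (u t) \<bullet> Bop v))) (at t)"
    using sol by (auto simp: wave_solution_def)
  let ?F = "\<lambda>t. (- (c t)\<^sup>2) *\<^sub>R (Bop (u t) - R (Bop (u t)))"
  \<comment> \<open>The vectors R y exhaust the domain of B, and B maps R y to y - R y; symmetry of
    R moves this onto \<open>Bop (u t)\<close>.\<close>
  have Ru0: "((\<lambda>t. R (u' t)) has_vector_derivative ?F s) (at s within {0<..<T})" if s: "s \<in> {0<..<T}" for s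
  proof (rule weak_derivative_imp_strong[OF _ _ _ s])
    fix y t assume t: "t \<in> {0<..<T}"
    have "Bop (u t) \<bullet> (y - R y) = (Bop (u t) - R (Bop (u t))) \<bullet> y"
      by (simp add: inner_diff_left inner_diff_right sym)
    then have "((\<lambda>s. R (u' s) \<bullet> y) has_real_derivative ?F t \<bullet> y) (at t)"
      using weak[of "R y" t] t by (simp add: Domain_B Bop_R sym)
    then show "((\<lambda>s. R (u' s) \<bullet> y) has_real_derivative ?F t \<bullet> y) (at t within {0<..<T})"
      by (rule has_field_derivative_at_within)
  next
    show "convex {0<..<T}" by simp
    have "continuous_on {0<..<T} (\<lambda>t. Bop (u t))" by (rule continuous_on_subset[OF cont(2)]) auto
    moreover have "continuous_on {0<..<T} c" by (rule continuous_on_subset[OF c_cont]) auto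
    ultimately show "continuous_on {0<..<T} ?F"
      by (intro continuous_intros bounded_linear.continuous_on[OF lin])
  qed
  have Ru': "((\<lambda>t. R (u' t)) has_vector_derivative ?F s) (at s)" if s: "s \<in> {0<..<T}" for s
    using Ru0[OF s] by (simp only: at_within_open[OF s open_greaterThanLessThan])
  have Gu: "((\<lambda>t. G (u t)) has_vector_derivative G (u' s)) (at s)" if s: "s \<in> {0<..<T}" for s
  proof -
    have "at s within {0..T} = at s" using s by (intro at_within_interior) auto
    then have "(u has_vector_derivative u' s) (at s)" using der[of s] s by simp
    then show ?thesis by (rule bounded_linear.has_vector_derivative[OF blinfun.bounded_linear_right])
  qed
  have Gu': "((\<lambda>t. G (u' t)) has_vector_derivative (- (c s)\<^sup>2) *\<^sub>R H (H (G (u s)))) (at s)"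
    if s: "s \<in> {0<..<T}" for s
  proof -
    have "u s \<in> Domain B" using dom s by simp
    \<comment> \<open>Q (1 - R) = H G, and G B = H G on the domain: both occurrences of B turn into
      the bounded operator H.\<close>
    then have "Q (?F s) = (- (c s)\<^sup>2) *\<^sub>R H (H (G (u s)))"
      by (simp add: blinfun.scaleR_right blinfun.minus_right Q_1_minus_R G_Bop)
    then show ?thesis
      using bounded_linear.has_vector_derivative[OF blinfun.bounded_linear_right Ru'[OF s], of Q]
      by (simp add: Q_R)
  qed
  have Gc: "continuous_on {0..T} (\<lambda>t. G (u t))" "continuous_on {0..T} (\<lambda>t. G (u' t))"
    by (intro blinfun.continuous_on continuous_on_const cont)+
  have en: "norm (G (u' t)) \<le> sqrt K * (norm (H (G (u 0))) + norm (G (u' 0)))"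
    "norm (H (G (u t))) \<le> sqrt K * (norm (H (G (u 0))) + norm (G (u' 0)))"
    by (rule op_energy[OF cut_continuous(3) _ Gc _ _ t]; (rule symb_nonneg | rule Gu | rule Gu'); assumption)+
  have 0: "H (G u0) = G (Bop u0)" using G_Bop[of "u 0"] dom[of 0] T by (simp add: init)
  have le: "sqrt K * (norm (H (G (u 0))) + norm (G (u' 0))) \<le> sqrt K * (norm (Bop u0) + norm u1)"
    unfolding init 0 using norm_G_le K by (intro mult_left_mono add_mono) auto
  show "norm (G (u' t)) \<le> sqrt K * (norm (Bop u0) + norm u1)"
    using en(1) le by linarith
  show "norm (G (Bop (u t))) \<le> sqrt K * (norm (Bop u0) + norm u1)"
    using en(2) le by (simp add: G_Bop[OF dom[OF t]])
qed

text \<open>Solve the equation with the bounded operator H for the data x0, x1 and apply G to the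
  solution: on the range of G the operators H and B coincide, so the result solves the original
  equation.\<close>

lemma G_existence: "\<exists>u u'. wave_solution c B T (G x0) (G x1) u u'"
proof -
  note h = cut_continuous(3)
  obtain f1 g1 f2 g2 where 1: "fund (symb \<epsilon>) 1 0 f1 g1" and 2: "fund (symb \<epsilon>) 0 1 f2 g2"
    using fund_exists[OF h] by metis
  define p where "p t = Phi (f1 t) x0 + Phi (f2 t) x1" for t
  define p' where "p' t = Phi (g1 t) x0 + Phi (g2 t) x1" for t
  have pc: "continuous_on {0..T} p" "continuous_on {0..T} p'"
    unfolding p_def[abs_def] p'_def[abs_def]
    by (intro continuous_intros blinfun.continuous_on fund_op_cont[OF 1] fund_op_cont[OF 2])+
  have pd: "(p has_vector_derivative p' t) (at t within {0..T})" if t: "t \<in> {0..T}" for t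
    unfolding p_def[abs_def] p'_def
    by (intro has_vector_derivative_add bounded_linear.has_vector_derivative[OF blinfun.bounded_linear_left]
        fund_op_deriv[OF 1 t] fund_op_deriv[OF 2 t])
  have pd': "(p' has_vector_derivative (- (c t)\<^sup>2) *\<^sub>R H (H (p t))) (at t)" if t: "t \<in> {0<..<T}" for t
  proof -
    obtain G1 G2 where G1: "((\<lambda>t. Phi (g1 t)) has_vector_derivative G1) (at t)"
        "\<And>x. G1 x = (- (c t)\<^sup>2) *\<^sub>R H (H (Phi (f1 t) x))"
      and G2: "((\<lambda>t. Phi (g2 t)) has_vector_derivative G2) (at t)"
        "\<And>x. G2 x = (- (c t)\<^sup>2) *\<^sub>R H (H (Phi (f2 t) x))"
      using fund_op_deriv2[OF 1 h t] fund_op_deriv2[OF 2 h t] by metis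
    have "(p' has_vector_derivative G1 x0 + G2 x1) (at t)"
      unfolding p'_def[abs_def]
      by (intro has_vector_derivative_add bounded_linear.has_vector_derivative[OF blinfun.bounded_linear_left]
          G1 G2)
    then show ?thesis by (simp add: G1(2) G2(2) p_def blinfun.add_right scaleR_add_right)
  qed
  have "Phi (f1 0) x = x" "Phi (g1 0) x = 0" "Phi (f2 0) x = 0" "Phi (g2 0) x = x" for x
    using 1 2 by (simp_all add: fund_def fun_eq_iff[symmetric] cong: Phi_cong)
  then have init: "p 0 = x0" "p' 0 = x1" by (simp_all add: p_def p'_def)
  have "wave_solution c B T (G x0) (G x1) (\<lambda>t. G (p t)) (\<lambda>t. G (p' t))"
    unfolding wave_solution_def
  proof (intro conjI ballI)
    show "continuous_on {0..T} (\<lambda>t. Bop (G (p t)))"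
      unfolding Bop_G by (intro blinfun.continuous_on continuous_on_const pc)
    fix v t assume v: "v \<in> Domain B" and t: "t \<in> {0<..<T}"
    obtain y where y: "v = R y" "Bop v = y - R y" using v by (rule Domain_BE)
    have "((\<lambda>t. G (p' t)) has_vector_derivative G ((- (c t)\<^sup>2) *\<^sub>R H (H (p t)))) (at t)"
      by (rule bounded_linear.has_vector_derivative[OF blinfun.bounded_linear_right pd'[OF t]])
    from bounded_linear.has_vector_derivative[OF bounded_linear_inner_left this, of v]
    have D: "((\<lambda>t. G (p' t) \<bullet> v) has_real_derivative - (c t)\<^sup>2 * (G (H (H (p t))) \<bullet> v)) (at t)"
      by (simp add: has_real_derivative_iff_has_vector_derivative blinfun.scaleR_right blinfun.minus_right)
    have "G (H (H (p t))) \<bullet> v = R (G (H (H (p t)))) \<bullet> y" by (simp add: y sym)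
    also have "R (G (H (H (p t)))) = H (R (G (H (p t))))"
      by (simp only: Phi_commute[OF cut_continuous(1,3)] R_Phi[OF cut_continuous(3)])
    also have "\<dots> = G (H (p t)) - R (G (H (p t)))" by (rule H_R_G)
    also have "G (H (p t)) = H (G (p t))" by (rule Phi_commute[OF cut_continuous(1,3)])
    also have "(H (G (p t)) - R (H (G (p t)))) \<bullet> y = H (G (p t)) \<bullet> Bop v"
      by (simp add: y(1) Bop_R inner_diff_left inner_diff_right sym)
    finally show "((\<lambda>r. G (p' r) \<bullet> v) has_real_derivative - ((c t)\<^sup>2 * (Bop (G (p t)) \<bullet> Bop v))) (at t)"
      using D by (simp add: Bop_G)
  qed (use init pc pd in \<open>auto simp: G_Domain
        intro!: blinfun.continuous_on continuous_on_const bounded_linear.has_vector_derivative[OF blinfun.bounded_linear_right]\<close>)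
  then show ?thesis by blast
qed

end

section \<open>Removal of the cut-off and well-posedness\<close>

lemma G_limit: "(\<lambda>n. Phi (cut (inverse (real (Suc n)))) x) \<longlonglongrightarrow> x"
proof (rule tendstoI)
  fix e :: real assume e: "e > 0"
  have "x \<in> closure (range R)" using dense by simp
  then obtain y where y: "dist (R y) x < e/4"
    using e unfolding closure_approachable by (metis divide_pos_pos rangeE zero_less_numeral)
  have "(\<lambda>n. 2 * inverse (real (Suc n)) * norm y) \<longlonglongrightarrow> 2 * 0 * norm y"
    by (intro tendsto_intros LIMSEQ_inverse_real_of_nat)
  then have "\<forall>\<^sub>F n in sequentially. 2 * inverse (real (Suc n)) * norm y < e/2"
    by (rule order_tendstoD(2)) (use e in simp)
  then show "\<forall>\<^sub>F n in sequentially. dist (Phi (cut (inverse (real (Suc n)))) x) x < e"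
  proof eventually_elim
    case (elim n)
    let ?\<epsilon> = "inverse (real (Suc n))"
    have pos: "?\<epsilon> > 0" by simp
    let ?G = "Phi (cut ?\<epsilon>)"
    have "?G x - x = ?G (x - R y) + (?G (R y) - R y) + (R y - x)" by (simp add: blinfun.diff_right)
    then have "norm (?G x - x) \<le> norm (?G (x - R y)) + norm (?G (R y) - R y) + norm (R y - x)"
      by (metis norm_triangle_mono norm_triangle_ineq order_refl)
    also have "\<dots> \<le> norm (x - R y) + 2 * ?\<epsilon> * norm y + norm (R y - x)"
      by (intro add_mono norm_G_le[OF pos] norm_G_R_diff[OF pos] order_refl)
    also have "\<dots> < e" using y elim by (simp add: dist_norm norm_minus_commute)
    finally show ?case by (simp add: dist_norm)
  qed
qed

text \<open>The bound of \<open>G_apriori\<close> is uniform in the cut-off and therefore survives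
  the limit, taken at the fixed vectors u' t and \<open>Bop (u t)\<close>.\<close>

lemma apriori:
  assumes "wave_solution c B T u0 u1 u u'" and "t \<in> {0..T}"
  shows "norm (u' t) \<le> sqrt K * (norm (Bop u0) + norm u1)"
    "norm (Bop (u t)) \<le> sqrt K * (norm (Bop u0) + norm u1)"
  by (rule tendsto_upperbound[OF tendsto_norm[OF G_limit]],
      rule always_eventually, rule allI, rule G_apriori[OF _ assms], simp, simp)+

text \<open>The energy does not control u itself when 0 lies in the spectrum of B; this norm is
  recovered by integrating u', whence the factor T.\<close>

lemma apriori_norm:
  assumes sol: "wave_solution c B T u0 u1 u u'" and t: "t \<in> {0..T}"
  shows "norm (u t) \<le> norm u0 + T * sqrt K * (norm (Bop u0) + norm u1)"
proof (cases "t = 0")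
  case True
  then show ?thesis using sol K T by (simp add: wave_solution_def)
next
  case False
  let ?M = "sqrt K * (norm (Bop u0) + norm u1)"
  have M: "?M \<ge> 0" using K by simp
  have "norm (u t - u 0) \<le> ?M * t - ?M * 0"
  proof (rule differentiable_bound_general[of 0 t u "\<lambda>s. ?M * s" u' "\<lambda>s. ?M"])
    show "0 < t" using False t by simp
    show "continuous_on {0..t} u" "continuous_on {0..t} (\<lambda>s. ?M * s)"
      using sol t by (auto simp: wave_solution_def intro!: continuous_intros elim: continuous_on_subset)
    fix x assume x: "0 < x" "x < t"
    then have "at x within {0..T} = at x" using t by (intro at_within_interior) auto
    moreover have "(u has_vector_derivative u' x) (at x within {0..T})"
      using sol x t by (simp add: wave_solution_def)
    ultimately show "(u has_vector_derivative u' x) (at x)" by simp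
    show "((\<lambda>s. ?M * s) has_vector_derivative ?M) (at x)"
      unfolding has_real_derivative_iff_has_vector_derivative[symmetric]
      by (auto intro!: derivative_eq_intros)
    show "norm (u' x) \<le> ?M" by (rule apriori(1)[OF sol]) (use x t in auto)
  qed
  also have "\<dots> \<le> ?M * T" using t M by (simp add: mult_left_mono)
  finally have "norm (u t - u 0) \<le> T * ?M" by (simp add: mult.commute)
  moreover have "u 0 = u0" using sol by (simp add: wave_solution_def)
  ultimately show ?thesis using norm_triangle_ineq2[of "u t" u0] by simp
qed

lemma wave_solution_diff:
  assumes u: "wave_solution c B T u0 u1 u u'" and v: "wave_solution c B T v0 v1 v v'"
  shows "wave_solution c B T (u0 - v0) (u1 - v1) (\<lambda>t. u t - v t) (\<lambda>t. u' t - v' t)"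
proof -
  have dom: "u t \<in> Domain B" "v t \<in> Domain B" if "t \<in> {0..T}" for t
    using u v that by (auto simp: wave_solution_def)
  have eq: "Bop (u t - v t) = Bop (u t) - Bop (v t)" if "t \<in> {0..T}" for t
    using Bop_diff dom[OF that] by simp
  show ?thesis
    unfolding wave_solution_def
  proof (intro conjI ballI)
    have "continuous_on {0..T} (\<lambda>t. Bop (u t) - Bop (v t))"
      using u v by (auto simp: wave_solution_def intro!: continuous_intros)
    then show "continuous_on {0..T} (\<lambda>t. Bop (u t - v t))"
      by (rule continuous_on_eq) (simp add: eq)
    fix w t assume w: "w \<in> Domain B" and t: "t \<in> {0<..<T}"
    have D: "((\<lambda>r. u' r \<bullet> w) has_real_derivative - ((c t)\<^sup>2 * (Bop (u t) \<bullet> Bop w))) (at t)"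
      "((\<lambda>r. v' r \<bullet> w) has_real_derivative - ((c t)\<^sup>2 * (Bop (v t) \<bullet> Bop w))) (at t)"
      using u v w t by (auto simp: wave_solution_def)
    show "((\<lambda>r. (u' r - v' r) \<bullet> w) has_real_derivative - ((c t)\<^sup>2 * (Bop (u t - v t) \<bullet> Bop w))) (at t)"
    proof -
      have "Bop (u t - v t) = Bop (u t) - Bop (v t)" using t by (intro eq) simp
      then show ?thesis
        using DERIV_diff[OF D] by (simp add: inner_diff_left right_diff_distrib)
    qed
  qed (use u v dom in \<open>auto simp: wave_solution_def intro!: Domain_B_diff continuous_intros has_vector_derivative_diff\<close>)
qed

lemma uniformly_Cauchy_of_bound:
  fixes f :: "nat \<Rightarrow> real \<Rightarrow> 'h" and a b d :: "nat \<Rightarrow> 'h"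
  assumes "Cauchy a" "Cauchy b" "Cauchy d"
    and bd: "\<And>m n t. t \<in> S \<Longrightarrow> norm (f m t - f n t) \<le> norm (a m - a n) + M * (norm (b m - b n) + norm (d m - d n))"
    and M: "M \<ge> 0"
  shows "uniformly_Cauchy_on S f"
proof (rule uniformly_Cauchy_onI)
  fix e :: real assume e: "e > 0"
  define \<delta> where "\<delta> = e / (1 + 2 * M)"
  have M1: "1 + 2 * M > 0" using M by simp
  have "\<delta> * (1 + 2 * M) = e" using M1 by (simp add: \<delta>_def)
  then have d: "\<delta> > 0" "\<delta> + M * (\<delta> + \<delta>) = e"
    using e M1 by (simp_all add: \<delta>_def algebra_simps add_divide_distrib[symmetric])
  obtain N1 N2 N3 where N: "\<And>m n. m \<ge> N1 \<Longrightarrow> n \<ge> N1 \<Longrightarrow> norm (a m - a n) < \<delta>"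
    "\<And>m n. m \<ge> N2 \<Longrightarrow> n \<ge> N2 \<Longrightarrow> norm (b m - b n) < \<delta>"
    "\<And>m n. m \<ge> N3 \<Longrightarrow> n \<ge> N3 \<Longrightarrow> norm (d m - d n) < \<delta>"
    using assms(1-3) d(1) unfolding Cauchy_iff by metis
  show "\<exists>M. \<forall>x\<in>S. \<forall>m\<ge>M. \<forall>n\<ge>M. dist (f m x) (f n x) < e"
  proof (intro exI[of _ "max N1 (max N2 N3)"] ballI allI impI)
    fix x m n assume x: "x \<in> S" and mn: "max N1 (max N2 N3) \<le> m" "max N1 (max N2 N3) \<le> n"
    have "norm (f m x - f n x) \<le> norm (a m - a n) + M * (norm (b m - b n) + norm (d m - d n))"
      by (rule bd[OF x])
    also have "\<dots> < \<delta> + M * (\<delta> + \<delta>)"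
    proof -
      have "norm (a m - a n) < \<delta>" "norm (b m - b n) < \<delta>" "norm (d m - d n) < \<delta>"
        using N[of m n] mn by auto
      then have "norm (a m - a n) < \<delta>" "M * (norm (b m - b n) + norm (d m - d n)) \<le> M * (\<delta> + \<delta>)"
        using M by (auto intro!: mult_left_mono)
      then show ?thesis by simp
    qed
    finally show "dist (f m x) (f n x) < e" by (simp only: d(2) dist_norm)
  qed
qed

text \<open>The truncated data converge in the graph norm because the cut-off commutes with B on u0.
  The a priori bounds for differences of the solutions give uniform Cauchy sequences for u, u' and B
  u; closedness of B identifies the limit of the last one.\<close>

lemma existence:
  assumes u0: "u0 \<in> Domain B"
  shows "\<exists>u u'. wave_solution c B T u0 u1 u u'"
proof -
  define \<epsilon> where "\<epsilon> n = inverse (real (Suc n))" for n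
  define G where "G n = Phi (cut (\<epsilon> n))" for n
  have eps: "\<epsilon> n > 0" for n by (simp add: \<epsilon>_def)
  have Glim: "(\<lambda>n. G n x) \<longlonglongrightarrow> x" for x unfolding G_def \<epsilon>_def by (rule G_limit)
  have Gdom: "G n x \<in> Domain B" for n x unfolding G_def by (rule G_Domain[OF eps])
  have BG: "Bop (G n u0) = G n (Bop u0)" for n
    unfolding G_def by (simp only: Bop_G[OF eps] G_Bop[OF eps u0])
  have "\<forall>n. \<exists>u u'. wave_solution c B T (G n u0) (G n u1) u u'"
    unfolding G_def using G_existence[OF eps] by blast
  then obtain u u' where sol: "\<And>n. wave_solution c B T (G n u0) (G n u1) (u n) (u' n)" by metis
  have Ca: "Cauchy (\<lambda>n. G n x)" for x using Glim LIMSEQ_imp_Cauchy by blast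
  note Bd = Bop_diff[OF Gdom Gdom]
  \<comment> \<open>The terms with G m 0 - G n 0 vanish; they give all three estimates the shape
    expected by \<open>uniformly_Cauchy_of_bound\<close>.\<close>
  have diff: "norm (u m t - u n t) \<le> norm (G m u0 - G n u0)
        + T * sqrt K * (norm (G m (Bop u0) - G n (Bop u0)) + norm (G m u1 - G n u1))"
    "norm (u' m t - u' n t) \<le> norm (G m 0 - G n 0)
        + sqrt K * (norm (G m (Bop u0) - G n (Bop u0)) + norm (G m u1 - G n u1))"
    "norm (Bop (u m t) - Bop (u n t)) \<le> norm (G m 0 - G n 0)
        + sqrt K * (norm (G m (Bop u0) - G n (Bop u0)) + norm (G m u1 - G n u1))"
    if t: "t \<in> {0..T}" for m n t
  proof -
    note d = wave_solution_diff[OF sol[of m] sol[of n]]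
    have dom: "u m t \<in> Domain B" "u n t \<in> Domain B" using sol t by (auto simp: wave_solution_def)
    show "norm (u m t - u n t) \<le> norm (G m u0 - G n u0)
        + T * sqrt K * (norm (G m (Bop u0) - G n (Bop u0)) + norm (G m u1 - G n u1))"
      using apriori_norm[OF d t] by (simp add: Bd BG)
    show "norm (u' m t - u' n t) \<le> norm (G m 0 - G n 0)
        + sqrt K * (norm (G m (Bop u0) - G n (Bop u0)) + norm (G m u1 - G n u1))"
      using apriori(1)[OF d t] by (simp add: Bd BG)
    show "norm (Bop (u m t) - Bop (u n t)) \<le> norm (G m 0 - G n 0)
        + sqrt K * (norm (G m (Bop u0) - G n (Bop u0)) + norm (G m u1 - G n u1))"
      using apriori(2)[OF d t] by (simp add: Bd BG Bop_diff[OF dom])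
  qed
  obtain U where U: "uniform_limit {0..T} u U sequentially"
    using uniformly_Cauchy_of_bound[OF Ca Ca Ca diff(1)] K T
    by (meson Cauchy_uniformly_convergent uniformly_convergent_on_def less_imp_le mult_nonneg_nonneg real_sqrt_ge_zero)
  obtain U' where U': "uniform_limit {0..T} u' U' sequentially"
    using uniformly_Cauchy_of_bound[OF Ca Ca Ca diff(2)] K
    by (meson Cauchy_uniformly_convergent uniformly_convergent_on_def real_sqrt_ge_zero)
  obtain V where V: "uniform_limit {0..T} (\<lambda>n t. Bop (u n t)) V sequentially"
    using uniformly_Cauchy_of_bound[where f = "\<lambda>n t. Bop (u n t)", OF Ca Ca Ca diff(3)] K
    by (meson Cauchy_uniformly_convergent uniformly_convergent_on_def real_sqrt_ge_zero)
  have lim: "(\<lambda>n. u n t) \<longlonglongrightarrow> U t" "(\<lambda>n. u' n t) \<longlonglongrightarrow> U' t" "(\<lambda>n. Bop (u n t)) \<longlonglongrightarrow> V t"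
    if "t \<in> {0..T}" for t
    using tendsto_uniform_limitI[OF U that] tendsto_uniform_limitI[OF U' that] tendsto_uniform_limitI[OF V that] .
  have dom: "U t \<in> Domain B" "Bop (U t) = V t" if t: "t \<in> {0..T}" for t
    using Domain_B_closed[OF _ lim(1)[OF t] lim(3)[OF t]] sol t by (auto simp: wave_solution_def)
  have "wave_solution c B T u0 u1 U U'"
    unfolding wave_solution_def
  proof (intro conjI ballI)
    show "U t \<in> Domain B" if "t \<in> {0..T}" for t using dom that by simp
    show "continuous_on {0..T} U"
      by (rule uniform_limit_theorem[OF _ U]) (use sol in \<open>auto simp: wave_solution_def\<close>)
    show U'c: "continuous_on {0..T} U'"
      by (rule uniform_limit_theorem[OF _ U']) (use sol in \<open>auto simp: wave_solution_def\<close>)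
    have "continuous_on {0..T} V"
      by (rule uniform_limit_theorem[OF _ V]) (use sol in \<open>auto simp: wave_solution_def\<close>)
    then show "continuous_on {0..T} (\<lambda>t. Bop (U t))" by (rule continuous_on_eq) (simp add: dom)
    have i: "u n 0 = G n u0" "u' n 0 = G n u1" for n using sol[of n] by (auto simp: wave_solution_def)
    have 0: "0 \<in> {0..T}" using T by simp
    show "U 0 = u0" using lim(1)[OF 0] Glim[of u0] by (simp add: i LIMSEQ_unique)
    show "U' 0 = u1" using lim(2)[OF 0] Glim[of u1] by (simp add: i LIMSEQ_unique)
    fix t assume t: "t \<in> {0..T}"
    show "(U has_vector_derivative U' t) (at t within {0..T})"
    proof (rule weak_derivative_imp_strong[OF _ _ U'c t])
      fix y x assume x: "x \<in> {0..T}"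
      show "((\<lambda>s. U s \<bullet> y) has_real_derivative U' x \<bullet> y) (at x within {0..T})"
      proof (rule derivative_of_uniform_limit[OF _ x])
        show "((\<lambda>s. u n s \<bullet> y) has_real_derivative u' n z \<bullet> y) (at z within {0..T})" if "z \<in> {0..T}" for n z
        proof -
          have "(u n has_vector_derivative u' n z) (at z within {0..T})"
            using sol[of n] that by (simp add: wave_solution_def)
          from bounded_linear.has_vector_derivative[OF bounded_linear_inner_left this, of y]
          show ?thesis by (simp only: has_real_derivative_iff_has_vector_derivative)
        qed
        show "(\<lambda>n. u n z \<bullet> y) \<longlonglongrightarrow> U z \<bullet> y" if "z \<in> {0..T}" for z
          by (intro tendsto_intros lim(1)[OF that])
        show "uniform_limit {0..T} (\<lambda>n z. u' n z \<bullet> y) (\<lambda>z. U' z \<bullet> y) sequentially"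
          by (rule bounded_linear.uniform_limit[OF bounded_linear_inner_left U'])
      qed simp
    qed simp
  next
    fix v t assume v: "v \<in> Domain B" and t: "t \<in> {0<..<T}"
    \<comment> \<open>9/4 bounds the square of the speed, and adding 1 keeps C positive when B v =
      0.\<close>
    define C where "C = 9/4 * norm (Bop v) + 1"
    have C: "C > 0" by (simp add: C_def add_nonneg_pos)
    have ul: "uniform_limit {0<..<T} (\<lambda>n x. - ((c x)\<^sup>2 * (Bop (u n x) \<bullet> Bop v)))
       (\<lambda>x. - ((c x)\<^sup>2 * (V x \<bullet> Bop v))) sequentially"
    proof (rule uniform_limitI)
      fix e :: real assume e: "e > 0"
      have "\<forall>\<^sub>F n in sequentially. \<forall>x\<in>{0..T}. dist (Bop (u n x)) (V x) < e / C"
        using uniform_limitD[OF V] e C by simp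
      then show "\<forall>\<^sub>F n in sequentially. \<forall>x\<in>{0<..<T}.
          dist (- ((c x)\<^sup>2 * (Bop (u n x) \<bullet> Bop v))) (- ((c x)\<^sup>2 * (V x \<bullet> Bop v))) < e"
      proof eventually_elim
        case (elim n)
        show ?case
        proof
          fix x assume x: "x \<in> {0<..<T}"
          have c2: "(c x)\<^sup>2 \<le> 9/4"
            using abs_le_square_iff[of "c x" "3/2"] c_le[of x] x by (simp add: power2_eq_square)
          have b: "norm (Bop (u n x) - V x) < e / C" using elim x by (simp add: dist_norm)
          have "dist (- ((c x)\<^sup>2 * (Bop (u n x) \<bullet> Bop v))) (- ((c x)\<^sup>2 * (V x \<bullet> Bop v)))
            = (c x)\<^sup>2 * \<bar>(Bop (u n x) - V x) \<bullet> Bop v\<bar>"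
            by (simp add: dist_real_def inner_diff_left right_diff_distrib[symmetric] abs_mult abs_minus_commute)
          also have "\<dots> \<le> 9/4 * (norm (Bop (u n x) - V x) * norm (Bop v))"
            by (intro mult_mono c2 Cauchy_Schwarz_ineq2) auto
          also have "\<dots> = norm (Bop (u n x) - V x) * (9/4 * norm (Bop v))" by simp
          also have "\<dots> \<le> e / C * (9/4 * norm (Bop v))"
            using b by (intro mult_right_mono) auto
          also have "\<dots> < e / C * C" using e C by (intro mult_strict_left_mono) (auto simp: C_def)
          finally show "dist (- ((c x)\<^sup>2 * (Bop (u n x) \<bullet> Bop v))) (- ((c x)\<^sup>2 * (V x \<bullet> Bop v))) < e"
            using C by simp
        qed
      qed
    qed
    have "((\<lambda>x. U' x \<bullet> v) has_real_derivative - ((c t)\<^sup>2 * (V t \<bullet> Bop v))) (at t within {0<..<T})"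
    proof (rule derivative_of_uniform_limit[OF _ t _ _ ul])
      show "((\<lambda>x. u' n x \<bullet> v) has_real_derivative - ((c x)\<^sup>2 * (Bop (u n x) \<bullet> Bop v))) (at x within {0<..<T})"
        if "x \<in> {0<..<T}" for n x
        using sol[of n] that v by (simp add: wave_solution_def has_field_derivative_at_within)
      show "(\<lambda>n. u' n x \<bullet> v) \<longlonglongrightarrow> U' x \<bullet> v" if "x \<in> {0<..<T}" for x
        by (intro tendsto_intros lim(2)) (use that in simp)
    qed simp
    then have "((\<lambda>x. U' x \<bullet> v) has_real_derivative - ((c t)\<^sup>2 * (V t \<bullet> Bop v))) (at t)"
      by (simp only: at_within_open[OF t open_greaterThanLessThan])
    then show "((\<lambda>r. U' r \<bullet> v) has_real_derivative - ((c t)\<^sup>2 * (Bop (U t) \<bullet> Bop v))) (at t)"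
      using dom(2)[of t] t by simp
  qed
  then show ?thesis by blast
qed

lemma uniqueness:
  assumes "wave_solution c B T u0 u1 u u'" "wave_solution c B T u0 u1 v v'" "t \<in> {0..T}"
  shows "u t = v t"
proof -
  have "Bop 0 = 0" using Bop_R[of 0] linear_0[OF R_lin] by simp
  then show ?thesis using apriori_norm[OF wave_solution_diff[OF assms(1,2)] assms(3)] by simp
qed

lemma continuous_dependence:
  assumes u0: "u0 \<in> Domain B" and e: "e > 0"
  shows "\<exists>\<delta>>0. \<forall>v0\<in>Domain B. \<forall>v1 u u' v v'. graph_norm B (v0 - u0) < \<delta> \<longrightarrow> norm (v1 - u1) < \<delta> \<longrightarrow>
        wave_solution c B T u0 u1 u u' \<longrightarrow> wave_solution c B T v0 v1 v v' \<longrightarrow>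
        (\<forall>t\<in>{0..T}. graph_norm B (v t - u t) < e \<and> norm (v' t - u' t) < e)"
proof -
  define S where "S = sqrt K"
  have S: "S \<ge> 0" using K by (simp add: S_def)
  \<comment> \<open>The sum of the a priori constants: 1 + 2 T S for the norm of the difference and
    2 S for its image under B, each for data of size d.\<close>
  define M where "M = 1 + 2 * T * S + 2 * S"
  have M: "M \<ge> 1" using S T by (simp add: M_def)
  show ?thesis
  proof (intro exI[of _ "e / M"] conjI ballI allI impI)
    show "e / M > 0" using e M by simp
    fix v0 v1 u u' v v' t
    assume v0: "v0 \<in> Domain B" and g: "graph_norm B (v0 - u0) < e / M" and n: "norm (v1 - u1) < e / M"
      and u: "wave_solution c B T u0 u1 u u'" and v: "wave_solution c B T v0 v1 v v'" and t: "t \<in> {0..T}"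
    define d where "d = max (graph_norm B (v0 - u0)) (norm (v1 - u1))"
    have d: "d < e / M" using g n by (simp add: d_def)
    have d0: "norm (v0 - u0) \<le> d" "norm (Bop (v0 - u0)) \<le> d" "norm (v1 - u1) \<le> d"
      unfolding d_def graph_norm_def by (auto intro!: max.coboundedI1 real_le_rsqrt)
    then have d_nn: "d \<ge> 0" using norm_ge_zero order_trans by blast
    note sol = wave_solution_diff[OF v u]
    have s: "S * (norm (Bop (v0 - u0)) + norm (v1 - u1)) \<le> S * (d + d)"
      using d0 S by (intro mult_left_mono add_mono) auto
    have 1: "norm (v' t - u' t) \<le> 2 * S * d" "norm (Bop (v t - u t)) \<le> 2 * S * d"
      using apriori[OF sol t] s by (simp_all add: S_def)
    have "norm (v t - u t) \<le> norm (v0 - u0) + T * (S * (norm (Bop (v0 - u0)) + norm (v1 - u1)))"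
      using apriori_norm[OF sol t] by (simp add: S_def mult.assoc)
    also have "\<dots> \<le> d + T * (S * (d + d))"
      using d0(1) mult_left_mono[OF s, of T] T by (intro add_mono) auto
    finally have 2: "norm (v t - u t) \<le> d + 2 * T * S * d" by (simp add: algebra_simps)
    have "graph_norm B (v t - u t) \<le> norm (v t - u t) + norm (Bop (v t - u t))"
      unfolding graph_norm_def by (rule sqrt_sum_squares_le_sum) auto
    also have "\<dots> \<le> M * d" using 1 2 by (simp add: M_def algebra_simps)
    also have "\<dots> < e" using d M by (simp add: pos_less_divide_eq mult.commute)
    finally show "graph_norm B (v t - u t) < e" .
    have "2 * S * d \<le> M * d" using d_nn T S by (intro mult_right_mono) (auto simp: M_def)
    also have "\<dots> < e" using d M by (simp add: pos_less_divide_eq mult.commute)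
    finally show "norm (v' t - u' t) < e" using 1 by simp
  qed
qed

end

lemma wave_well_posed_of_energy_bound:
  fixes A :: "('h::{real_inner, complete_space} \<times> 'h) set"
  assumes c: "continuous_on {0<..} c" "\<And>t. t > 0 \<Longrightarrow> \<bar>c t\<bar> \<le> 3/2" and energy: "scalar_energy_bound c"
    and A: "self_adjoint_op A" "nonneg_op A"
  shows "wave_well_posed c A"
proof -
  define B where "B = sqrt_op A"
  obtain R where "is_resolvent B R"
    using resolvent_exists[OF sqrt_op[OF A]] unfolding B_def by blast
  then have R: "unit_interval_op R" "B = range (\<lambda>z. (R z, z - R z))" "closure (range R) = UNIV" "inj R"
    by (simp_all add: is_resolvent_def)
  have wp: "\<exists>K. wave_problem R c T K B" if T: "T > 0" for T
  proof -
    obtain K where K: "\<And>\<mu> w w'. \<mu> \<ge> 0 \<Longrightarrow> continuous_on {0..T} w \<and> continuous_on {0..T} w' \<and>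
     (\<forall>t\<in>{0<..<T}. (w has_real_derivative w' t) (at t) \<and>
        (w' has_real_derivative - (\<mu>\<^sup>2 * (c t)\<^sup>2 * w t)) (at t)) \<Longrightarrow>
     (\<forall>t\<in>{0..T}. (w' t)\<^sup>2 + \<mu>\<^sup>2 * (w t)\<^sup>2 \<le> K * ((w' 0)\<^sup>2 + \<mu>\<^sup>2 * (w 0)\<^sup>2))"
      using energy T unfolding scalar_energy_bound_def by meson
    \<comment> \<open>The scalar estimate does not provide the sign of K; the absolute value does no
      harm since the initial energy is nonnegative.\<close>
    have "wave_problem R c T \<bar>K\<bar> B"
    proof (intro wave_problem.intro bounded_wave.intro bounded_wave_axioms.intro wave_problem_axioms.intro R c T)
      fix \<mu> t :: real and w w' :: "real \<Rightarrow> real"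
      assume *: "\<mu> \<ge> 0" "continuous_on {0..T} w" "continuous_on {0..T} w'"
        "\<And>t. t \<in> {0<..<T} \<Longrightarrow> (w has_real_derivative w' t) (at t)"
        "\<And>t. t \<in> {0<..<T} \<Longrightarrow> (w' has_real_derivative - (\<mu>\<^sup>2 * (c t)\<^sup>2 * w t)) (at t)" "t \<in> {0..T}"
      have "(w' t)\<^sup>2 + \<mu>\<^sup>2 * (w t)\<^sup>2 \<le> K * ((w' 0)\<^sup>2 + \<mu>\<^sup>2 * (w 0)\<^sup>2)"
        using K[OF *(1), of w w'] * by blast
      also have "\<dots> \<le> \<bar>K\<bar> * ((w' 0)\<^sup>2 + \<mu>\<^sup>2 * (w 0)\<^sup>2)" by (intro mult_right_mono) auto
      finally show "(w' t)\<^sup>2 + \<mu>\<^sup>2 * (w t)\<^sup>2 \<le> \<bar>K\<bar> * ((w' 0)\<^sup>2 + \<mu>\<^sup>2 * (w 0)\<^sup>2)" .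
    qed auto
    then show ?thesis ..
  qed
  show ?thesis
    unfolding wave_well_posed_def B_def[symmetric]
  proof (intro allI impI ballI)
    fix T :: real and u0 u1 :: 'h
    assume "T > 0" and u0: "u0 \<in> Domain B"
    then obtain K where "wave_problem R c T K B" using wp by blast
    \<comment> \<open>K depends on T, so the operator theory is instantiated anew for each T, always
      with the same R and B.\<close>
    then interpret wave_problem R c T K B .
    show "(\<exists>u u'. wave_solution c B T u0 u1 u u') \<and>
     (\<forall>u u' v v'. wave_solution c B T u0 u1 u u' \<longrightarrow>
        wave_solution c B T u0 u1 v v' \<longrightarrow> (\<forall>t\<in>{0..T}. u t = v t)) \<and>
     (\<forall>\<epsilon>>0. \<exists>\<delta>>0. \<forall>v0\<in>Domain B. \<forall>v1 u u' v v'.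
        graph_norm B (v0 - u0) < \<delta> \<longrightarrow> norm (v1 - u1) < \<delta> \<longrightarrow>
        wave_solution c B T u0 u1 u u' \<longrightarrow>
        wave_solution c B T v0 v1 v v' \<longrightarrow>
        (\<forall>t\<in>{0..T}. graph_norm B (v t - u t) < \<epsilon> \<and> norm (v' t - u' t) < \<epsilon>))"
      using existence[OF u0] uniqueness continuous_dependence[OF u0] by blast
  qed
qed

theorem theorem7p1:
  shows "smooth_on {0<..} wave_speed \<and>
    (\<forall>t>0. wave_speed t \<in> {1/2..3/2}) \<and>
    (\<forall>T>0. \<forall>s>1/2. wave_speed \<notin> sobolev_W1 s T) \<and>
    (\<forall>A :: ('h::{real_inner, complete_space} \<times> 'h) set.
       self_adjoint_op A \<and> nonneg_op A \<longrightarrow> wave_well_posed wave_speed A)"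
proof -
  have speed: "rough_speed wave_speed" "scalar_energy_bound wave_speed"
    using someI_ex[OF rough_speed_exists] by (simp_all add: wave_speed_def)
  have smooth: "smooth_on {0<..} wave_speed" and range: "\<And>t. t > 0 \<Longrightarrow> wave_speed t \<in> {1/2..3/2}"
    using speed(1) by (auto simp: rough_speed_def)
  have "wave_speed field_differentiable at t" if "t > 0" for t
    using smooth that unfolding smooth_on_def by (metis funpow_0 greaterThan_iff)
  then have cont: "continuous_on {0<..} wave_speed"
    by (intro continuous_at_imp_continuous_on ballI field_differentiable_imp_continuous_at) simp
  have "\<bar>wave_speed t\<bar> \<le> 3/2" if "t > 0" for t
    using range[OF that] by (simp add: abs_le_iff)
  from wave_well_posed_of_energy_bound[OF cont this speed(2)]
  have "wave_well_posed wave_speed A" if "self_adjoint_op A \<and> nonneg_op A" for A :: "('h \<times> 'h) set"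
    using that by blast
  with speed(1) show ?thesis by (simp add: rough_speed_def)
qed

end
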